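(* Let $R$ be an arithmetical ring and let $n\geq 3$ be an integer. Then $\mathrm{SL}_n(R[x])=\mathrm{SL}_n(R)\cdot E_n(R[x])$, where the right-hand side is the set of products $A\cdot B$ with $A\in \mathrm{SL}_n(R)$ (viewed as a constant matrix over $R[x]$) and $B\in E_n(R[x])$.
   Context: All rings are commutative with unity. A valuation ring is a commutative ring $V$ whose principal ideals are totally ordered by inclusion, i.e. for any $a,b\in V$ either $a\mid b$ or $b\mid a$ (zero divisors are allowed; $V$ need not be a domain). A commutative ring $R$ is arithmetical if the localization $R_m$ is a valuation ring (in this sense) for every maximal ideal $m$ of $R$. For a commutative ring $S$, $\mathrm{SL}_n(S)$ is the group of $n\times n$ matrices over $S$ of determinant $1$, and $E_n(S)$ is the subgroup generated by the elementary matrices $I_n+a\,\mathbf{e}_{ij}$ with $a\in S$, $i\neq j$, where $\mathbf{e}_{ij}$ is the matrix whose only nonzero entry is $1$ at position $(i,j)$. *)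

theory Defs
  imports
    "Jordan_Normal_Form.Determinant"
    "HOL-Computational_Algebra.Polynomial"
    "HOL-Algebra.QuotRing"
    "HOL-Algebra.Generated_Groups"
    "HOL-Algebra.Algebraic_Closure_Type"
begin

section \<open>Localizations and arithmetical rings\<close>

text \<open>A pair \<open>(a, s)\<close> stands for the fraction \<open>a / s\<close>. As zero divisors are allowed, two
  fractions \<open>a / s\<close> and \<open>b / t\<close> are equal iff \<open>a t - b s\<close> is annihilated by an element of \<open>S\<close>.\<close>

definition frac_rel :: "('a, 'b) ring_scheme \<Rightarrow> 'a set \<Rightarrow> (('a \<times> 'a) \<times> ('a \<times> 'a)) set" where
  "frac_rel R S = {((a, s), (b, t)). a \<in> carrier R \<and> b \<in> carrier R \<and> s \<in> S \<and> t \<in> S \<and>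
     (\<exists>u\<in>S. u \<otimes>\<^bsub>R\<^esub> ((a \<otimes>\<^bsub>R\<^esub> t) \<ominus>\<^bsub>R\<^esub> (b \<otimes>\<^bsub>R\<^esub> s)) = \<zero>\<^bsub>R\<^esub>)}"

definition fraction :: "('a, 'b) ring_scheme \<Rightarrow> 'a set \<Rightarrow> 'a \<Rightarrow> 'a \<Rightarrow> ('a \<times> 'a) set" where
  "fraction R S a s = frac_rel R S `` {(a, s)}"

text \<open>The operations are given on representatives; the unions below range over the
  representatives of the two classes and do not depend on them (see \<open>localization_mult\<close> and
  \<open>localization_add\<close>).\<close>

definition localization :: "('a, 'b) ring_scheme \<Rightarrow> 'a set \<Rightarrow> ('a \<times> 'a) set ring" where
  "localization R S =
    \<lparr>carrier = (carrier R \<times> S) // frac_rel R S,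
     monoid.mult = (\<lambda>P Q. \<Union>(a, s)\<in>P. \<Union>(b, t)\<in>Q. fraction R S (a \<otimes>\<^bsub>R\<^esub> b) (s \<otimes>\<^bsub>R\<^esub> t)),
     one = fraction R S \<one>\<^bsub>R\<^esub> \<one>\<^bsub>R\<^esub>,
     zero = fraction R S \<zero>\<^bsub>R\<^esub> \<one>\<^bsub>R\<^esub>,
     add = (\<lambda>P Q. \<Union>(a, s)\<in>P. \<Union>(b, t)\<in>Q.
              fraction R S ((a \<otimes>\<^bsub>R\<^esub> t) \<oplus>\<^bsub>R\<^esub> (b \<otimes>\<^bsub>R\<^esub> s)) (s \<otimes>\<^bsub>R\<^esub> t))\<rparr>"

definition valuation_ring :: "('a, 'b) ring_scheme \<Rightarrow> bool" where
  "valuation_ring V \<longleftrightarrow> cring V \<and>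
     (\<forall>a\<in>carrier V. \<forall>b\<in>carrier V. PIdl\<^bsub>V\<^esub> a \<subseteq> PIdl\<^bsub>V\<^esub> b \<or> PIdl\<^bsub>V\<^esub> b \<subseteq> PIdl\<^bsub>V\<^esub> a)"

definition arithmetical_ring :: "('a, 'b) ring_scheme \<Rightarrow> bool" where
  "arithmetical_ring R \<longleftrightarrow> cring R \<and>
     (\<forall>m. maximalideal m R \<longrightarrow> valuation_ring (localization R (carrier R - m)))"

locale cring_localization = cring R for R (structure) +
  fixes S
  assumes S: "submonoid S R"
begin

lemma S_carr [simp, intro]: "s \<in> S \<Longrightarrow> s \<in> carrier R"
  using submonoid.mem_carrier[OF S] .

lemma S_mult [simp, intro]: "s \<in> S \<Longrightarrow> t \<in> S \<Longrightarrow> s \<otimes> t \<in> S"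
  using submonoid.m_closed[OF S] .

lemma S_one [simp, intro]: "\<one> \<in> S"
  using submonoid.one_closed[OF S] .

lemma frac_relI:
  assumes "a \<in> carrier R" "b \<in> carrier R" "s \<in> S" "t \<in> S" "u \<in> S"
    and "u \<otimes> (a \<otimes> t) = u \<otimes> (b \<otimes> s)"
  shows "((a, s), (b, t)) \<in> frac_rel R S"
proof -
  have "u \<otimes> ((a \<otimes> t) \<ominus> (b \<otimes> s)) = u \<otimes> (a \<otimes> t) \<ominus> u \<otimes> (b \<otimes> s)"
    using assms(1,2) S_carr[OF assms(3)] S_carr[OF assms(4)] S_carr[OF assms(5)] by algebra
  then show ?thesis unfolding frac_rel_def using assms
    by (auto intro!: bexI[of _ u])
qed

lemma frac_relE:
  assumes "((a, s), (b, t)) \<in> frac_rel R S"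
  obtains u where "a \<in> carrier R" "b \<in> carrier R" "s \<in> S" "t \<in> S" "u \<in> S"
    and "u \<otimes> (a \<otimes> t) = u \<otimes> (b \<otimes> s)"
proof -
  from assms obtain u where u: "a \<in> carrier R" "b \<in> carrier R" "s \<in> S" "t \<in> S" "u \<in> S"
    "u \<otimes> ((a \<otimes> t) \<ominus> (b \<otimes> s)) = \<zero>" unfolding frac_rel_def by auto
  have "u \<otimes> (a \<otimes> t) = u \<otimes> ((a \<otimes> t) \<ominus> (b \<otimes> s)) \<oplus> u \<otimes> (b \<otimes> s)"
    using S_carr[OF u(3)] S_carr[OF u(4)] S_carr[OF u(5)] u(1,2) by algebra
  also have "\<dots> = u \<otimes> (b \<otimes> s)" using u by simp
  finally show thesis using that u by blast
qed

lemma equiv_frac_rel: "equiv (carrier R \<times> S) (frac_rel R S)"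
proof (rule equivI)
  show "frac_rel R S \<subseteq> (carrier R \<times> S) \<times> (carrier R \<times> S)"
    unfolding frac_rel_def by auto
  show "refl_on (carrier R \<times> S) (frac_rel R S)"
    by (rule refl_onI) (auto intro: frac_relI[where u = \<one>])
  show "sym (frac_rel R S)"
    by (rule symI) (clarsimp, erule frac_relE, erule (4) frac_relI[OF _ _ _ _ _ sym])
  show "trans (frac_rel R S)"
  proof (rule transI, clarify)
    fix a s b t c r
    assume "((a, s), (b, t)) \<in> frac_rel R S" "((b, t), (c, r)) \<in> frac_rel R S"
    then obtain u v where u: "a \<in> carrier R" "b \<in> carrier R" "s \<in> S" "t \<in> S" "u \<in> S"
      "u \<otimes> (a \<otimes> t) = u \<otimes> (b \<otimes> s)" and v: "c \<in> carrier R" "r \<in> S" "v \<in> S"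
      "v \<otimes> (b \<otimes> r) = v \<otimes> (c \<otimes> t)"
      by (elim frac_relE) blast
    note c = u(1,2) v(1) S_carr[OF u(3)] S_carr[OF u(4)] S_carr[OF u(5)] S_carr[OF v(2)] S_carr[OF v(3)]
    have "(u \<otimes> v \<otimes> t) \<otimes> (a \<otimes> r) = (v \<otimes> r) \<otimes> (u \<otimes> (a \<otimes> t))" using c by algebra
    also have "\<dots> = (u \<otimes> s) \<otimes> (v \<otimes> (b \<otimes> r))" unfolding u(6) using c by algebra
    also have "\<dots> = (u \<otimes> v \<otimes> t) \<otimes> (c \<otimes> s)" unfolding v(4) using c by algebra
    finally show "((a, s), (c, r)) \<in> frac_rel R S"
      by (intro frac_relI[where u = "u \<otimes> v \<otimes> t"]) (use u v in auto)
  qed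
qed

lemma fraction_eq_iff:
  assumes "a \<in> carrier R" "b \<in> carrier R" "s \<in> S" "t \<in> S"
  shows "fraction R S a s = fraction R S b t \<longleftrightarrow> (\<exists>u\<in>S. u \<otimes> (a \<otimes> t) = u \<otimes> (b \<otimes> s))"
proof -
  have "fraction R S a s = fraction R S b t \<longleftrightarrow> ((a, s), (b, t)) \<in> frac_rel R S"
    unfolding fraction_def using eq_equiv_class_iff[OF equiv_frac_rel] assms by auto
  also have "\<dots> \<longleftrightarrow> (\<exists>u\<in>S. u \<otimes> (a \<otimes> t) = u \<otimes> (b \<otimes> s))"
    using assms by (auto elim: frac_relE intro: frac_relI)
  finally show ?thesis .
qed

lemma fraction_closed [simp]: "a \<in> carrier R \<Longrightarrow> s \<in> S \<Longrightarrow> fraction R S a s \<in> carrier (localization R S)"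
  unfolding localization_def fraction_def by (auto intro: quotientI)

lemma localization_carrierE:
  assumes "P \<in> carrier (localization R S)"
  obtains a s where "a \<in> carrier R" "s \<in> S" "P = fraction R S a s"
  using assms unfolding localization_def fraction_def by (auto elim!: quotientE)

lemma localization_mult:
  assumes "a \<in> carrier R" "b \<in> carrier R" "s \<in> S" "t \<in> S"
  shows "fraction R S a s \<otimes>\<^bsub>localization R S\<^esub> fraction R S b t = fraction R S (a \<otimes> b) (s \<otimes> t)"
proof -
  let ?f = "\<lambda>p q. fraction R S (fst p \<otimes> fst q) (snd p \<otimes> snd q)"
  have "congruent2 (frac_rel R S) (frac_rel R S) ?f"
  proof (rule congruent2I[OF equiv_frac_rel equiv_frac_rel])
    fix p q r assume pq: "(p, q) \<in> frac_rel R S" and r: "r \<in> carrier R \<times> S"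
    obtain a s b t c z where e: "p = (a, s)" "q = (b, t)" "r = (c, z)" by (metis surj_pair)
    from pq obtain u where u: "a \<in> carrier R" "b \<in> carrier R" "s \<in> S" "t \<in> S" "u \<in> S"
      "u \<otimes> (a \<otimes> t) = u \<otimes> (b \<otimes> s)" unfolding e by (elim frac_relE)
    have c: "c \<in> carrier R" "z \<in> S" using r e by auto
    note k = u(1,2) S_carr[OF u(3)] S_carr[OF u(4)] S_carr[OF u(5)] c(1) S_carr[OF c(2)]
    have "u \<otimes> ((a \<otimes> c) \<otimes> (t \<otimes> z)) = (c \<otimes> z) \<otimes> (u \<otimes> (a \<otimes> t))" using k by algebra
    also have "\<dots> = u \<otimes> ((b \<otimes> c) \<otimes> (s \<otimes> z))" unfolding u(6) using k by algebra
    finally show "?f p r = ?f q r" unfolding e using u c by (auto simp: fraction_eq_iff)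
    have "u \<otimes> ((c \<otimes> a) \<otimes> (z \<otimes> t)) = (c \<otimes> z) \<otimes> (u \<otimes> (a \<otimes> t))" using k by algebra
    also have "\<dots> = u \<otimes> ((c \<otimes> b) \<otimes> (z \<otimes> s))" unfolding u(6) using k by algebra
    finally show "?f r p = ?f r q" unfolding e using u c by (auto simp: fraction_eq_iff)
  qed
  from UN_equiv_class2[OF equiv_frac_rel equiv_frac_rel this, of "(a, s)" "(b, t)"] assms
  show ?thesis unfolding localization_def
    by (simp add: case_prod_unfold) (simp add: fraction_def)
qed

lemma localization_add:
  assumes "a \<in> carrier R" "b \<in> carrier R" "s \<in> S" "t \<in> S"
  shows "fraction R S a s \<oplus>\<^bsub>localization R S\<^esub> fraction R S b t =
    fraction R S ((a \<otimes> t) \<oplus> (b \<otimes> s)) (s \<otimes> t)"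
proof -
  let ?f = "\<lambda>p q. fraction R S ((fst p \<otimes> snd q) \<oplus> (fst q \<otimes> snd p)) (snd p \<otimes> snd q)"
  have "congruent2 (frac_rel R S) (frac_rel R S) ?f"
  proof (rule congruent2I[OF equiv_frac_rel equiv_frac_rel])
    fix p q r assume pq: "(p, q) \<in> frac_rel R S" and r: "r \<in> carrier R \<times> S"
    obtain a s b t c z where e: "p = (a, s)" "q = (b, t)" "r = (c, z)" by (metis surj_pair)
    from pq obtain u where u: "a \<in> carrier R" "b \<in> carrier R" "s \<in> S" "t \<in> S" "u \<in> S"
      "u \<otimes> (a \<otimes> t) = u \<otimes> (b \<otimes> s)" unfolding e by (elim frac_relE)
    have c: "c \<in> carrier R" "z \<in> S" using r e by auto
    note k = u(1,2) S_carr[OF u(3)] S_carr[OF u(4)] S_carr[OF u(5)] c(1) S_carr[OF c(2)]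
    have "u \<otimes> ((a \<otimes> z \<oplus> c \<otimes> s) \<otimes> (t \<otimes> z)) =
      (z \<otimes> z) \<otimes> (u \<otimes> (a \<otimes> t)) \<oplus> u \<otimes> c \<otimes> s \<otimes> t \<otimes> z" using k by algebra
    also have "\<dots> = u \<otimes> ((b \<otimes> z \<oplus> c \<otimes> t) \<otimes> (s \<otimes> z))" unfolding u(6) using k by algebra
    finally show "?f p r = ?f q r" unfolding e using u c by (auto simp: fraction_eq_iff)
    have "u \<otimes> ((c \<otimes> s \<oplus> a \<otimes> z) \<otimes> (z \<otimes> t)) =
      (z \<otimes> z) \<otimes> (u \<otimes> (a \<otimes> t)) \<oplus> u \<otimes> c \<otimes> s \<otimes> t \<otimes> z" using k by algebra
    also have "\<dots> = u \<otimes> ((c \<otimes> t \<oplus> b \<otimes> z) \<otimes> (z \<otimes> s))" unfolding u(6) using k by algebra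
    finally show "?f r p = ?f r q" unfolding e using u c by (auto simp: fraction_eq_iff)
  qed
  from UN_equiv_class2[OF equiv_frac_rel equiv_frac_rel this, of "(a, s)" "(b, t)"] assms
  show ?thesis unfolding localization_def
    by (simp add: case_prod_unfold) (simp add: fraction_def)
qed

lemma localization_one: "\<one>\<^bsub>localization R S\<^esub> = fraction R S \<one> \<one>"
  and localization_zero: "\<zero>\<^bsub>localization R S\<^esub> = fraction R S \<zero> \<one>"
  unfolding localization_def by simp_all

lemma fraction_eqI:
  assumes "a \<in> carrier R" "b \<in> carrier R" "s \<in> S" "t \<in> S" "a \<otimes> t = b \<otimes> s"
  shows "fraction R S a s = fraction R S b t"
  using assms by (subst fraction_eq_iff) (auto intro!: bexI[of _ \<one>])

lemma cring_localization: "cring (localization R S)"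
proof (rule cringI)
  note loc = localization_mult localization_add localization_one localization_zero
  show "abelian_group (localization R S)"
  proof (rule abelian_groupI)
    fix P Q assume "P \<in> carrier (localization R S)" "Q \<in> carrier (localization R S)"
    then obtain a s b t where k: "a \<in> carrier R" "s \<in> S" "P = fraction R S a s"
      "b \<in> carrier R" "t \<in> S" "Q = fraction R S b t" by (elim localization_carrierE)
    show "P \<oplus>\<^bsub>localization R S\<^esub> Q \<in> carrier (localization R S)" using k by (auto simp: loc)
    show "P \<oplus>\<^bsub>localization R S\<^esub> Q = Q \<oplus>\<^bsub>localization R S\<^esub> P"
      using k by (auto simp: loc a_comm m_comm)
    show "\<zero>\<^bsub>localization R S\<^esub> \<oplus>\<^bsub>localization R S\<^esub> P = P" using k by (auto simp: loc)
    show "\<exists>W\<in>carrier (localization R S). W \<oplus>\<^bsub>localization R S\<^esub> P = \<zero>\<^bsub>localization R S\<^esub>"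
    proof (intro bexI)
      have "fraction R S \<zero> (s \<otimes> s) = fraction R S \<zero> \<one>"
        using k by (intro fraction_eqI) auto
      then show "fraction R S (\<ominus> a) s \<oplus>\<^bsub>localization R S\<^esub> P = \<zero>\<^bsub>localization R S\<^esub>"
        using k by (simp add: loc l_minus l_neg)
    qed (use k in auto)
    fix W assume "W \<in> carrier (localization R S)"
    then obtain c r where c: "c \<in> carrier R" "r \<in> S" "W = fraction R S c r"
      by (elim localization_carrierE)
    note m = k(1,4) c(1) S_carr[OF k(2)] S_carr[OF k(5)] S_carr[OF c(2)]
    have "(a \<otimes> t \<oplus> b \<otimes> s) \<otimes> r \<oplus> c \<otimes> (s \<otimes> t) = a \<otimes> (t \<otimes> r) \<oplus> (b \<otimes> r \<oplus> c \<otimes> t) \<otimes> s"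
      using m by algebra
    then show "P \<oplus>\<^bsub>localization R S\<^esub> Q \<oplus>\<^bsub>localization R S\<^esub> W =
      P \<oplus>\<^bsub>localization R S\<^esub> (Q \<oplus>\<^bsub>localization R S\<^esub> W)"
      using k c by (auto simp: loc m_assoc)
  qed (auto simp: loc)
  show "comm_monoid (localization R S)"
    by (rule comm_monoidI)
      (auto elim!: localization_carrierE simp: loc m_ac)
  fix P Q W
  assume "P \<in> carrier (localization R S)" "Q \<in> carrier (localization R S)"
    "W \<in> carrier (localization R S)"
  then obtain a s b t c r where k: "a \<in> carrier R" "s \<in> S" "P = fraction R S a s"
      "b \<in> carrier R" "t \<in> S" "Q = fraction R S b t" "c \<in> carrier R" "r \<in> S" "W = fraction R S c r"
    by (elim localization_carrierE)
  note m = k(1,4,7) S_carr[OF k(2)] S_carr[OF k(5)] S_carr[OF k(8)]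
  have "(a \<otimes> t \<oplus> b \<otimes> s) \<otimes> c \<otimes> (s \<otimes> r \<otimes> (t \<otimes> r)) =
    (a \<otimes> c \<otimes> (t \<otimes> r) \<oplus> b \<otimes> c \<otimes> (s \<otimes> r)) \<otimes> (s \<otimes> t \<otimes> r)" using m by algebra
  then show "(P \<oplus>\<^bsub>localization R S\<^esub> Q) \<otimes>\<^bsub>localization R S\<^esub> W =
    P \<otimes>\<^bsub>localization R S\<^esub> W \<oplus>\<^bsub>localization R S\<^esub> Q \<otimes>\<^bsub>localization R S\<^esub> W"
    using k by (simp add: loc) (rule fraction_eqI, simp_all)
qed

end

lemma (in cring) submonoid_compl_maximalideal:
  assumes "maximalideal m R"
  shows "submonoid (carrier R - m) R"
proof -
  interpret m: primeideal m R using maximalideal_prime[OF assms] .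
  show ?thesis
    by unfold_locales (use m.I_prime m.I_notcarr m.one_imp_carrier in auto)
qed

lemma (in cring) valuation_ring_iff:
  "valuation_ring R \<longleftrightarrow> (\<forall>a\<in>carrier R. \<forall>b\<in>carrier R. a divides b \<or> b divides a)"
  unfolding valuation_ring_def using is_cring by (auto simp: to_contain_is_to_divide)

section \<open>Special linear and elementary groups\<close>

definition SL :: "nat \<Rightarrow> 'a::comm_ring_1 mat monoid" where
  "SL n = \<lparr>carrier = {A \<in> carrier_mat n n. det A = 1}, monoid.mult = (*), one = 1\<^sub>m n\<rparr>"

text \<open>The matrix with entry \<open>1\<close> at position \<open>(i, j)\<close> and \<open>0\<close> elsewhere; indices start at \<open>0\<close>.\<close>

definition unit_mat :: "nat \<Rightarrow> nat \<Rightarrow> nat \<Rightarrow> 'a::comm_ring_1 mat" where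
  "unit_mat n i j = mat n n (\<lambda>(k, l). if k = i \<and> l = j then 1 else 0)"

definition elementary_mats :: "nat \<Rightarrow> 'a::comm_ring_1 mat set" where
  "elementary_mats n = {1\<^sub>m n + a \<cdot>\<^sub>m unit_mat n i j | a i j. i < n \<and> j < n \<and> i \<noteq> j}"

definition elementary_group :: "nat \<Rightarrow> 'a::comm_ring_1 mat set" where
  "elementary_group n = generate (SL n) (elementary_mats n)"

lemma group_SL: "group (SL n :: 'a::comm_ring_1 mat monoid)"
proof (rule groupI)
  fix A :: "'a mat" assume "A \<in> carrier (SL n)"
  then have A: "A \<in> carrier_mat n n" "det A = 1" by (auto simp: SL_def)
  note adj = adj_mat[OF A(1), unfolded A(2)]
  have "adj_mat A * A = 1\<^sub>m n" using adj(3) by (auto intro!: eq_matI)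
  moreover from this have "det (adj_mat A) = 1"
    using det_mult[OF adj(1) A(1)] A(2) by simp
  ultimately show "\<exists>B\<in>carrier (SL n). B \<otimes>\<^bsub>SL n\<^esub> A = \<one>\<^bsub>SL n\<^esub>"
    using adj(1) by (auto simp: SL_def)
qed (auto simp: SL_def det_mult)

lemma elementary_mats_subset: "elementary_mats n \<subseteq> carrier (SL n)"
proof -
  have "1\<^sub>m n + a \<cdot>\<^sub>m unit_mat n i j = (addrow_mat n a i j :: 'a mat)" if "i \<noteq> j" for a i j
    by (rule eq_matI) (use that in \<open>auto simp: unit_mat_def addrow_mat_def\<close>)
  then show ?thesis
    by (auto simp: elementary_mats_def SL_def det_addrow_mat)
qed

lemma subgroup_elementary_group: "subgroup (elementary_group n) (SL n)"
  unfolding elementary_group_def using group.generate_is_subgroup[OF group_SL elementary_mats_subset] .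

end

theory Submission
  imports Defs
begin

hide_const (open) up_ring.coeff up_ring.monom Polynomials.degree Polynomials.lead_coeff
  Divisibility.prime Divisibility.irreducible

text \<open>
  For a matrix \<open>A\<close> of determinant one over \<open>R[x]\<close>, the elements \<open>s\<close> of \<open>R\<close> with
  \<open>A(x)\<^sup>-\<^sup>1 A(x + s y)\<close> in \<open>E\<^sub>n(R[x, y])\<close> form an ideal (Quillen). If it is the unit ideal, then setting
  \<open>x = 0\<close> and \<open>y = x\<close> yields \<open>A(x) = A(0) E\<close>. Otherwise it is contained in a maximal ideal \<open>m\<close>. As \<open>R\<^sub>m\<close> is
  a valuation ring, its nilradical is prime, with quotient a valuation domain \<open>V\<close>. If \<open>A\<close> becomes
  elementary over \<open>V[x]\<close>, then, as elementary matrices lift along quotients, matrices congruent to \<open>1\<close>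
  modulo a nil ideal are elementary, and denominators can be cleared by scaling \<open>y\<close>, some \<open>s\<close> outside
  \<open>m\<close> lies in Quillen's ideal, a contradiction.

  It remains to show \<open>SL\<^sub>n(V[x]) = E\<^sub>n(V[x])\<close> for a valuation domain \<open>V\<close>. The entries of \<open>A\<close> lie in a
  finitely generated field, on which \<open>V\<close> induces a valuation ring of finite rank. Climbing
  up its chain of primes, one may pass to a quotient and assume that \<open>A\<close> is elementary, hence without
  loss of generality the identity, modulo the smallest nonzero prime \<open>P\<close>. Row reduction then leaves \<open>2 \<times> 2\<close>
  blocks with first row \<open>(g, f)\<close>, where \<open>g\<close> is congruent to \<open>1\<close> modulo \<open>P\<close>. That their Mennicke symbols
  are trivial is shown by induction on the degree of \<open>g\<close>: after a Hensel factorization of \<open>f\<close> over the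
  rank one valuation ring \<open>V\<^sub>P\<close>, multiplicativity and reciprocity of the symbol lower the degree.
\<close>

section \<open>Elementary matrices over a subring\<close>

text \<open>Gcds, Bezout identities and prime factors exist in K[x] for a field K, but not in V[x].
  Hence the local arguments take place inside one ambient field, with \<open>V\<close>, its prime
  \<open>P\<close> and the localization at \<open>P\<close> as subsets; a computation in K[x] is
  brought back to V[x] by multiplying with constants. Rank one makes these constants harmless: a
  high power of an element of \<open>P\<close> is divisible by any given nonzero constant, so a
  polynomial congruent to 1 modulo \<open>P\<close> has a trivial symbol with every nonzero
  constant, and errors that are small in powers of some \<open>t \<in> P\<close> are absorbed by
  \<open>P\<close>. A valuation domain of infinite rank may have no smallest nonzero prime, whence
  the detour through finitely generated fields. No completeness is available, so the Hensel
  factorization \<open>f1 * f2\<close> of \<open>f\<close> is only approximate. The error is handled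
  by an inverse \<open>w\<close> of \<open>f\<close> modulo \<open>g\<close>: the remainder of
  \<open>f1 * f2 * w\<close> modulo \<open>g\<close> is not 1, but congruent to 1 modulo
  \<open>P\<close> and of smaller degree than \<open>g\<close>. The bound on \<open>n\<close> enters
  twice: the symbol is multiplicative only in size at least 3, and clearing denominators writes a
  transvection as a commutator through a third index.\<close>

definition is_subring :: "'a::comm_ring_1 set \<Rightarrow> bool" where
  "is_subring D \<longleftrightarrow> 0 \<in> D \<and> 1 \<in> D \<and> (\<forall>a\<in>D. \<forall>b\<in>D. a + b \<in> D \<and> a * b \<in> D) \<and> (\<forall>a\<in>D. - a \<in> D)"

lemma is_subringD:
  assumes "is_subring D"
  shows "0 \<in> D" "1 \<in> D" "a \<in> D \<Longrightarrow> b \<in> D \<Longrightarrow> a + b \<in> D" "a \<in> D \<Longrightarrow> b \<in> D \<Longrightarrow> a * b \<in> D"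
    "a \<in> D \<Longrightarrow> - a \<in> D" "a \<in> D \<Longrightarrow> b \<in> D \<Longrightarrow> a - b \<in> D"
  using assms unfolding is_subring_def by (auto simp: diff_conv_add_uminus simp del: add_uminus_conv_diff)

lemma is_subring_UNIV [simp]: "is_subring UNIV"
  by (simp add: is_subring_def)

lemma subring_sum: "is_subring D \<Longrightarrow> (\<And>i. i \<in> S \<Longrightarrow> f i \<in> D) \<Longrightarrow> sum f S \<in> D"
  by (induction S rule: infinite_finite_induct) (auto simp: is_subringD)

lemma subring_prod: "is_subring D \<Longrightarrow> (\<And>i. i \<in> S \<Longrightarrow> f i \<in> D) \<Longrightarrow> prod f S \<in> D"
  by (induction S rule: infinite_finite_induct) (auto simp: is_subringD)

lemma subring_power: "is_subring D \<Longrightarrow> a \<in> D \<Longrightarrow> a ^ n \<in> D"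
  by (induction n) (auto simp: is_subringD)

definition ideal_in :: "'a::comm_ring_1 set \<Rightarrow> 'a set \<Rightarrow> bool" where
  "ideal_in D I \<longleftrightarrow> I \<subseteq> D \<and> 0 \<in> I \<and> (\<forall>a\<in>I. \<forall>b\<in>I. a + b \<in> I) \<and> (\<forall>a\<in>D. \<forall>b\<in>I. a * b \<in> I)"

lemma ideal_inD:
  assumes "ideal_in D I"
  shows "a \<in> I \<Longrightarrow> a \<in> D" "0 \<in> I" "a \<in> I \<Longrightarrow> b \<in> I \<Longrightarrow> a + b \<in> I"
    "a \<in> D \<Longrightarrow> b \<in> I \<Longrightarrow> a * b \<in> I" "a \<in> I \<Longrightarrow> b \<in> D \<Longrightarrow> a * b \<in> I"
  using assms unfolding ideal_in_def by (auto simp: mult.commute)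

lemma ideal_in_uminus: "is_subring D \<Longrightarrow> ideal_in D I \<Longrightarrow> a \<in> I \<Longrightarrow> - a \<in> I"
  using ideal_inD(4)[of D I "- 1" a] by (auto simp: is_subringD)

lemma ideal_in_diff: "is_subring D \<Longrightarrow> ideal_in D I \<Longrightarrow> a \<in> I \<Longrightarrow> b \<in> I \<Longrightarrow> a - b \<in> I"
  using ideal_inD(3)[of D I a "- b"] by (auto simp: ideal_in_uminus)

lemma ideal_in_sum: "ideal_in D I \<Longrightarrow> (\<And>i. i \<in> S \<Longrightarrow> f i \<in> I) \<Longrightarrow> sum f S \<in> I"
  by (induction S rule: infinite_finite_induct) (auto simp: ideal_inD)

text \<open>Additivity and multiplicativity are required on \<open>D\<close> only, because the
  residue map \<open>res\<close> below is meaningful just on a chosen subring of its type.\<close>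

definition hom_on :: "'a::comm_ring_1 set \<Rightarrow> ('a \<Rightarrow> 'b::comm_ring_1) \<Rightarrow> bool" where
  "hom_on D f \<longleftrightarrow> is_subring D \<and> f 1 = 1 \<and> (\<forall>a\<in>D. \<forall>b\<in>D. f (a + b) = f a + f b \<and> f (a * b) = f a * f b)"

lemma hom_onD:
  assumes "hom_on D f"
  shows "is_subring D" "f 1 = 1" "a \<in> D \<Longrightarrow> b \<in> D \<Longrightarrow> f (a + b) = f a + f b"
    "a \<in> D \<Longrightarrow> b \<in> D \<Longrightarrow> f (a * b) = f a * f b" "f 0 = 0" "a \<in> D \<Longrightarrow> f (- a) = - f a"
    "a \<in> D \<Longrightarrow> b \<in> D \<Longrightarrow> f (a - b) = f a - f b"
proof -
  show *: "is_subring D" "f 1 = 1" "\<And>a b. a \<in> D \<Longrightarrow> b \<in> D \<Longrightarrow> f (a + b) = f a + f b"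
    "a \<in> D \<Longrightarrow> b \<in> D \<Longrightarrow> f (a * b) = f a * f b"
    using assms unfolding hom_on_def by auto
  note sub = is_subringD[OF *(1)]
  show 0: "f 0 = 0" using *(3)[of 0 0] sub by simp
  show neg: "f (- a) = - f a" if "a \<in> D" for a
    using *(3)[of a "- a"] sub that 0 by (simp add: eq_neg_iff_add_eq_0 add.commute)
  show "a \<in> D \<Longrightarrow> b \<in> D \<Longrightarrow> f (a - b) = f a - f b"
    using *(3)[of a "- b"] sub neg by simp
qed

lemma hom_on_sum:
  assumes h: "hom_on D f" and "\<And>i. i \<in> S \<Longrightarrow> g i \<in> D"
  shows "f (sum g S) = (\<Sum>i\<in>S. f (g i))"
  using assms(2)
proof (induction S rule: infinite_finite_induct)
  case (insert x S)
  have "sum g S \<in> D" using insert by (intro subring_sum[OF hom_onD(1)[OF h]]) auto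
  then show ?case using insert hom_onD(3)[OF h, of "g x" "sum g S"] by simp
qed (simp_all add: hom_onD(5)[OF h])

lemma hom_on_prod:
  assumes h: "hom_on D f" and "\<And>i. i \<in> S \<Longrightarrow> g i \<in> D"
  shows "f (prod g S) = (\<Prod>i\<in>S. f (g i))"
  using assms(2)
proof (induction S rule: infinite_finite_induct)
  case (insert x S)
  have "prod g S \<in> D" using insert by (intro subring_prod[OF hom_onD(1)[OF h]]) auto
  then show ?case using insert hom_onD(4)[OF h, of "g x" "prod g S"] by simp
qed (simp_all add: hom_onD(2)[OF h])

lemma hom_on_power: "hom_on D f \<Longrightarrow> a \<in> D \<Longrightarrow> f (a ^ n) = f a ^ n"
  by (induction n) (auto simp: hom_onD subring_power)

lemma hom_on_image:
  assumes h: "hom_on D f"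
  shows "is_subring (f ` D)"
proof -
  note s = is_subringD[OF hom_onD(1)[OF h]]
  have "f a + f b \<in> f ` D \<and> f a * f b \<in> f ` D \<and> - f a \<in> f ` D" if "a \<in> D" "b \<in> D" for a b
    using that s hom_onD(3,4,6)[OF h, symmetric] by auto
  moreover have "0 \<in> f ` D" "1 \<in> f ` D"
    using imageI[OF s(1), of f] imageI[OF s(2), of f] hom_onD[OF h] by auto
  ultimately show ?thesis unfolding is_subring_def by blast
qed

section \<open>Polynomials with coefficients in a subset\<close>

definition polys :: "'a::comm_ring_1 set \<Rightarrow> 'a poly set" where
  "polys D = {p. \<forall>i. coeff p i \<in> D}"

lemma polys_UNIV [simp]: "polys UNIV = UNIV" by (simp add: polys_def)

lemma polysD: "p \<in> polys D \<Longrightarrow> coeff p i \<in> D" by (simp add: polys_def)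

lemma polysI: "(\<And>i. coeff p i \<in> D) \<Longrightarrow> p \<in> polys D" by (simp add: polys_def)

lemma polys_const: "0 \<in> D \<Longrightarrow> a \<in> D \<Longrightarrow> [:a:] \<in> polys D"
  by (auto simp: polys_def coeff_pCons split: nat.splits)

lemma polys_const_iff: "0 \<in> D \<Longrightarrow> [:a:] \<in> polys D \<longleftrightarrow> a \<in> D"
  by (auto simp: polys_def coeff_pCons split: nat.splits dest: spec[of _ 0])

lemma polys_smult: "is_subring D \<Longrightarrow> a \<in> D \<Longrightarrow> p \<in> polys D \<Longrightarrow> smult a p \<in> polys D"
  by (auto simp: polys_def is_subringD)

lemma polys_smult_ideal: "ideal_in D I \<Longrightarrow> a \<in> D \<Longrightarrow> p \<in> polys I \<Longrightarrow> smult a p \<in> polys I"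
  by (auto simp: polys_def ideal_inD)

lemma polys_mono: "p \<in> polys A \<Longrightarrow> A \<subseteq> B \<Longrightarrow> p \<in> polys B"
  by (auto simp: polys_def)

lemma is_subring_polys: "is_subring D \<Longrightarrow> is_subring (polys D)"
  unfolding is_subring_def[of "polys D"]
  by (auto simp: polys_def coeff_mult is_subringD coeff_1 intro!: subring_sum)

lemma ideal_in_polys: "ideal_in D I \<Longrightarrow> ideal_in (polys D) (polys I)"
  unfolding ideal_in_def[of "polys D"]
  by (auto simp: polys_def coeff_mult ideal_inD intro!: ideal_in_sum)

lemma hom_on_map_poly: "hom_on D f \<Longrightarrow> hom_on (polys D) (map_poly f)"
proof -
  assume h: "hom_on D f"
  note s = hom_onD(1)[OF h]
  have c: "coeff (map_poly f p) i = f (coeff p i)" for p i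
    using coeff_map_poly[of f p i] hom_onD(5)[OF h] by simp
  show ?thesis unfolding hom_on_def
  proof (intro conjI ballI)
    show "is_subring (polys D)" using s by (rule is_subring_polys)
    show "map_poly f 1 = 1" by (rule poly_eqI) (simp add: c coeff_1 hom_onD[OF h])
    fix p q assume pq: "p \<in> polys D" "q \<in> polys D"
    show "map_poly f (p + q) = map_poly f p + map_poly f q"
      by (rule poly_eqI) (use pq in \<open>simp add: c hom_onD[OF h] polysD\<close>)
    show "map_poly f (p * q) = map_poly f p * map_poly f q"
    proof (rule poly_eqI)
      fix k
      have "coeff (map_poly f (p * q)) k = f (\<Sum>i\<le>k. coeff p i * coeff q (k - i))"
        by (simp add: c coeff_mult)
      also have "\<dots> = (\<Sum>i\<le>k. f (coeff p i * coeff q (k - i)))"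
        using pq by (intro hom_on_sum[OF h]) (auto simp: polysD is_subringD[OF s])
      also have "\<dots> = coeff (map_poly f p * map_poly f q) k"
        unfolding coeff_mult c using pq by (intro sum.cong) (auto simp: polysD hom_onD[OF h])
      finally show "coeff (map_poly f (p * q)) k = coeff (map_poly f p * map_poly f q) k" .
    qed
  qed
qed

lemma coeff_map_poly_hom: "hom_on D f \<Longrightarrow> coeff (map_poly f p) i = f (coeff p i)"
  using coeff_map_poly[of f p i] hom_onD(5) by blast

section \<open>Matrices with entries in a subset\<close>

definition mats :: "nat \<Rightarrow> 'a::comm_ring_1 set \<Rightarrow> 'a mat set" where
  "mats n D = {A \<in> carrier_mat n n. \<forall>i<n. \<forall>j<n. A $$ (i,j) \<in> D}"

lemma mats_UNIV [simp]: "mats n UNIV = carrier_mat n n" by (auto simp: mats_def)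

lemma matsD: "A \<in> mats n D \<Longrightarrow> A \<in> carrier_mat n n" "A \<in> mats n D \<Longrightarrow> i < n \<Longrightarrow> j < n \<Longrightarrow> A $$ (i,j) \<in> D"
  by (auto simp: mats_def)

lemma mult_mat_entry:
  assumes "A \<in> carrier_mat n n" "B \<in> carrier_mat n n" "i < n" "j < n"
  shows "(A * B) $$ (i,j) = (\<Sum>k<n. A $$ (i,k) * B $$ (k,j))"
  using assms by (auto simp: scalar_prod_def atLeast0LessThan intro!: sum.cong)

lemma mats_mult: "is_subring D \<Longrightarrow> A \<in> mats n D \<Longrightarrow> B \<in> mats n D \<Longrightarrow> A * B \<in> mats n D"
  unfolding mats_def by (auto simp: mult_mat_entry is_subringD simp del: index_mult_mat(1) intro!: subring_sum)

lemma mats_one: "is_subring D \<Longrightarrow> 1\<^sub>m n \<in> mats n D"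
  unfolding mats_def by (auto simp: is_subringD)

lemma hom_on_mat_mult:
  assumes h: "hom_on D f" and A: "A \<in> mats n D" and B: "B \<in> mats n D"
  shows "map_mat f (A * B) = map_mat f A * map_mat f B"
proof (rule eq_matI)
  fix i j assume "i < dim_row (map_mat f A * map_mat f B)" "j < dim_col (map_mat f A * map_mat f B)"
  then have ij: "i < n" "j < n" using A B by (auto simp: mats_def)
  have "map_mat f (A * B) $$ (i,j) = f ((A * B) $$ (i,j))" using ij A B by (auto simp: mats_def)
  also have "\<dots> = f (\<Sum>k<n. A $$ (i,k) * B $$ (k,j))"
    by (subst mult_mat_entry[of A n]) (use ij A B in \<open>auto simp: mats_def\<close>)
  also have "\<dots> = (\<Sum>k<n. f (A $$ (i,k) * B $$ (k,j)))"
    using ij A B by (intro hom_on_sum[OF h]) (auto simp: mats_def is_subringD[OF hom_onD(1)[OF h]])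
  also have "\<dots> = (\<Sum>k<n. map_mat f A $$ (i,k) * map_mat f B $$ (k,j))"
    using ij A B by (intro sum.cong) (auto simp: mats_def hom_onD[OF h])
  also have "\<dots> = (map_mat f A * map_mat f B) $$ (i,j)"
    by (subst mult_mat_entry[of _ n]) (use ij A B in \<open>auto simp: mats_def\<close>)
  finally show "map_mat f (A * B) $$ (i,j) = (map_mat f A * map_mat f B) $$ (i,j)" .
qed (use A B in \<open>auto simp: mats_def\<close>)

lemma hom_on_det:
  assumes h: "hom_on D f" and A: "A \<in> mats n D"
  shows "det (map_mat f A) = f (det A)"
proof -
  note s = is_subringD[OF hom_onD(1)[OF h]]
  have sg: "signof p \<in> D" "f (signof p) = signof p" for p
    using s hom_onD[OF h] hom_onD(6)[OF h, of 1] by (auto simp: sign_def)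
  have pr: "(\<Prod>i = 0..<n. A $$ (i, p i)) \<in> D" if "p permutes {0..<n}" for p
    using A permutes_in_image[OF that] by (intro subring_prod[OF hom_onD(1)[OF h]]) (auto simp: mats_def)
  have "f (det A) = f (\<Sum>p | p permutes {0..<n}. signof p * (\<Prod>i = 0..<n. A $$ (i, p i)))"
    using A by (auto simp: det_def mats_def)
  also have "\<dots> = (\<Sum>p | p permutes {0..<n}. f (signof p * (\<Prod>i = 0..<n. A $$ (i, p i))))"
    using pr sg s by (intro hom_on_sum[OF h]) auto
  also have "\<dots> = (\<Sum>p | p permutes {0..<n}. signof p * (\<Prod>i = 0..<n. map_mat f A $$ (i, p i)))"
  proof (intro sum.cong refl)
    fix p assume "p \<in> {p. p permutes {0..<n}}"
    then have p: "p permutes {0..<n}" by simp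
    have "f (\<Prod>i = 0..<n. A $$ (i, p i)) = (\<Prod>i = 0..<n. f (A $$ (i, p i)))"
      using A permutes_in_image[OF p] by (intro hom_on_prod[OF h]) (auto simp: mats_def)
    also have "\<dots> = (\<Prod>i = 0..<n. map_mat f A $$ (i, p i))"
      using A permutes_in_image[OF p] by (intro prod.cong) (auto simp: mats_def)
    finally show "f (signof p * (\<Prod>i = 0..<n. A $$ (i, p i))) = signof p * (\<Prod>i = 0..<n. map_mat f A $$ (i, p i))"
      using pr[OF p] sg by (simp add: hom_onD[OF h])
  qed
  also have "\<dots> = det (map_mat f A)" using A by (auto simp: det_def mats_def)
  finally show ?thesis ..
qed

text \<open>Closing under right multiplication by transvections suffices: the inverse of a
  transvection has the negated parameter, so over a subring this is already a group
  (\<open>Eg_inverse\<close>). The parameter set may be arbitrary; later it is also the set of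
  multiples of a fixed element.\<close>

inductive_set Eg :: "nat \<Rightarrow> 'a::comm_ring_1 set \<Rightarrow> 'a mat set" for n D where
  one: "1\<^sub>m n \<in> Eg n D"
| step: "M \<in> Eg n D \<Longrightarrow> i < n \<Longrightarrow> j < n \<Longrightarrow> i \<noteq> j \<Longrightarrow> a \<in> D \<Longrightarrow> M * addrow_mat n a i j \<in> Eg n D"

lemma addrow_mats: "is_subring D \<Longrightarrow> a \<in> D \<Longrightarrow> i \<noteq> j \<Longrightarrow> addrow_mat n a i j \<in> mats n D"
  by (auto simp: mats_def is_subringD)

lemma Eg_carrier: "M \<in> Eg n D \<Longrightarrow> M \<in> carrier_mat n n"
  by (induction rule: Eg.induct) auto

lemma Eg_mats: "is_subring D \<Longrightarrow> M \<in> Eg n D \<Longrightarrow> M \<in> mats n D"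
  by (rotate_tac, induction rule: Eg.induct) (auto simp: mats_one intro!: mats_mult addrow_mats)

lemma Eg_mono: "M \<in> Eg n D \<Longrightarrow> D \<subseteq> D' \<Longrightarrow> M \<in> Eg n D'"
  by (induction rule: Eg.induct) (auto intro: Eg.intros)

lemma Eg_det: "M \<in> Eg n D \<Longrightarrow> det M = 1"
  by (induction rule: Eg.induct) (auto simp: det_mult[OF Eg_carrier] det_addrow_mat)

lemma Eg_addrow: "i < n \<Longrightarrow> j < n \<Longrightarrow> i \<noteq> j \<Longrightarrow> a \<in> D \<Longrightarrow> addrow_mat n a i j \<in> Eg n D"
  using Eg.step[OF Eg.one, of i n j a D] by (simp add: left_mult_one_mat[of _ n n])

lemma Eg_mult: "M \<in> Eg n D \<Longrightarrow> N \<in> Eg n D \<Longrightarrow> M * N \<in> Eg n D"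
proof (rotate_tac, induction rule: Eg.induct)
  case one
  then show ?case by (metis Eg_carrier right_mult_one_mat)
next
  case (step N i j a)
  have "M * (N * addrow_mat n a i j) = M * N * addrow_mat n a i j"
    using Eg_carrier[OF step.prems] Eg_carrier[OF step.hyps(1)]
    by (subst assoc_mult_mat[of _ n n _ n _ n]) auto
  then show ?case using step by (auto intro: Eg.step)
qed

lemma Eg_inverse:
  assumes "is_subring D" "M \<in> Eg n D"
  obtains N where "N \<in> Eg n D" "M * N = 1\<^sub>m n" "N * M = 1\<^sub>m n"
proof -
  from assms(2) have "\<exists>N\<in>Eg n D. M * N = 1\<^sub>m n \<and> N * M = 1\<^sub>m n"
  proof (induction rule: Eg.induct)
    case one
    show ?case by (rule bexI[OF _ Eg.one]) simp
  next
    case (step M i j a)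
    then obtain N where N: "N \<in> Eg n D" "M * N = 1\<^sub>m n" "N * M = 1\<^sub>m n" by auto
    let ?E = "addrow_mat n a i j" and ?F = "addrow_mat n (- a) i j"
    have EF: "?E * ?F = 1\<^sub>m n" "?F * ?E = 1\<^sub>m n"
      using addrow_mat_inv[OF step.hyps(2,3,4), of a] addrow_mat_inv[OF step.hyps(2,3,4), of "- a"] by auto
    note c = Eg_carrier[OF step.hyps(1)] Eg_carrier[OF N(1)]
    have [simp]: "?E \<in> carrier_mat n n" "?F \<in> carrier_mat n n" by auto
    have "?E * (?F * N) = N"
      using c EF by (subst assoc_mult_mat[symmetric, of _ n n _ n _ n]) auto
    then have 1: "M * ?E * (?F * N) = 1\<^sub>m n"
      using c N by (subst assoc_mult_mat[of _ n n _ n _ n]) auto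
    have "N * (M * ?E) = ?E"
      using c N by (subst assoc_mult_mat[symmetric, of _ n n _ n _ n]) auto
    then have 2: "?F * N * (M * ?E) = 1\<^sub>m n"
      using c EF by (subst assoc_mult_mat[of _ n n _ n _ n]) auto
    have "?F * N \<in> Eg n D"
      using step N assms(1) by (intro Eg_mult Eg_addrow) (auto simp: is_subringD)
    with 1 2 show ?case by auto
  qed
  then show thesis using that by auto
qed

lemma Eg_cancel_left:
  assumes "is_subring D" "G \<in> Eg n D" "A \<in> carrier_mat n n" "G * A \<in> Eg n D"
  shows "A \<in> Eg n D"
proof -
  obtain Y where Y: "Y \<in> Eg n D" "Y * G = 1\<^sub>m n" using Eg_inverse[OF assms(1,2)] by metis
  have "Y * (G * A) = A"
    using Y assms(3) Eg_carrier[OF assms(2)] Eg_carrier[OF Y(1)]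
    by (subst assoc_mult_mat[symmetric, of _ n n _ n _ n]) auto
  then show ?thesis using Eg_mult[OF Y(1) assms(4)] by simp
qed

lemma Eg_cancel_right:
  assumes "is_subring D" "G \<in> Eg n D" "A \<in> carrier_mat n n" "A * G \<in> Eg n D"
  shows "A \<in> Eg n D"
proof -
  obtain Y where Y: "Y \<in> Eg n D" "G * Y = 1\<^sub>m n" using Eg_inverse[OF assms(1,2)] by metis
  have "A * G * Y = A"
    using Y assms(3) Eg_carrier[OF assms(2)] Eg_carrier[OF Y(1)]
    by (subst assoc_mult_mat[of _ n n _ n _ n]) auto
  then show ?thesis using Eg_mult[OF assms(4) Y(1)] by simp
qed

lemma Eg_left_iff:
  "is_subring D \<Longrightarrow> L \<in> Eg n D \<Longrightarrow> A \<in> carrier_mat n n \<Longrightarrow> L * A \<in> Eg n D \<longleftrightarrow> A \<in> Eg n D"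
  using Eg_cancel_left Eg_mult by blast

lemma Eg_right_iff:
  "is_subring D \<Longrightarrow> R \<in> Eg n D \<Longrightarrow> A \<in> carrier_mat n n \<Longrightarrow> A * R \<in> Eg n D \<longleftrightarrow> A \<in> Eg n D"
  using Eg_cancel_right Eg_mult by blast

lemma map_addrow_mat:
  "f 0 = 0 \<Longrightarrow> f 1 = 1 \<Longrightarrow> i \<noteq> j \<Longrightarrow> map_mat f (addrow_mat n a i j) = addrow_mat n (f a) i j"
  by (rule eq_matI) auto

lemma Eg_hom:
  assumes h: "hom_on D f" and D': "f ` D \<subseteq> D'" and M: "M \<in> Eg n D"
  shows "map_mat f M \<in> Eg n D'"
  using M
proof (induction rule: Eg.induct)
  case one
  have "map_mat f (1\<^sub>m n) = 1\<^sub>m n" by (rule eq_matI) (auto simp: hom_onD[OF h])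
  then show ?case by (simp add: Eg.one)
next
  case (step M i j a)
  note s = hom_onD(1)[OF h]
  have "map_mat f (M * addrow_mat n a i j) = map_mat f M * addrow_mat n (f a) i j"
    using step by (subst hom_on_mat_mult[OF h Eg_mats[OF s] addrow_mats[OF s]])
      (auto simp: map_addrow_mat hom_onD[OF h])
  then show ?case using step D' by (auto intro: Eg.step)
qed

text \<open>A transvection lifts by lifting its single parameter. Matrices of determinant one need
  not lift along a surjection, which is why lifting is done after a matrix is known to be
  elementary.\<close>

lemma Eg_lift:
  assumes h: "hom_on D f" and D': "D' \<subseteq> f ` D" and M: "M \<in> Eg n D'"
  obtains N where "N \<in> Eg n D" "map_mat f N = M"
proof -
  from M have "\<exists>N\<in>Eg n D. map_mat f N = M"
  proof (induction rule: Eg.induct)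
    case one
    have "map_mat f (1\<^sub>m n) = 1\<^sub>m n" by (rule eq_matI) (auto simp: hom_onD[OF h])
    then show ?case using Eg.one by blast
  next
    case (step M i j a)
    note s = hom_onD(1)[OF h]
    obtain N where N: "N \<in> Eg n D" "map_mat f N = M" using step by auto
    obtain b where b: "b \<in> D" "f b = a" using step D' by auto
    have "map_mat f (N * addrow_mat n b i j) = map_mat f N * addrow_mat n (f b) i j"
      using step N b by (subst hom_on_mat_mult[OF h Eg_mats[OF s] addrow_mats[OF s]])
        (auto simp: map_addrow_mat hom_onD[OF h])
    then show ?case using step N b Eg.step[OF N(1) step.hyps(2,3,4) b(1)] by auto
  qed
  then show thesis using that by auto
qed

text \<open>The block \<open>A\<close> is placed on the coordinates picked by
  \<open>\<sigma>\<close>, with the identity elsewhere. For \<open>m = n\<close> and a permutation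
  \<open>\<sigma>\<close> this is conjugation by a permutation matrix, which need not have
  determinant one itself.\<close>

definition emb :: "nat \<Rightarrow> nat \<Rightarrow> (nat \<Rightarrow> nat) \<Rightarrow> 'a::comm_ring_1 mat \<Rightarrow> 'a mat" where
  "emb m n \<sigma> A = mat n n (\<lambda>(i,j). if i \<in> \<sigma> ` {..<m} \<and> j \<in> \<sigma> ` {..<m}
     then A $$ (the_inv_into {..<m} \<sigma> i, the_inv_into {..<m} \<sigma> j) else if i = j then 1 else 0)"

lemma emb_carrier [simp]: "emb m n \<sigma> A \<in> carrier_mat n n"
  by (simp add: emb_def)

lemma emb_entry:
  assumes "inj_on \<sigma> {..<m}" "\<sigma> ` {..<m} \<subseteq> {..<n}" "i < m" "j < m"
  shows "emb m n \<sigma> A $$ (\<sigma> i, \<sigma> j) = A $$ (i,j)"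
proof -
  have "\<sigma> i < n" "\<sigma> j < n" using assms by auto
  then show ?thesis using assms by (auto simp: emb_def the_inv_into_f_f)
qed

lemma emb_out:
  assumes "i \<notin> \<sigma> ` {..<m} \<or> j \<notin> \<sigma> ` {..<m}" "i < n" "j < n"
  shows "emb m n \<sigma> A $$ (i, j) = (if i = j then 1 else 0)"
  using assms by (auto simp: emb_def)

lemma emb_mult:
  assumes s: "inj_on \<sigma> {..<m}" "\<sigma> ` {..<m} \<subseteq> {..<n}"
    and AB: "A \<in> carrier_mat m m" "B \<in> carrier_mat m m"
  shows "emb m n \<sigma> (A * B) = emb m n \<sigma> A * emb m n \<sigma> B"
proof (rule eq_matI)
  let ?A = "emb m n \<sigma> A" and ?B = "emb m n \<sigma> B"
  fix i j assume "i < dim_row (?A * ?B)" "j < dim_col (?A * ?B)"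
  then have ij: "i < n" "j < n" by (auto simp: emb_def)
  have e: "(?A * ?B) $$ (i,j) = (\<Sum>k<n. ?A $$ (i,k) * ?B $$ (k,j))"
    by (rule mult_mat_entry) (use ij in auto)
  show "emb m n \<sigma> (A * B) $$ (i,j) = (?A * ?B) $$ (i,j)"
  proof (cases "i \<in> \<sigma> ` {..<m}")
    case i: True
    then obtain i' where i': "i' < m" "i = \<sigma> i'" by auto
    have "(\<Sum>k<n. ?A $$ (i,k) * ?B $$ (k,j)) = (\<Sum>k\<in>\<sigma> ` {..<m}. ?A $$ (i,k) * ?B $$ (k,j))"
    proof (rule sum.mono_neutral_right)
      show "\<forall>k\<in>{..<n} - \<sigma> ` {..<m}. ?A $$ (i,k) * ?B $$ (k,j) = 0"
        using i ij by (auto simp: emb_out)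
    qed (use s in auto)
    also have "\<dots> = (\<Sum>k<m. ?A $$ (i,\<sigma> k) * ?B $$ (\<sigma> k,j))"
      using s(1) by (simp add: sum.reindex)
    finally have e2: "(?A * ?B) $$ (i,j) = (\<Sum>k<m. ?A $$ (i,\<sigma> k) * ?B $$ (\<sigma> k,j))" using e by simp
    show ?thesis
    proof (cases "j \<in> \<sigma> ` {..<m}")
      case True
      then obtain j' where j': "j' < m" "j = \<sigma> j'" by auto
      have "(\<Sum>k<m. ?A $$ (i,\<sigma> k) * ?B $$ (\<sigma> k,j)) = (\<Sum>k<m. A $$ (i',k) * B $$ (k,j'))"
        using i' j' by (intro sum.cong) (auto simp: emb_entry[OF s])
      also have "\<dots> = (A * B) $$ (i',j')" using i' j' AB by (subst mult_mat_entry[of A m]) auto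
      finally show ?thesis using e2 i' j' by (simp add: emb_entry[OF s])
    next
      case False
      have "(\<Sum>k<m. ?A $$ (i,\<sigma> k) * ?B $$ (\<sigma> k,j)) = 0"
        using False s ij by (intro sum.neutral) (auto simp: emb_out image_subset_iff)
      then show ?thesis using e2 False ij i by (auto simp: emb_out)
    qed
  next
    case False
    have "(\<Sum>k<n. ?A $$ (i,k) * ?B $$ (k,j)) = (\<Sum>k<n. if k = i then ?B $$ (i,j) else 0)"
      using False ij by (intro sum.cong) (auto simp: emb_out)
    also have "\<dots> = ?B $$ (i,j)" using ij by simp
    finally show ?thesis using e False ij by (simp add: emb_out)
  qed
qed (auto simp: emb_def)

lemma emb_addrow:
  assumes s: "inj_on \<sigma> {..<m}" "\<sigma> ` {..<m} \<subseteq> {..<n}" and ij: "i < m" "j < m" "i \<noteq> j"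
  shows "emb m n \<sigma> (addrow_mat m a i j) = addrow_mat n a (\<sigma> i) (\<sigma> j)"
proof (rule eq_matI)
  fix k l assume "k < dim_row (addrow_mat n a (\<sigma> i) (\<sigma> j))" "l < dim_col (addrow_mat n a (\<sigma> i) (\<sigma> j))"
  then have kl: "k < n" "l < n" by auto
  have [simp]: "\<sigma> x = \<sigma> y \<longleftrightarrow> x = y" if "x < m" "y < m" for x y
    using s(1) that by (auto simp: inj_on_def)
  show "emb m n \<sigma> (addrow_mat m a i j) $$ (k,l) = addrow_mat n a (\<sigma> i) (\<sigma> j) $$ (k,l)"
  proof (cases "k \<in> \<sigma> ` {..<m} \<and> l \<in> \<sigma> ` {..<m}")
    case True
    then obtain k' l' where k': "k' < m" "l' < m" "k = \<sigma> k'" "l = \<sigma> l'" by auto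
    then show ?thesis using ij kl by (auto simp: emb_entry[OF s])
  next
    case False
    then show ?thesis using ij kl by (auto simp: emb_out)
  qed
qed (auto simp: emb_def)

lemma emb_Eg:
  fixes D :: "'a::comm_ring_1 set"
  assumes s: "inj_on \<sigma> {..<m}" "\<sigma> ` {..<m} \<subseteq> {..<n}" and M: "M \<in> Eg m D"
  shows "emb m n \<sigma> M \<in> Eg n D"
  using M
proof (induction rule: Eg.induct)
  case one
  have "emb m n \<sigma> (1\<^sub>m m :: 'a mat) = 1\<^sub>m n"
    using s by (intro eq_matI) (auto simp: emb_def the_inv_into_f_f inj_on_eq_iff)
  then show ?case by (simp add: Eg.one)
next
  case (step M i j a)
  have "emb m n \<sigma> (M * addrow_mat m a i j) = emb m n \<sigma> M * addrow_mat n a (\<sigma> i) (\<sigma> j)"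
    using step Eg_carrier[OF step.hyps(1)] by (subst emb_mult[OF s]) (auto simp: emb_addrow[OF s])
  moreover have "\<sigma> i < n" "\<sigma> j < n" "\<sigma> i \<noteq> \<sigma> j"
    using s step by (auto simp: inj_on_def)
  ultimately show ?case using step by (auto intro: Eg.step)
qed

section \<open>Products of transvections sharing a column or a row\<close>

definition col_mat :: "nat \<Rightarrow> nat \<Rightarrow> (nat \<Rightarrow> 'a::comm_ring_1) \<Rightarrow> 'a mat" where
  "col_mat n k v = mat n n (\<lambda>(i,j). (if i = j then 1 else 0) + (if j = k \<and> i \<noteq> k then v i else 0))"

definition row_mat :: "nat \<Rightarrow> nat \<Rightarrow> (nat \<Rightarrow> 'a::comm_ring_1) \<Rightarrow> 'a mat" where
  "row_mat n k w = mat n n (\<lambda>(i,j). (if i = j then 1 else 0) + (if i = k \<and> j \<noteq> k then w j else 0))"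

lemma col_row_carrier [simp]: "col_mat n k v \<in> carrier_mat n n" "row_mat n k w \<in> carrier_mat n n"
  by (auto simp: col_mat_def row_mat_def)

lemma sum_delta_plus:
  fixes f g :: "nat \<Rightarrow> 'a::comm_ring_1"
  assumes "finite S" "a \<in> S"
  shows "(\<Sum>k\<in>S. ((if a = k then 1 else 0) + f k) * g k) = g a + (\<Sum>k\<in>S. f k * g k)"
    and "(\<Sum>k\<in>S. ((if k = a then 1 else 0) + f k) * g k) = g a + (\<Sum>k\<in>S. f k * g k)"
  using assms by (simp_all add: distrib_right sum.distrib if_distrib[of "\<lambda>x. x * _"] cong: if_cong)

lemma mult_col_mat:
  assumes "A \<in> carrier_mat n n" "i < n" "j < n" "k < n"
  shows "(A * col_mat n k v) $$ (i,j) = A $$ (i,j) + (if j = k then (\<Sum>l\<in>{..<n}-{k}. A $$ (i,l) * v l) else 0)"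
proof -
  have "(A * col_mat n k v) $$ (i,j) = (\<Sum>l<n. A $$ (i,l) * col_mat n k v $$ (l,j))"
    using assms by (intro mult_mat_entry) auto
  also have "\<dots> = (\<Sum>l<n. ((if l = j then 1 else 0) + (if j = k \<and> l \<noteq> k then v l else 0)) * A $$ (i,l))"
    using assms by (intro sum.cong) (auto simp: col_mat_def mult.commute)
  also have "\<dots> = A $$ (i,j) + (\<Sum>l<n. (if j = k \<and> l \<noteq> k then v l else 0) * A $$ (i,l))"
    using assms by (subst sum_delta_plus) auto
  also have "(\<Sum>l<n. (if j = k \<and> l \<noteq> k then v l else 0) * A $$ (i,l)) = (if j = k then (\<Sum>l\<in>{..<n}-{k}. A $$ (i,l) * v l) else 0)"
    using assms by (auto simp: sum.If_cases if_distrib[of "\<lambda>x. x * _"] Int_def mult.commute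
        intro!: sum.mono_neutral_cong_right split: if_splits)
  finally show ?thesis .
qed

lemma mult_row_mat:
  assumes "A \<in> carrier_mat n n" "i < n" "j < n" "k < n"
  shows "(A * row_mat n k w) $$ (i,j) = A $$ (i,j) + (if j \<noteq> k then A $$ (i,k) * w j else 0)"
proof -
  have "(A * row_mat n k w) $$ (i,j) = (\<Sum>l<n. A $$ (i,l) * row_mat n k w $$ (l,j))"
    using assms by (intro mult_mat_entry) auto
  also have "\<dots> = (\<Sum>l<n. ((if l = j then 1 else 0) + (if l = k \<and> j \<noteq> k then w j else 0)) * A $$ (i,l))"
    using assms by (intro sum.cong) (auto simp: row_mat_def mult.commute)
  also have "\<dots> = A $$ (i,j) + (\<Sum>l<n. (if l = k \<and> j \<noteq> k then w j else 0) * A $$ (i,l))"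
    using assms by (subst sum_delta_plus) auto
  also have "(\<Sum>l<n. (if l = k \<and> j \<noteq> k then w j else 0) * A $$ (i,l)) = (if j \<noteq> k then A $$ (i,k) * w j else 0)"
    using assms by (auto simp: if_distrib[of "\<lambda>x. x * _"] cong: if_cong)
  finally show ?thesis .
qed

lemma col_mat_mult:
  assumes "A \<in> carrier_mat n n" "i < n" "j < n" "k < n"
  shows "(col_mat n k v * A) $$ (i,j) = A $$ (i,j) + (if i \<noteq> k then v i * A $$ (k,j) else 0)"
proof -
  have "(col_mat n k v * A) $$ (i,j) = (\<Sum>l<n. col_mat n k v $$ (i,l) * A $$ (l,j))"
    using assms by (intro mult_mat_entry) auto
  also have "\<dots> = (\<Sum>l<n. ((if i = l then 1 else 0) + (if l = k \<and> i \<noteq> k then v i else 0)) * A $$ (l,j))"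
    using assms by (intro sum.cong) (auto simp: col_mat_def)
  also have "\<dots> = A $$ (i,j) + (\<Sum>l<n. (if l = k \<and> i \<noteq> k then v i else 0) * A $$ (l,j))"
    using assms by (subst sum_delta_plus) auto
  also have "(\<Sum>l<n. (if l = k \<and> i \<noteq> k then v i else 0) * A $$ (l,j)) = (if i \<noteq> k then v i * A $$ (k,j) else 0)"
    using assms by (auto simp: if_distrib[of "\<lambda>x. x * _"] cong: if_cong)
  finally show ?thesis .
qed

lemma col_mat_Eg:
  assumes D: "is_subring D" and k: "k < n" and v: "\<And>i. i < n \<Longrightarrow> i \<noteq> k \<Longrightarrow> v i \<in> D"
  shows "col_mat n k v \<in> Eg n D"
proof -
  have "col_mat n k (\<lambda>i. if i < m then v i else 0) \<in> Eg n D" if "m \<le> n" for m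
    using that
  proof (induction m)
    case 0
    have "col_mat n k (\<lambda>i. if i < 0 then v i else 0) = 1\<^sub>m n"
      by (rule eq_matI) (auto simp: col_mat_def)
    then show ?case by (simp add: Eg.one)
  next
    case (Suc m)
    let ?c = "\<lambda>m. col_mat n k (\<lambda>i. if i < m then v i else 0)"
    show ?case
    proof (cases "m = k")
      case True
      have "?c (Suc m) = ?c m" using True by (intro eq_matI) (auto simp: col_mat_def)
      then show ?thesis using Suc by simp
    next
      case False
      have "?c (Suc m) = addrow (v m) m k (?c m)"
        using False k Suc.prems by (intro eq_matI) (auto simp: col_mat_def mat_addrow_gen_def)
      also have "\<dots> = addrow_mat n (v m) m k * ?c m" by (rule addrow_mat[of _ n n]) (use k in auto)
      also have "\<dots> \<in> Eg n D"
        using False Suc k v[of m] by (intro Eg_mult Eg_addrow) auto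
      finally show ?thesis .
    qed
  qed
  from this[of n] have "col_mat n k (\<lambda>i. if i < n then v i else 0) \<in> Eg n D" by simp
  also have "col_mat n k (\<lambda>i. if i < n then v i else 0) = col_mat n k v"
    by (rule eq_matI) (auto simp: col_mat_def)
  finally show ?thesis .
qed

lemma row_mat_Eg:
  assumes D: "is_subring D" and k: "k < n" and w: "\<And>j. j < n \<Longrightarrow> j \<noteq> k \<Longrightarrow> w j \<in> D"
  shows "row_mat n k w \<in> Eg n D"
proof -
  have "row_mat n k (\<lambda>i. if i < m then w i else 0) \<in> Eg n D" if "m \<le> n" for m
    using that
  proof (induction m)
    case 0
    have "row_mat n k (\<lambda>i. if i < 0 then w i else 0) = 1\<^sub>m n"
      by (rule eq_matI) (auto simp: row_mat_def)
    then show ?case by (simp add: Eg.one)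
  next
    case (Suc m)
    let ?c = "\<lambda>m. row_mat n k (\<lambda>i. if i < m then w i else 0)"
    show ?case
    proof (cases "m = k")
      case True
      have "?c (Suc m) = ?c m" using True by (intro eq_matI) (auto simp: row_mat_def)
      then show ?thesis using Suc by simp
    next
      case False
      have "?c (Suc m) = addcol (w m) m k (?c m)"
        using False k Suc.prems by (intro eq_matI) (auto simp: row_mat_def mat_addcol_def)
      also have "\<dots> = ?c m * addrow_mat n (w m) k m" by (rule addcol_mat[of _ n n]) (use k Suc.prems in auto)
      also have "\<dots> \<in> Eg n D"
        using False Suc k w[of m] by (intro Eg_mult Eg_addrow) auto
      finally show ?thesis .
    qed
  qed
  from this[of n] have "row_mat n k (\<lambda>i. if i < n then w i else 0) \<in> Eg n D" by simp
  also have "row_mat n k (\<lambda>i. if i < n then w i else 0) = row_mat n k w"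
    by (rule eq_matI) (auto simp: row_mat_def)
  finally show ?thesis .
qed

section \<open>Congruences between matrices and removal of a pivot 1\<close>

definition cong_mat :: "nat \<Rightarrow> 'a::comm_ring_1 set \<Rightarrow> 'a mat \<Rightarrow> 'a mat \<Rightarrow> bool" where
  "cong_mat n I A B \<longleftrightarrow> (\<forall>i<n. \<forall>j<n. A $$ (i,j) - B $$ (i,j) \<in> I)"

lemma cong_mat_oneD:
  assumes "cong_mat n I A (1\<^sub>m n)" "i < n" "j < n"
  shows "A $$ (i,j) - (if i = j then 1 else 0) \<in> I"
proof -
  have "A $$ (i,j) - (1\<^sub>m n) $$ (i,j) \<in> I" using assms unfolding cong_mat_def by blast
  then show ?thesis using assms by simp
qed

lemma cong_mat_mult:
  assumes D: "is_subring D" and I: "ideal_in D I"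
    and "A \<in> mats n D" "B \<in> mats n D" "A' \<in> mats n D" "B' \<in> mats n D"
    and c: "cong_mat n I A A'" "cong_mat n I B B'"
  shows "cong_mat n I (A * B) (A' * B')"
  unfolding cong_mat_def
proof (intro allI impI)
  fix i j assume ij: "i < n" "j < n"
  have "(A * B) $$ (i,j) - (A' * B') $$ (i,j) = (\<Sum>k<n. A $$ (i,k) * B $$ (k,j) - A' $$ (i,k) * B' $$ (k,j))"
    using assms ij by (simp add: mult_mat_entry[OF matsD(1) matsD(1)] sum_subtractf del: index_mult_mat(1))
  also have "\<dots> = (\<Sum>k<n. A $$ (i,k) * (B $$ (k,j) - B' $$ (k,j)) + (A $$ (i,k) - A' $$ (i,k)) * B' $$ (k,j))"
    by (intro sum.cong) (auto simp: algebra_simps)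
  also have "\<dots> \<in> I"
    using assms ij by (intro ideal_in_sum[OF I] ideal_inD(3)[OF I] ideal_inD(4,5)[OF I]) (auto simp: cong_mat_def matsD)
  finally show "(A * B) $$ (i,j) - (A' * B') $$ (i,j) \<in> I" .
qed

text \<open>The pivot 1 clears its column and row by transvections, and \<open>B\<close> is the
  Schur complement. The product subtracted from each entry contains a factor from the first row,
  which lies in \<open>I\<close>, so the congruence survives.\<close>

lemma pivot:
  assumes D: "is_subring D" and A: "A \<in> mats (Suc n) D" and A00: "A $$ (0,0) = 1"
    and det: "det A = 1" and I: "ideal_in D I" and cong: "cong_mat (Suc n) I A (1\<^sub>m (Suc n))"
  obtains B where "B \<in> mats n D" "det B = 1" "cong_mat n I B (1\<^sub>m n)"
    "emb n (Suc n) Suc B \<in> Eg (Suc n) D \<longleftrightarrow> A \<in> Eg (Suc n) D"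
proof -
  let ?n = "Suc n"
  define L where "L = col_mat ?n 0 (\<lambda>i. - A $$ (i,0))"
  define R where "R = row_mat ?n 0 (\<lambda>j. - A $$ (0,j))"
  have L: "L \<in> Eg ?n D" unfolding L_def using A by (intro col_mat_Eg) (auto simp: D is_subringD matsD)
  have R: "R \<in> Eg ?n D" unfolding R_def using A by (intro row_mat_Eg) (auto simp: D is_subringD matsD)
  define M where "M = L * (A * R)"
  have Ac: "A \<in> carrier_mat ?n ?n" using A by (simp add: matsD)
  have AR: "(A * R) $$ (i,j) = A $$ (i,j) + (if j \<noteq> 0 then A $$ (i,0) * - A $$ (0,j) else 0)" if "i < ?n" "j < ?n" for i j
    unfolding R_def by (rule mult_row_mat) (use Ac that in auto)
  have M: "M $$ (i,j) = (A * R) $$ (i,j) + (if i \<noteq> 0 then - A $$ (i,0) * (A * R) $$ (0,j) else 0)" if "i < ?n" "j < ?n" for i j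
    unfolding M_def L_def by (rule col_mat_mult) (use Ac that in \<open>auto simp: R_def\<close>)
  have Mc: "M \<in> mats ?n D" unfolding M_def using A Eg_mats[OF D L] Eg_mats[OF D R] by (intro mats_mult D)
  define B where "B = mat n n (\<lambda>(i,j). M $$ (Suc i, Suc j))"
  have sub: "Suc ` {..<n} \<subseteq> {..<?n}" by auto
  have Me: "M = emb n ?n Suc B"
  proof (rule eq_matI)
    fix i j assume "i < dim_row (emb n ?n Suc B)" "j < dim_col (emb n ?n Suc B)"
    then have ij: "i < ?n" "j < ?n" by (auto simp: emb_def)
    show "M $$ (i,j) = emb n ?n Suc B $$ (i,j)"
    proof (cases "i = 0 \<or> j = 0")
      case True
      then have "i \<notin> Suc ` {..<n} \<or> j \<notin> Suc ` {..<n}" by auto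
      then have "emb n ?n Suc B $$ (i,j) = (if i = j then 1 else 0)" using ij by (simp add: emb_out)
      moreover have "M $$ (i,j) = (if i = j then 1 else 0)" using True ij by (auto simp: M AR A00)
      ultimately show ?thesis by simp
    next
      case False
      then obtain i' j' where "i = Suc i'" "j = Suc j'" by (cases i; cases j) auto
      then have "emb n ?n Suc B $$ (i,j) = B $$ (i',j')"
        using ij by (simp only: emb_entry[of Suc n ?n i' j' B, OF inj_Suc sub] Suc_less_eq)
      then show ?thesis using ij \<open>i = Suc i'\<close> \<open>j = Suc j'\<close> by (simp add: B_def)
    qed
  qed (use Mc in \<open>auto simp: emb_def mats_def\<close>)
  have dM: "det M = 1"
    unfolding M_def using Ac L R det by (simp add: det_mult[of _ ?n] Eg_carrier Eg_det)
  have "det M = (\<Sum>i<?n. M $$ (i,0) * cofactor M i 0)"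
    by (rule laplace_expansion_column) (use Mc in \<open>auto simp: mats_def\<close>)
  also have "\<dots> = M $$ (0,0) * cofactor M 0 0"
    by (subst sum.lessThan_Suc_shift) (simp add: Me emb_out)
  also have "\<dots> = det (mat_delete M 0 0)"
    unfolding Me by (simp add: emb_out cofactor_def)
  also have "mat_delete M 0 0 = B"
    using Mc by (intro eq_matI) (auto simp: mat_delete_def B_def mats_def)
  finally have dB: "det B = 1" using dM by simp
  have BD: "B \<in> mats n D" using Mc by (auto simp: B_def mats_def)
  have BI: "cong_mat n I B (1\<^sub>m n)" unfolding cong_mat_def
  proof (intro allI impI)
    fix i j assume ij: "i < n" "j < n"
    have "A $$ (0, Suc j) - (1\<^sub>m ?n) $$ (0, Suc j) \<in> I"
      using cong ij unfolding cong_mat_def by (metis Suc_less_eq zero_less_Suc)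
    then have a: "A $$ (0, Suc j) \<in> I" using ij by simp
    have "A $$ (Suc i, Suc j) - (1\<^sub>m ?n) $$ (Suc i, Suc j) \<in> I"
      using cong ij unfolding cong_mat_def by (metis Suc_less_eq)
    moreover have "A $$ (Suc i, 0) * - A $$ (0, Suc j) \<in> I"
      using A ij by (intro ideal_inD(4)[OF I] ideal_in_uminus[OF D I] a) (auto simp: mats_def)
    ultimately have "A $$ (Suc i, Suc j) - (1\<^sub>m ?n) $$ (Suc i, Suc j) + A $$ (Suc i, 0) * - A $$ (0, Suc j) \<in> I"
      by (rule ideal_inD(3)[OF I])
    moreover have "B $$ (i,j) - (1\<^sub>m n) $$ (i,j) = A $$ (Suc i, Suc j) - (1\<^sub>m ?n) $$ (Suc i, Suc j) + A $$ (Suc i, 0) * - A $$ (0, Suc j)"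
      using ij by (simp add: B_def M AR A00)
    ultimately show "B $$ (i,j) - (1\<^sub>m n) $$ (i,j) \<in> I" by simp
  qed
  have "M \<in> Eg ?n D \<longleftrightarrow> A \<in> Eg ?n D"
    unfolding M_def using Ac Eg_cancel_left[OF D L, of "A * R"] Eg_cancel_right[OF D R Ac] Eg_mult[OF L Eg_mult[OF _ R]]
      Eg_carrier[OF R] by auto
  with dB BD BI Me that show thesis by auto
qed

lemma Eg_one_by_one:
  assumes "A \<in> carrier_mat 1 1" "det A = 1"
  shows "A \<in> Eg 1 D"
proof -
  have "A = 1\<^sub>m 1" using assms det_single[of A] by (intro eq_matI) auto
  then show ?thesis by (simp add: Eg.one)
qed

section \<open>Mennicke symbols\<close>

definition m3 :: "'a \<Rightarrow> 'a \<Rightarrow> 'a \<Rightarrow> 'a \<Rightarrow> 'a \<Rightarrow> 'a \<Rightarrow> 'a \<Rightarrow> 'a \<Rightarrow> 'a \<Rightarrow> 'a mat" where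
  "m3 a b c d e f g h k = mat 3 3 (\<lambda>(i,j). [[a,b,c],[d,e,f],[g,h,k]] ! i ! j)"

lemma less3: "i < 3 \<longleftrightarrow> i = 0 \<or> i = 1 \<or> i = (2::nat)"
  by auto

lemma m3_carrier [simp]: "m3 a b c d e f g h k \<in> carrier_mat 3 3"
  by (simp add: m3_def)

lemma m3_entries [simp]:
  "m3 a b c d e f g h k $$ (0,0) = a" "m3 a b c d e f g h k $$ (0,1) = b" "m3 a b c d e f g h k $$ (0,2) = c"
  "m3 a b c d e f g h k $$ (1,0) = d" "m3 a b c d e f g h k $$ (1,1) = e" "m3 a b c d e f g h k $$ (1,2) = f"
  "m3 a b c d e f g h k $$ (2,0) = g" "m3 a b c d e f g h k $$ (2,1) = h" "m3 a b c d e f g h k $$ (2,2) = k"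
  by (simp_all add: m3_def)

lemma m3_eqI:
  assumes "A \<in> carrier_mat 3 3"
    and "A $$ (0,0) = a" "A $$ (0,1) = b" "A $$ (0,2) = c"
      "A $$ (1,0) = d" "A $$ (1,1) = e" "A $$ (1,2) = f"
      "A $$ (2,0) = g" "A $$ (2,1) = h" "A $$ (2,2) = k"
  shows "A = m3 a b c d e f g h k"
proof (rule eq_matI)
  fix i j assume "i < dim_row (m3 a b c d e f g h k)" "j < dim_col (m3 a b c d e f g h k)"
  then have "i < 3" "j < 3" by (simp_all add: m3_def)
  then show "A $$ (i,j) = m3 a b c d e f g h k $$ (i,j)"
    unfolding less3 using assms by (elim disjE) (simp_all del: One_nat_def)
qed (use assms(1) in \<open>auto simp: m3_def\<close>)

lemma m3_mult:
  fixes a :: "'a::comm_ring_1"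
  shows "m3 a b c d e f g h k * m3 a' b' c' d' e' f' g' h' k' =
    m3 (a*a'+b*d'+c*g') (a*b'+b*e'+c*h') (a*c'+b*f'+c*k')
       (d*a'+e*d'+f*g') (d*b'+e*e'+f*h') (d*c'+e*f'+f*k')
       (g*a'+h*d'+k*g') (g*b'+h*e'+k*h') (g*c'+h*f'+k*k')" (is "?A * ?B = _")
proof -
  have s: "(\<Sum>l<3. F l) = F 0 + F 1 + F 2" for F :: "nat \<Rightarrow> 'a"
    by (simp add: eval_nat_numeral)
  have "(?A * ?B) $$ (i,j) = ?A $$ (i,0) * ?B $$ (0,j) + ?A $$ (i,1) * ?B $$ (1,j) + ?A $$ (i,2) * ?B $$ (2,j)"
    if "i < 3" "j < 3" for i j
    using that by (subst mult_mat_entry[of _ 3]) (simp_all add: s)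
  then show ?thesis by (intro m3_eqI mult_carrier_mat[of _ 3 3]) (simp_all del: One_nat_def index_mult_mat(1))
qed

lemma addrow_m3:
  "addrow_mat 3 x 0 1 = m3 1 x 0 0 1 0 0 0 1" "addrow_mat 3 x 0 2 = m3 1 0 x 0 1 0 0 0 1"
  "addrow_mat 3 x 1 0 = m3 1 0 0 x 1 0 0 0 1" "addrow_mat 3 x 1 2 = m3 1 0 0 0 1 x 0 0 1"
  "addrow_mat 3 x 2 0 = m3 1 0 0 0 1 0 x 0 1" "addrow_mat 3 x 2 1 = m3 1 0 0 0 1 0 0 x 1"
  by (rule m3_eqI; simp)+

abbreviation M2 :: "'a::comm_ring_1 \<Rightarrow> 'a \<Rightarrow> 'a \<Rightarrow> 'a \<Rightarrow> 'a mat" where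
  "M2 a b c d \<equiv> m3 a b 0 c d 0 0 0 1"

text \<open>This and the other coordinate permutations carry a two by two block to another pair of
  indices without leaving the elementary group.\<close>

lemma emb_m3_rev:
  fixes a :: "'a::comm_ring_1"
  shows "emb 3 3 (\<lambda>i. 2 - i) (m3 a b c d e f g h k) = m3 k h g f e d c b a"
proof -
  have i: "inj_on (\<lambda>i. 2 - i) {..<3::nat}" "(\<lambda>i. 2 - i) ` {..<3::nat} \<subseteq> {..<3}"
    by (auto simp: inj_on_def)
  note E = emb_entry[OF i, of _ _ "m3 a b c d e f g h k"]
  show ?thesis
    using E[of 0 0] E[of 0 1] E[of 0 2] E[of 1 0] E[of 1 1] E[of 1 2] E[of 2 0] E[of 2 1] E[of 2 2]
    by (intro m3_eqI) (simp_all flip: One_nat_def add: numeral_2_eq_2[symmetric])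
qed

lemma emb_m3_swap:
  fixes a :: "'a::comm_ring_1"
  shows "emb 3 3 (\<lambda>i. if i = 1 then 2 else if i = 2 then 1 else i) (m3 a b c d e f g h k) = m3 a c b g k h d f e"
proof -
  let ?s = "\<lambda>i::nat. if i = 1 then 2 else if i = 2 then 1 else i"
  have i: "inj_on ?s {..<3::nat}" "?s ` {..<3::nat} \<subseteq> {..<3}"
    by (auto simp: inj_on_def)
  note E = emb_entry[OF i, of _ _ "m3 a b c d e f g h k"]
  show ?thesis
    using E[of 0 0] E[of 0 1] E[of 0 2] E[of 1 0] E[of 1 1] E[of 1 2] E[of 2 0] E[of 2 1] E[of 2 2]
    by (intro m3_eqI) (simp_all del: One_nat_def)
qed

text \<open>\<open>tri D a b\<close> says that the Mennicke symbol of \<open>(a, b)\<close> over the subring \<open>D\<close> is trivial.\<close>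

definition tri :: "'a::comm_ring_1 set \<Rightarrow> 'a \<Rightarrow> 'a \<Rightarrow> bool" where
  "tri D a b \<longleftrightarrow> a \<in> D \<and> b \<in> D \<and> (\<exists>c\<in>D. \<exists>d\<in>D. a * d - b * c = 1 \<and> M2 a b c d \<in> Eg 3 D)"

context
  fixes D :: "'a::comm_ring_1 set"
  assumes D: "is_subring D"
begin

private lemmas DD = is_subringD[OF D]

lemma Eg3_addrow:
  assumes "x \<in> D"
  shows "m3 1 x 0 0 1 0 0 0 1 \<in> Eg 3 D" "m3 1 0 x 0 1 0 0 0 1 \<in> Eg 3 D"
  "m3 1 0 0 x 1 0 0 0 1 \<in> Eg 3 D" "m3 1 0 0 0 1 x 0 0 1 \<in> Eg 3 D"
  "m3 1 0 0 0 1 0 x 0 1 \<in> Eg 3 D" "m3 1 0 0 0 1 0 0 x 1 \<in> Eg 3 D"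
  unfolding addrow_m3[symmetric] using assms by (auto intro!: Eg_addrow)

text \<open>Two completions of the row \<open>(a, b)\<close> to determinant one differ by a
  transvection on the left, with parameter \<open>c * d' - d * c'\<close>. So triviality depends on
  the row alone.\<close>

lemma tri_witness:
  assumes "tri D a b" "c \<in> D" "d \<in> D" "a * d - b * c = 1"
  shows "M2 a b c d \<in> Eg 3 D"
proof -
  obtain c' d' where w: "c' \<in> D" "d' \<in> D" "a * d' - b * c' = 1" "M2 a b c' d' \<in> Eg 3 D"
    using assms(1) unfolding tri_def by auto
  define x where "x = c * d' - d * c'"
  have "x * a + c' = c" "x * b + d' = d"
  proof -
    have "x * a + c' = c * (a * d') - c' * (a * d - 1)" unfolding x_def by (simp add: algebra_simps)
    also have "\<dots> = c" using assms(4) w(3) by (simp add: diff_eq_eq) (simp add: algebra_simps)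
    finally show "x * a + c' = c" .
    have "1 + b * c = a * d" "1 + b * c' = a * d'" using assms(4) w(3) by (simp_all add: algebra_simps)
    then have "d' * (1 + b * c) - d * (1 + b * c') = 0" by (simp add: algebra_simps)
    moreover have "x * b + d' = d' * (1 + b * c) - d * (1 + b * c') + d" unfolding x_def by (simp add: algebra_simps)
    ultimately have "x * b + d' = d" by simp
    then show "x * b + d' = d" .
  qed
  then have "M2 a b c d = m3 1 0 0 x 1 0 0 0 1 * M2 a b c' d'"
    unfolding m3_mult by simp
  also have "\<dots> \<in> Eg 3 D" using assms w by (intro Eg_mult Eg3_addrow) (auto simp: x_def DD)
  finally show ?thesis .
qed

lemma triD: "tri D a b \<Longrightarrow> a \<in> D" "tri D a b \<Longrightarrow> b \<in> D"
  by (auto simp: tri_def)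

lemma tri_add_left:
  assumes "tri D a b" "h \<in> D"
  shows "tri D (a + h * b) b"
proof -
  obtain c d where w: "c \<in> D" "d \<in> D" "a * d - b * c = 1" "M2 a b c d \<in> Eg 3 D"
    using assms(1) unfolding tri_def by auto
  have "M2 a b c d * m3 1 0 0 h 1 0 0 0 1 = M2 (a + h * b) b (c + h * d) d"
    unfolding m3_mult by (simp add: mult.commute)
  then have "M2 (a + h * b) b (c + h * d) d \<in> Eg 3 D"
    using Eg_mult[OF w(4) Eg3_addrow(3)[OF assms(2)]] by simp
  moreover have "(a + h * b) * d - b * (c + h * d) = 1" using w(3) by (simp add: algebra_simps)
  ultimately show ?thesis using w assms triD[OF assms(1)] unfolding tri_def by (auto intro!: DD)
qed

lemma tri_add_right:
  assumes "tri D a b" "h \<in> D"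
  shows "tri D a (b + h * a)"
proof -
  obtain c d where w: "c \<in> D" "d \<in> D" "a * d - b * c = 1" "M2 a b c d \<in> Eg 3 D"
    using assms(1) unfolding tri_def by auto
  have "M2 a b c d * m3 1 h 0 0 1 0 0 0 1 = M2 a (b + h * a) c (d + h * c)"
    unfolding m3_mult by (simp add: mult.commute add.commute)
  then have "M2 a (b + h * a) c (d + h * c) \<in> Eg 3 D"
    using Eg_mult[OF w(4) Eg3_addrow(1)[OF assms(2)]] by simp
  moreover have "a * (d + h * c) - (b + h * a) * c = 1" using w(3) by (simp add: algebra_simps)
  ultimately show ?thesis using w assms triD[OF assms(1)] unfolding tri_def by (auto intro!: DD)
qed

lemma tri_one_left: "b \<in> D \<Longrightarrow> tri D 1 b"
  unfolding tri_def using Eg3_addrow(1)[of b] DD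
  by (intro conjI bexI[of _ 0] bexI[of _ 1]) auto

text \<open>Whitehead's identity: the rotation by a right angle is a product of three
  transvections.\<close>

lemma Eg3_rotation: "M2 0 (-1) 1 0 \<in> Eg 3 D"
proof -
  have "M2 0 (-1) 1 0 = m3 1 (-1) 0 0 1 0 0 0 1 * (m3 1 0 0 1 1 0 0 0 1 * m3 1 (-1) 0 0 1 0 0 0 (1::'a))"
    unfolding m3_mult by simp
  also have "\<dots> \<in> Eg 3 D" by (intro Eg_mult Eg3_addrow) (auto simp: DD)
  finally show ?thesis .
qed

lemma tri_minus_one:
  assumes "b \<in> D"
  shows "tri D b (-1)"
proof -
  have "tri D 0 (-1)" unfolding tri_def
    by (intro conjI bexI[of _ 0] bexI[of _ 1] Eg3_rotation) (auto simp: DD)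
  from tri_add_left[OF this, of "- b"] show ?thesis using assms by (simp add: DD)
qed

lemma tri_rotate:
  assumes "tri D a b"
  shows "tri D b (- a)"
proof -
  obtain c d where w: "c \<in> D" "d \<in> D" "a * d - b * c = 1" "M2 a b c d \<in> Eg 3 D"
    using assms(1) unfolding tri_def by auto
  have "M2 a b c d * M2 0 (-1) 1 0 = M2 b (- a) d (- c)"
    unfolding m3_mult by simp
  then have "M2 b (- a) d (- c) \<in> Eg 3 D"
    using Eg_mult[OF w(4) Eg3_rotation] by simp
  moreover have "b * - c - - a * d = 1" using w(3) by (simp add: algebra_simps)
  ultimately show ?thesis using w triD[OF assms(1)] unfolding tri_def
    by (intro conjI bexI[of _ d] bexI[of _ "- c"]) (auto intro!: DD)
qed

text \<open>The classical proof that Mennicke symbols multiply: blocks for \<open>(a, b1)\<close>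
  and \<open>(a, b2)\<close> are placed on overlapping pairs of three indices, and their product is
  reduced to a block for \<open>(a, b1 * b2)\<close>. The result is kept as an equivalence so that
  it yields cancellation as well as multiplication.\<close>

lemma tri_mult_aux:
  assumes "a \<in> D" "b1 \<in> D" "b2 \<in> D" "c1 \<in> D" "d1 \<in> D" "c2 \<in> D" "d2 \<in> D"
    and w: "a * d1 - b1 * c1 = 1" "a * d2 - b2 * c2 = 1"
  obtains N P Q where "N \<in> carrier_mat 3 3" "N \<in> Eg 3 D \<longleftrightarrow> M2 a b1 c1 d1 \<in> Eg 3 D"
    "P \<in> carrier_mat 3 3" "M2 a b2 c2 d2 \<in> Eg 3 D \<Longrightarrow> P \<in> Eg 3 D"
    "P * N \<in> Eg 3 D \<longleftrightarrow> tri D a (b1 * b2)"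
proof -
  let ?N = "m3 1 0 0 0 d1 c1 0 b1 a" and ?P = "m3 a 0 b2 0 1 0 c2 0 d2"
  have inj: "inj_on (\<lambda>i. 2 - i) {..<3::nat}" "(\<lambda>i. 2 - i) ` {..<3::nat} \<subseteq> {..<3}"
    by (auto simp: inj_on_def)
  let ?s = "\<lambda>i::nat. if i = 1 then 2 else if i = 2 then 1 else i"
  have inj': "inj_on ?s {..<3::nat}" "?s ` {..<3::nat} \<subseteq> {..<3}"
    by (auto simp: inj_on_def)
  have N: "?N \<in> Eg 3 D \<longleftrightarrow> M2 a b1 c1 d1 \<in> Eg 3 D"
    using emb_Eg[OF inj, of "M2 a b1 c1 d1" D] emb_Eg[OF inj, of ?N D] by (auto simp: emb_m3_rev)
  have P: "?P \<in> Eg 3 D" if "M2 a b2 c2 d2 \<in> Eg 3 D"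
    using emb_Eg[OF inj' that] by (simp only: emb_m3_swap)
  have 1: "d2 * a = 1 + b2 * c2" using w(2) by (simp add: algebra_simps)
  have q0: "?P * ?N = m3 a (b2 * b1) (b2 * a) 0 d1 c1 c2 (d2 * b1) (1 + b2 * c2)"
    unfolding m3_mult by (simp add: 1)
  \<comment> \<open>\<open>?R1\<close> turns the last column into (0, \<open>c1\<close>, 1). The new
    corner 1 then clears the last row by column operations and the last column by
    \<open>?L\<close>.\<close>
  let ?R1 = "m3 1 0 (- b2) 0 1 0 0 0 1" and ?R2 = "m3 1 0 0 0 1 0 (- c2) 0 1"
  let ?R3 = "m3 1 0 0 0 1 0 0 (- (d2 * b1)) 1" and ?L = "m3 1 0 0 0 1 (- c1) 0 0 1"
  have "?R1 \<in> Eg 3 D" "?R2 \<in> Eg 3 D" "?R3 \<in> Eg 3 D" and L: "?L \<in> Eg 3 D"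
    using assms by (auto intro!: Eg3_addrow DD)
  note R = this(1-3)[THEN Eg_right_iff[OF D _ m3_carrier]] and L = Eg_left_iff[OF D L m3_carrier]
  have q1: "m3 a (b2 * b1) (b2 * a) 0 d1 c1 c2 (d2 * b1) (1 + b2 * c2) * ?R1 =
      m3 a (b2 * b1) 0 0 d1 c1 c2 (d2 * b1) 1"
    unfolding m3_mult by (simp add: algebra_simps)
  have q2: "m3 a (b2 * b1) 0 0 d1 c1 c2 (d2 * b1) 1 * ?R2 =
      m3 a (b2 * b1) 0 (- (c1 * c2)) d1 c1 0 (d2 * b1) 1"
    unfolding m3_mult by (simp add: algebra_simps)
  have q3: "m3 a (b2 * b1) 0 (- (c1 * c2)) d1 c1 0 (d2 * b1) 1 * ?R3 =
      m3 a (b2 * b1) 0 (- (c1 * c2)) (d1 - c1 * d2 * b1) c1 0 0 1"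
    unfolding m3_mult by (simp add: algebra_simps)
  have q4: "?L * m3 a (b2 * b1) 0 (- (c1 * c2)) (d1 - c1 * d2 * b1) c1 0 0 1 =
      M2 a (b1 * b2) (- (c1 * c2)) (d1 - c1 * d2 * b1)"
    unfolding m3_mult by (simp add: algebra_simps)
  have "M2 a (b1 * b2) (- (c1 * c2)) (d1 - c1 * d2 * b1) \<in> Eg 3 D \<longleftrightarrow> tri D a (b1 * b2)"
  proof -
    have "a * (d1 - c1 * d2 * b1) - (b1 * b2) * (- (c1 * c2)) = a * d1 - b1 * c1 * (d2 * a - b2 * c2)"
      by (simp add: algebra_simps)
    also have "\<dots> = 1" using w(1) by (simp add: 1)
    finally have det: "a * (d1 - c1 * d2 * b1) - (b1 * b2) * (- (c1 * c2)) = 1" .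
    have cd: "- (c1 * c2) \<in> D" "d1 - c1 * d2 * b1 \<in> D" "b1 * b2 \<in> D" using assms by (auto intro!: DD)
    show ?thesis using tri_witness[OF _ cd(1,2) det] det cd assms(1) unfolding tri_def by blast
  qed
  moreover have "m3 a (b2 * b1) (b2 * a) 0 d1 c1 c2 (d2 * b1) (1 + b2 * c2) \<in> Eg 3 D \<longleftrightarrow>
      m3 a (b2 * b1) 0 0 d1 c1 c2 (d2 * b1) 1 \<in> Eg 3 D" by (simp only: q1[symmetric] R(1))
  moreover have "\<dots> \<longleftrightarrow> m3 a (b2 * b1) 0 (- (c1 * c2)) d1 c1 0 (d2 * b1) 1 \<in> Eg 3 D"
    by (simp only: q2[symmetric] R(2))
  moreover have "\<dots> \<longleftrightarrow> m3 a (b2 * b1) 0 (- (c1 * c2)) (d1 - c1 * d2 * b1) c1 0 0 1 \<in> Eg 3 D"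
    by (simp only: q3[symmetric] R(3))
  moreover have "\<dots> \<longleftrightarrow> M2 a (b1 * b2) (- (c1 * c2)) (d1 - c1 * d2 * b1) \<in> Eg 3 D"
    by (simp only: q4[symmetric] L)
  ultimately have PN: "?P * ?N \<in> Eg 3 D \<longleftrightarrow> tri D a (b1 * b2)" unfolding q0 by blast
  show thesis by (rule that[OF m3_carrier N m3_carrier P PN])
qed

lemma tri_mult:
  assumes "tri D a b1" "tri D a b2"
  shows "tri D a (b1 * b2)"
proof -
  obtain c1 d1 where w1: "c1 \<in> D" "d1 \<in> D" "a * d1 - b1 * c1 = 1" "M2 a b1 c1 d1 \<in> Eg 3 D"
    using assms(1) unfolding tri_def by auto
  obtain c2 d2 where w2: "c2 \<in> D" "d2 \<in> D" "a * d2 - b2 * c2 = 1" "M2 a b2 c2 d2 \<in> Eg 3 D"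
    using assms(2) unfolding tri_def by auto
  from tri_mult_aux[OF triD(1)[OF assms(1)] triD(2)[OF assms(1)] triD(2)[OF assms(2)] w1(1,2) w2(1,2) w1(3) w2(3)]
  show ?thesis using w1(4) w2(4) by (metis Eg_mult)
qed

lemma tri_divide:
  assumes "tri D a (b1 * b2)" "tri D a b2" "b1 \<in> D"
  shows "tri D a b1"
proof -
  obtain c d where w: "c \<in> D" "d \<in> D" "a * d - b1 * b2 * c = 1"
    using assms(1) unfolding tri_def by auto
  \<comment> \<open>The Bezout relation for \<open>(a, b1 * b2)\<close> also completes
    \<open>(a, b1)\<close> once \<open>b2\<close> is moved to the other factor.\<close>
  have w1: "b2 * c \<in> D" "a * d - b1 * (b2 * c) = 1"
    using w triD(2)[OF assms(2)] by (auto simp: DD mult.assoc)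
  obtain c2 d2 where w2: "c2 \<in> D" "d2 \<in> D" "a * d2 - b2 * c2 = 1" "M2 a b2 c2 d2 \<in> Eg 3 D"
    using assms(2) unfolding tri_def by auto
  from tri_mult_aux[OF triD(1)[OF assms(2)] assms(3) triD(2)[OF assms(2)] w1(1) w(2) w2(1,2) w1(2) w2(3)]
  have "M2 a b1 (b2 * c) d \<in> Eg 3 D" using assms(1) w2(4) by (metis Eg_cancel_left D)
  then show ?thesis using w1 w assms triD[OF assms(2)] unfolding tri_def by blast
qed

text \<open>Rotation alone yields the pair \<open>(b, - a)\<close>; multiplying by the trivial
  symbol of \<open>(b, -1)\<close> removes the sign.\<close>

lemma tri_sym: 
  assumes "tri D a b"
  shows "tri D b a"
  using tri_mult[OF tri_rotate[OF assms] tri_minus_one[OF triD(2)[OF assms]]] by simp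

end

section \<open>Mennicke symbols over a valuation ring\<close>

lemma finite_coeffs: "finite (range (coeff p))"
proof (rule finite_subset)
  have "coeff p i \<in> insert 0 (coeff p ` {..degree p})" for i
    using coeff_eq_0[of p i] by (cases "i \<le> degree p") auto
  then show "range (coeff p) \<subseteq> insert 0 (coeff p ` {..degree p})" by blast
qed auto

lemma mod_poly_sum:
  fixes g :: "'k::field poly"
  shows "(\<Sum>j\<in>S. f j) mod g = (\<Sum>j\<in>S. f j mod g)"
  by (induction S rule: infinite_finite_induct) (auto simp: poly_mod_add_left)

text \<open>The ambient field is automatically the field of fractions of \<open>V\<close>. Its class
  \<open>field_gcd\<close> provides gcds and prime factors for polynomials over it.\<close>

locale valuation_subring =
  fixes V :: "'k::field_gcd set"
  assumes V: "is_subring V" and val: "\<And>x. x \<in> V \<or> inverse x \<in> V"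
begin

lemmas VD = is_subringD[OF V]

lemma val_divide: "a \<noteq> 0 \<Longrightarrow> a / b \<in> V \<or> b / a \<in> V"
  using val[of "a / b"] by (auto simp: inverse_eq_divide)

lemma val_max:
  assumes "finite S" "S \<noteq> {}" "0 \<notin> S"
  obtains m where "m \<in> S" "\<And>x. x \<in> S \<Longrightarrow> x / m \<in> V"
proof -
  from assms have "\<exists>m\<in>S. \<forall>x\<in>S. x / m \<in> V"
  proof (induction S rule: finite_ne_induct)
    case (singleton x)
    then show ?case by (auto simp: VD)
  next
    case (insert x S)
    then obtain m where m: "m \<in> S" "\<forall>y\<in>S. y / m \<in> V" by auto
    show ?case
    proof (cases "x / m \<in> V")
      case True
      then show ?thesis using m by auto
    next
      case False
      then have mx: "m / x \<in> V" using val_divide[of x m] insert.prems by auto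
      have "y / x \<in> V" if "y \<in> S" for y
      proof -
        have "y / m * (m / x) \<in> V" using m that mx by (intro VD) auto
        then show ?thesis using m insert.prems by (auto simp: field_simps split: if_splits)
      qed
      then show ?thesis using insert.prems by (intro bexI[of _ x]) (auto simp: VD)
    qed
  qed
  then show thesis using that by auto
qed

text \<open>Divisibility is total on the finitely many nonzero coefficients, so one of them divides
  all others and serves as the content.\<close>

lemma poly_content:
  assumes "h \<noteq> 0"
  obtains m where "coeff h m \<noteq> 0" "\<And>j. coeff h j / coeff h m \<in> V"
proof -
  let ?S = "range (coeff h) - {0}"
  have "\<exists>j. coeff h j \<noteq> 0" using assms by (auto simp: poly_eq_iff)
  then have "?S \<noteq> {}" by blast
  then obtain c where "c \<in> ?S" "\<And>x. x \<in> ?S \<Longrightarrow> x / c \<in> V"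
    using val_max[of ?S] finite_coeffs[of h] by auto
  moreover from this have "coeff h j / c \<in> V" for j by (cases "coeff h j = 0") (auto simp: VD)
  ultimately show thesis using that by auto
qed

end

text \<open>The condition \<open>rank_one\<close> implies that every nonzero prime of
  \<open>V\<close> contains \<open>P\<close>. It is stated in the form in which it is used: high
  powers of elements of \<open>P\<close> are divisible by any prescribed nonzero constant.\<close>

locale valuation_prime = valuation_subring V for V :: "'k::field_gcd set" +
  fixes P :: "'k set"
  assumes P: "ideal_in V P" and one_P: "1 \<notin> P"
    and prime_P: "\<And>a b. a \<in> V \<Longrightarrow> b \<in> V \<Longrightarrow> a * b \<in> P \<Longrightarrow> a \<in> P \<or> b \<in> P"
    and rank_one: "\<And>t r. t \<in> P \<Longrightarrow> r \<noteq> 0 \<Longrightarrow> \<exists>N. t ^ N / r \<in> V"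
    and nonzero_P: "\<exists>c\<in>P. c \<noteq> 0"
begin

text \<open>The localization of \<open>V\<close> at \<open>P\<close>, a valuation ring of rank one with maximal ideal \<open>P\<close>.\<close>

definition U :: "'k set" where "U = {y. y = 0 \<or> inverse y \<notin> P}"

lemmas PD = ideal_inD[OF P]

lemma P_V: "a \<in> P \<Longrightarrow> a \<in> V" by (rule PD)

lemma U_cases: "y \<notin> U \<Longrightarrow> inverse y \<in> P" by (auto simp: U_def)

text \<open>If \<open>y * t\<close> left \<open>V\<close>, its inverse would lie in
  \<open>V\<close>, and \<open>t\<close> times that inverse, which is the inverse of
  \<open>y\<close>, in \<open>P\<close>. So localizing at \<open>P\<close> does not enlarge
  \<open>P\<close>.\<close>

lemma UP:
  assumes "y \<in> U" "t \<in> P"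
  shows "y * t \<in> P"
proof (cases "y * t = 0")
  case False
  then have nz: "y \<noteq> 0" "t \<noteq> 0" by auto
  have yt: "y * t \<in> V"
  proof (rule ccontr)
    assume "y * t \<notin> V"
    then have "inverse (y * t) \<in> V" using val by blast
    then have "t * inverse (y * t) \<in> P" using assms(2) by (intro PD(5))
    then show False using assms(1) nz by (auto simp: U_def field_simps)
  qed
  show ?thesis
  proof (cases "y \<in> V")
    case True
    then show ?thesis using assms by (auto intro: PD)
  next
    case False
    then have i: "inverse y \<in> V" using val by blast
    have "inverse y * (y * t) \<in> P" using nz assms(2) by (simp flip: mult.assoc)
    then show ?thesis using prime_P[OF i yt] assms(1) nz by (auto simp: U_def)
  qed
qed (auto simp: PD)

lemma V_U: "V \<subseteq> U"
proof
  fix y assume y: "y \<in> V"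
  show "y \<in> U"
  proof (rule ccontr)
    assume n: "y \<notin> U"
    then have "y * inverse y \<in> P" using y U_cases by (auto intro: PD)
    then show False using n one_P by (auto simp: U_def)
  qed
qed

lemma U_mult:
  assumes "y \<in> U" "z \<in> U"
  shows "y * z \<in> U"
proof (rule ccontr)
  assume n: "y * z \<notin> U"
  then have "y * inverse (y * z) \<in> P" using U_cases UP assms by blast
  then show False using n assms by (auto simp: U_def field_simps split: if_splits)
qed

lemma U_add:
  assumes "y \<in> U" "z \<in> U"
  shows "y + z \<in> U"
proof -
  have *: "a + b \<in> U" if ab: "a \<in> U" "b \<in> U" "a / b \<in> V" "b \<noteq> 0" for a b
  proof -
    have "a + b = b * (1 + a / b)" using ab by (simp add: field_simps)
    moreover have "1 + a / b \<in> U" using V_U ab VD by blast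
    ultimately show ?thesis using U_mult ab by auto
  qed
  show ?thesis
    using *[of y z] *[of z y] assms val_divide[of y z] by (cases "y = 0"; cases "z = 0") (auto simp: add.commute)
qed

lemma U: "is_subring U"
  unfolding is_subring_def using U_add U_mult V_U VD
  by (auto simp: U_def inverse_minus_eq) (metis P V ideal_in_uminus minus_minus)

lemmas UD = is_subringD[OF U]

lemma UPi: "ideal_in U P"
  unfolding ideal_in_def using V_U P_V PD UP by auto

lemma U_scale:
  assumes "finite S" "S \<subseteq> U"
  obtains s where "s \<in> V" "s \<notin> P" "\<And>x. x \<in> S \<Longrightarrow> s * x \<in> V"
proof -
  from assms have "\<exists>s\<in>V. s \<notin> P \<and> (\<forall>x\<in>S. s * x \<in> V)"
  proof (induction S rule: finite_induct)
    case empty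
    then show ?case using one_P VD by auto
  next
    case (insert x S)
    then obtain s where s: "s \<in> V" "s \<notin> P" "\<forall>x\<in>S. s * x \<in> V" by auto
    obtain s' where s': "s' \<in> V" "s' \<notin> P" "s' * x \<in> V"
    proof (cases "x \<in> V")
      case True
      then show ?thesis using that[of 1] one_P VD by auto
    next
      case False
      then have "inverse x \<in> V" "x \<noteq> 0" using val VD by auto
      then show ?thesis using that[of "inverse x"] insert.prems VD by (auto simp: U_def)
    qed
    have "s' * s * y \<in> V" if "y \<in> insert x S" for y
    proof (cases "y = x")
      case True
      have "s' * x * s \<in> V" using s s' by (auto intro!: VD(4)[of "s' * x" s])
      then show ?thesis using True by (simp add: mult_ac)
    next
      case False
      then have "s' * (s * y) \<in> V" using False s s' that by (auto intro!: VD(4)[of s' "s * y"])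
      then show ?thesis by (simp add: mult_ac)
    qed
    then show ?case using s s' prime_P VD by (intro bexI[of _ "s' * s"]) auto
  qed
  then show thesis using that by auto
qed

lemma P_scale:
  assumes "finite S"
  obtains r where "r \<in> P" "r \<noteq> 0" "\<And>x. x \<in> S \<Longrightarrow> r * x \<in> P"
proof -
  from assms have "\<exists>r\<in>P. r \<noteq> 0 \<and> (\<forall>x\<in>S. r * x \<in> P)"
  proof (induction S rule: finite_induct)
    case empty
    then show ?case using nonzero_P by auto
  next
    case (insert x S)
    then obtain r where r: "r \<in> P" "r \<noteq> 0" "\<forall>x\<in>S. r * x \<in> P" by auto
    obtain c where c: "c \<in> P" "c \<noteq> 0" using nonzero_P by auto
    obtain r' where r': "r' \<in> P" "r' \<noteq> 0" "r' * x \<in> P"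
    proof (cases "x \<in> V")
      case True
      then show ?thesis using that[of c] c by (auto intro: PD)
    next
      case False
      then have "inverse x \<in> V" "x \<noteq> 0" using val VD by auto
      then show ?thesis using that[of "c * inverse x"] c PD(5)[of c "inverse x"] by (auto simp: mult.assoc)
    qed
    have "r' * r * y \<in> P" if "y \<in> insert x S" for y
    proof (cases "y = x")
      case True
      have "r' * x * r \<in> P" using r r' P_V by (intro PD(4)) auto
      then show ?thesis using True by (simp add: mult_ac)
    next
      case False
      then have "r' * (r * y) \<in> P" using False r r' that P_V by (auto intro!: PD(4)[of r' "r * y"])
      then show ?thesis by (simp add: mult_ac)
    qed
    then show ?case using r r' P_V by (intro bexI[of _ "r' * r"]) (auto intro: PD)
  qed
  then show thesis using that by auto
qed

lemma P_scale_polys: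
  assumes "finite Q"
  obtains r where "r \<in> P" "r \<noteq> 0" "\<And>q. q \<in> Q \<Longrightarrow> smult r q \<in> polys P"
proof -
  have "finite (\<Union>q\<in>Q. range (coeff q))" using assms finite_coeffs by auto
  then obtain r where "r \<in> P" "r \<noteq> 0" "\<And>x. x \<in> (\<Union>q\<in>Q. range (coeff q)) \<Longrightarrow> r * x \<in> P"
    using P_scale by metis
  then show thesis by (intro that[of r]) (auto simp: polys_def)
qed

lemmas Vx = is_subring_polys[OF V]
lemmas VxD = is_subringD[OF Vx]
lemmas Px = ideal_in_polys[OF P]
lemmas PxD = ideal_inD[OF Px]

lemma P_content:
  assumes "h \<in> polys P"
  obtains t h' where "t \<in> P" "h' \<in> polys V" "h = smult t h'"
proof (cases "h = 0")
  case True
  then show ?thesis using that[of 0 0] PD VxD by auto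
next
  case False
  obtain m where m: "coeff h m \<noteq> 0" "\<And>j. coeff h j / coeff h m \<in> V" using poly_content[OF False] by metis
  show ?thesis
    by (rule that[of "coeff h m" "smult (inverse (coeff h m)) h"])
      (use m assms in \<open>auto simp: polys_def inverse_eq_divide\<close>)
qed

text \<open>A Bezout identity over the field has a denominator \<open>r\<close>. With
  \<open>h = 1 - g\<close> over \<open>P\<close>, the geometric series inverts \<open>g\<close> up
  to the error \<open>h ^ N\<close>, which for large \<open>N\<close> is a multiple of
  \<open>r\<close> by rank one; the scaled Bezout identity then supplies exactly this error.\<close>

lemma unimodular:
  assumes g: "g - 1 \<in> polys P" and f: "f \<in> polys P" and co: "coprime g f"
  obtains u w where "u \<in> polys V" "u - 1 \<in> polys P" "w \<in> polys P" "g * u + f * w = 1"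
proof -
  obtain a b where ab: "a * g + b * f = 1"
    using bezout_coefficients_fst_snd[of g f] co by (metis coprime_imp_gcd_eq_1)
  obtain r where r: "r \<in> P" "r \<noteq> 0" "smult r a \<in> polys P" "smult r b \<in> polys P"
    using P_scale_polys[of "{a, b}"] by (metis finite.emptyI finite.insertI insertCI)
  define h where "h = 1 - g"
  have h: "h \<in> polys P" using ideal_in_uminus[OF Vx Px g] by (simp add: h_def)
  then obtain t h' where t: "t \<in> P" "h' \<in> polys V" "h = smult t h'" by (rule P_content)
  obtain N where N: "t ^ N / r \<in> V" using rank_one[OF t(1) r(2)] by auto
  define y where "y = smult (t ^ N / r) (h' ^ N)"
  have y: "y \<in> polys V" unfolding y_def using t N by (intro polys_smult V subring_power Vx)
  have hN: "h ^ N = smult r y" unfolding y_def t(3) using r by (simp add: smult_power)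
  define u where "u = (\<Sum>i<N. h ^ i) + y * smult r a"
  define w where "w = y * smult r b"
  have "g * (\<Sum>i<N. h ^ i) = 1 - h ^ N"
    using one_diff_power_eq[of h N] by (simp add: h_def)
  moreover have "g * (y * smult r a) + f * (y * smult r b) = smult r y * (a * g + b * f)"
    by (simp add: algebra_simps)
  ultimately have 1: "g * u + f * w = 1"
    unfolding u_def w_def by (simp add: distrib_left ab hN)
  have u: "u \<in> polys V" unfolding u_def
    using y h r by (intro VxD subring_sum Vx subring_power) (auto intro: PxD)
  have w: "w \<in> polys P" unfolding w_def using y r by (intro PxD(4))
  have "u - 1 = - (u * (g - 1) + f * w)" using 1 by (simp add: algebra_simps)
  also have "\<dots> \<in> polys P" using u w g f by (intro ideal_in_uminus[OF Vx Px] PxD(3) PxD(4)[of u] PxD(5)[of f]) (auto intro: PxD(1))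
  finally show thesis using that u w 1 by auto
qed

text \<open>If \<open>s\<close> divides the content \<open>t\<close> of \<open>g - 1\<close>, then
  \<open>g\<close> is 1 plus a multiple of \<open>s\<close>, and the symbol is that of
  \<open>(1, s)\<close>. In general \<open>s\<close> divides a power of \<open>t\<close> by rank
  one; splitting off one factor \<open>t\<close> at a time reduces to this case by
  multiplicativity.\<close>

lemma tri_const:
  assumes g: "g - 1 \<in> polys P" and s: "s \<in> V" "s \<noteq> 0"
  shows "tri (polys V) g [:s:]"
proof -
  have *: "tri (polys V) g [:s:]" if "s \<in> V" "h \<in> polys V" "g - 1 = h * [:s:]" for s h
  proof -
    have "tri (polys V) (1 + h * [:s:]) [:s:]"
      using that VD by (intro tri_add_left Vx tri_one_left) (auto simp: polys_const)
    then show ?thesis unfolding that(3)[symmetric] by simp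
  qed
  obtain t h' where t: "t \<in> P" "h' \<in> polys V" "g - 1 = smult t h'" using P_content[OF g] .
  have **: "tri (polys V) g [:s:]" if "s \<in> V" "s \<noteq> 0" "t / s \<in> V" for s
    by (rule *[of s "smult (t / s) h'"]) (use that t in \<open>auto intro!: polys_smult V\<close>)
  obtain N where "t ^ N / s \<in> V" using rank_one[OF t(1) s(2)] by auto
  then show ?thesis using s
  proof (induction N arbitrary: s)
    case 0
    have "t * (1 / s) \<in> V" using 0 P_V[OF t(1)] by (intro VD) auto
    then show ?case using 0 ** by auto
  next
    case (Suc N)
    show ?case
    proof (cases "t / s \<in> V")
      case True
      then show ?thesis using ** Suc by auto
    next
      case False
      then have st: "s / t \<in> V" using val_divide[of s t] Suc.prems by auto
      have t0: "t \<noteq> 0" using False VD by auto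
      have "tri (polys V) g [:s / t:]"
        using Suc st t0 by (intro Suc.IH) (auto simp: field_simps)
      moreover have "tri (polys V) g [:t:]" using t0 P_V[OF t(1)] VD by (intro **) auto
      ultimately have "tri (polys V) g ([:s / t:] * [:t:])" by (rule tri_mult[OF Vx])
      then show ?thesis using t0 by simp
    qed
  qed
qed

text \<open>The symbol of \<open>(g, f)\<close> for \<open>f\<close> with arbitrary denominators.
  For \<open>g\<close> congruent to 1 modulo \<open>P\<close>, constants have trivial symbols, so
  the scaling \<open>s\<close> is immaterial (\<open>T_scale\<close>) and identities in K[x] can be
  used freely.\<close>

definition T :: "'k poly \<Rightarrow> 'k poly \<Rightarrow> bool" where
  "T g f \<longleftrightarrow> (\<exists>s. s \<noteq> 0 \<and> smult s f \<in> polys V \<and> tri (polys V) g (smult s f))"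

text \<open>One of the two scalings divides the other in \<open>V\<close>. The quotient is a
  constant with trivial symbol, which is multiplied in or cancelled.\<close>

lemma T_scale:
  assumes g: "g - 1 \<in> polys P" and T: "T g f" and s: "s \<noteq> 0" "smult s f \<in> polys V"
  shows "tri (polys V) g (smult s f)"
proof -
  obtain s1 where s1: "s1 \<noteq> 0" "smult s1 f \<in> polys V" "tri (polys V) g (smult s1 f)"
    using T unfolding T_def by auto
  show ?thesis
  proof (cases "s / s1 \<in> V")
    case True
    have "tri (polys V) g ([:s / s1:] * smult s1 f)"
      using True s s1 by (intro tri_mult[OF Vx] tri_const g) auto
    then show ?thesis using s1 by simp
  next
    case False
    then have "s1 / s \<in> V" using val_divide[of s s1] s by auto
    then have "tri (polys V) g [:s1 / s:]" using s s1 by (intro tri_const g) auto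
    moreover have "tri (polys V) g (smult s f * [:s1 / s:])" using s s1 by simp
    ultimately show ?thesis using tri_divide[OF Vx] s by blast
  qed
qed

context
  fixes g :: "'k poly"
  assumes g: "g - 1 \<in> polys P"
begin

lemma T_mult:
  assumes "T g f1" "T g f2"
  shows "T g (f1 * f2)"
proof -
  obtain s1 s2 where s: "s1 \<noteq> 0" "tri (polys V) g (smult s1 f1)" "s2 \<noteq> 0" "tri (polys V) g (smult s2 f2)"
    using assms unfolding T_def by auto
  have "tri (polys V) g (smult s1 f1 * smult s2 f2)" using s by (intro tri_mult[OF Vx])
  also have "smult s1 f1 * smult s2 f2 = smult (s1 * s2) (f1 * f2)" by (simp add: mult_ac)
  finally show ?thesis using s unfolding T_def by (intro exI[of _ "s1 * s2"]) (auto dest: triD[OF Vx])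
qed

lemma T_divide:
  assumes "T g (f1 * f2)" "T g f2"
  shows "T g f1"
proof -
  obtain s2 where s2: "s2 \<noteq> 0" "tri (polys V) g (smult s2 f2)"
    using assms unfolding T_def by auto
  obtain s where s: "s \<in> P" "s \<noteq> 0" "smult s f1 \<in> polys P" using P_scale_polys[of "{f1}"] by auto
  have sV: "smult s f1 \<in> polys V" using s(3) by (auto intro: PxD)
  have e: "smult (s * s2) (f1 * f2) = smult s f1 * smult s2 f2" by (simp add: mult_ac)
  have "smult s f1 * smult s2 f2 \<in> polys V" using sV triD[OF Vx s2(2)] by (intro VxD)
  then have "tri (polys V) g (smult s f1 * smult s2 f2)"
    using T_scale[OF g assms(1), of "s * s2"] s s2 e by auto
  then have "tri (polys V) g (smult s f1)" using s2 sV tri_divide[OF Vx] by blast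
  then show ?thesis unfolding T_def using s sV by blast
qed

text \<open>The factor \<open>h\<close> may have denominators, so the scaling of \<open>f\<close> is
  first enlarged by an \<open>r\<close> that clears them.\<close>

lemma T_add:
  assumes "T g f"
  shows "T g (f + h * g)"
proof -
  obtain s where s: "s \<noteq> 0" "smult s f \<in> polys V" using assms unfolding T_def by auto
  obtain r where r: "r \<in> P" "r \<noteq> 0" "smult r (smult s h) \<in> polys P"
    using P_scale_polys[of "{smult s h}"] by auto
  have "smult r (smult s f) \<in> polys V" by (rule polys_smult[OF V P_V[OF r(1)] s(2)])
  then have "tri (polys V) g (smult (r * s) f)" using r s T_scale[OF g assms, of "r * s"] by simp
  then have *: "tri (polys V) g (smult (r * s) f + smult (r * s) h * g)"
    using r by (intro tri_add_right Vx) (auto intro: PxD)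
  also have "smult (r * s) f + smult (r * s) h * g = smult (r * s) (f + h * g)"
    by (simp add: smult_add_right)
  finally show ?thesis unfolding T_def using r s * by (intro exI[of _ "r * s"]) (auto dest: triD[OF Vx])
qed

lemma T_const: "c \<noteq> 0 \<Longrightarrow> T g [:c:]"
  unfolding T_def using tri_const[OF g, of 1] VD
  by (intro exI[of _ "inverse c"]) (auto simp: polys_const one_pCons)

lemma T_mod: "T g (f mod g) \<Longrightarrow> T g f"
  using T_add[of "f mod g" "f div g"] by simp

text \<open>Reciprocity. Both entries are congruent to 1 modulo \<open>P\<close> and hence lie over
  \<open>V\<close>, so the scaling 1 is admissible on either side.\<close>

lemma T_sym:
  assumes z: "z - 1 \<in> polys P" and T: "T z g"
  shows "T g z"
proof -
  have zV: "z \<in> polys V" and gV: "g \<in> polys V"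
    using VxD(3)[of "z - 1" 1] VxD(3)[of "g - 1" 1] PxD(1) z g VxD by auto
  have "tri (polys V) z g" using T_scale[OF z T, of 1] gV by simp
  then have "tri (polys V) g z" by (rule tri_sym[OF Vx])
  then show ?thesis unfolding T_def using zV by (intro exI[of _ 1]) auto
qed

end

end

text \<open>As the divisor has leading coefficient 1, each step of the division multiplies it by a
  coefficient of the current remainder only. Hence quotient and remainder stay over the ideal that
  contains the coefficients of \<open>h\<close>.\<close>

lemma div_monic:
  fixes f1 :: "'k::field poly"
  assumes U: "is_subring U" and I: "ideal_in U I"
    and f1: "f1 \<in> polys U" "lead_coeff f1 = 1" and h: "h \<in> polys I"
  obtains q r where "q \<in> polys I" "r \<in> polys I" "h = q * f1 + r" "r = 0 \<or> degree r < degree f1"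
    "degree q \<le> degree h - degree f1"
proof -
  note Ix = ideal_in_polys[OF I]
  have "\<exists>q r. q \<in> polys I \<and> r \<in> polys I \<and> h = q * f1 + r \<and> (r = 0 \<or> degree r < degree f1) \<and>
    degree q \<le> n - degree f1" if "h \<in> polys I" "degree h \<le> n" for n h
    using that
  proof (induction n arbitrary: h rule: less_induct)
    case (less n)
    show ?case
    proof (cases "h = 0 \<or> degree h < degree f1")
      case True
      then show ?thesis using less.prems ideal_inD(2)[OF Ix] by (intro exI[of _ 0] exI[of _ h]) auto
    next
      case False
      define m where "m = monom (lead_coeff h) (degree h - degree f1)"
      have f10: "f1 \<noteq> 0" using f1 by auto
      have m: "m \<in> polys I" using less.prems(1) ideal_inD(2)[OF I] by (auto simp: m_def polys_def)
      define h' where "h' = h - m * f1"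
      have h': "h' \<in> polys I" unfolding h'_def
        using m less.prems(1) f1 by (intro ideal_in_diff[OF is_subring_polys[OF U] Ix] ideal_inD(5)[OF Ix])
      have dm: "degree m = degree h - degree f1" using False by (simp add: m_def degree_monom_eq)
      have m0: "m \<noteq> 0" using False by (simp add: m_def)
      have dh': "degree h' < degree h \<or> h' = 0"
      proof -
        have d: "degree (m * f1) = degree h" using False m0 f10 dm by (simp add: degree_mult_eq)
        have "lead_coeff (m * f1) = lead_coeff h" unfolding lead_coeff_mult f1(2)
          using dm by (simp add: m_def)
        then have "coeff h' (degree h) = 0" using d by (simp add: h'_def)
        moreover have "degree h' \<le> degree h" unfolding h'_def using d by (simp add: degree_diff_le)
        ultimately show ?thesis using leading_coeff_0_iff[of h'] by (cases "degree h' = degree h") auto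
      qed
      obtain q r where qr: "q \<in> polys I" "r \<in> polys I" "h' = q * f1 + r" "r = 0 \<or> degree r < degree f1"
        "degree q \<le> n - degree f1"
      proof (cases "h' = 0")
        case True
        then show ?thesis using that[of 0 0] ideal_inD(2)[OF Ix] by auto
      next
        case False
        then obtain q r where "q \<in> polys I" "r \<in> polys I" "h' = q * f1 + r" "r = 0 \<or> degree r < degree f1"
          "degree q \<le> degree h' - degree f1"
          using less.IH[of "degree h'" h'] dh' less.prems(2) h' by auto
        then show ?thesis using that[of q r] dh' less.prems(2) False by auto
      qed
      have "degree (q + m) \<le> n - degree f1"
        using qr(5) dm less.prems(2) by (intro degree_add_le) auto
      moreover have "h = (q + m) * f1 + r" using qr(3) by (simp add: h'_def algebra_simps)
      ultimately show ?thesis using qr ideal_inD(3)[OF Ix qr(1) m] by blast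
    qed
  qed
  from this[OF h order.refl] that show thesis by blast
qed

context valuation_prime
begin

definition tU :: "'k \<Rightarrow> 'k set" where "tU t = (*) t ` U"

lemma tU_ideal: "t \<in> U \<Longrightarrow> ideal_in U (tU t)"
proof -
  assume t: "t \<in> U"
  have "t * a + t * b \<in> tU t" "c * (t * a) \<in> tU t" if "a \<in> U" "b \<in> U" "c \<in> U" for a b c
    using UD(3)[OF that(1,2)] UD(4)[OF that(3,1)] unfolding tU_def
    by (auto simp flip: distrib_left simp: mult.left_commute[of c])
  moreover have "0 \<in> tU t" unfolding tU_def using UD(1) by force
  ultimately show ?thesis unfolding ideal_in_def using t UD(4) by (auto simp: tU_def)
qed

lemma tU_P: "t \<in> P \<Longrightarrow> tU t \<subseteq> P"
  unfolding tU_def using UP by (auto simp: mult.commute)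

lemma tU_mult: "a \<in> polys (tU s) \<Longrightarrow> b \<in> polys (tU t) \<Longrightarrow> a * b \<in> polys (tU (s * t))"
proof -
  assume ab: "a \<in> polys (tU s)" "b \<in> polys (tU t)"
  have *: "x * y \<in> tU (s * t)" if "x \<in> tU s" "y \<in> tU t" for x y
    using that UD(4) unfolding tU_def by (auto simp: mult_ac image_iff)
  have add: "x + y \<in> tU r" if "x \<in> tU r" "y \<in> tU r" for x y r
    using that UD(3) unfolding tU_def by (auto simp flip: distrib_left)
  have 0: "0 \<in> tU r" for r unfolding tU_def using UD(1) by force
  have sum: "sum g S \<in> tU r" if "\<And>i. i \<in> S \<Longrightarrow> g i \<in> tU r" for g r and S :: "nat set"
    using that by (induction S rule: infinite_finite_induct) (auto simp: 0 add)
  show ?thesis using ab by (auto simp: polys_def coeff_mult intro!: sum *)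
qed

lemma tU_antimono: "t \<in> U \<Longrightarrow> m \<le> n \<Longrightarrow> tU (t ^ n) \<subseteq> tU (t ^ m)"
proof -
  assume t: "t \<in> U" "m \<le> n"
  then have "t ^ n = t ^ m * t ^ (n - m)" by (simp flip: power_add)
  then show ?thesis unfolding tU_def using subring_power[OF U t(1)] UD(4) by (auto simp: mult.assoc)
qed

lemma P_U: "t \<in> P \<Longrightarrow> t \<in> U"
  using P_V V_U by blast

text \<open>The last coefficient of maximal absolute value with respect to \<open>U\<close> is scaled to \<open>1\<close>.\<close>

lemma U_normalize:
  assumes "f \<noteq> 0"
  obtains c f' i where "c \<noteq> 0" "f = smult c f'" "f' \<in> polys U" "coeff f' i = 1"
    "\<And>j. j > i \<Longrightarrow> coeff f' j \<in> P"
proof -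
  define J where "J = {i. coeff f i \<noteq> 0 \<and> (\<forall>j. coeff f j / coeff f i \<in> U)}"
  obtain m where "coeff f m \<noteq> 0" "\<And>j. coeff f j / coeff f m \<in> V" using poly_content[OF assms] by metis
  then have "m \<in> J" using V_U by (auto simp: J_def)
  have "J \<subseteq> {..degree f}" using coeff_eq_0[of f] by (auto simp: J_def) (meson not_le)
  then have fin: "finite J" by (rule finite_subset) auto
  define i where "i = Max J"
  have i: "i \<in> J" unfolding i_def using fin \<open>m \<in> J\<close> by (intro Max_in) auto
  then have c: "coeff f i \<noteq> 0" "\<And>j. coeff f j / coeff f i \<in> U" by (auto simp: J_def)
  show thesis
  proof (rule that[of "coeff f i" "smult (inverse (coeff f i)) f" i])
    show "coeff (smult (inverse (coeff f i)) f) j \<in> P" if j: "j > i" for j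
    proof (rule ccontr)
      assume n: "coeff (smult (inverse (coeff f i)) f) j \<notin> P"
      then have "coeff f j / coeff f i \<notin> P" by (simp add: field_simps)
      then have ij: "coeff f i / coeff f j \<in> U" by (auto simp: U_def)
      have nz: "coeff f j \<noteq> 0" using n PD by auto
      have "coeff f l / coeff f j \<in> U" for l
        using UD(4)[OF c(2)[of l] ij] c by simp
      then have "j \<in> J" using nz by (auto simp: J_def)
      then have "j \<le> i" unfolding i_def using fin by simp
      then show False using j by simp
    qed
  qed (use c in \<open>auto simp: polys_def field_simps\<close>)
qed

text \<open>Modulo \<open>t\<close> the polynomial \<open>f\<close> is monic of degree \<open>i\<close>; its factorization \<open>f = f \<cdot> 1\<close> is lifted to a
  factorization modulo \<open>t\<^sup>k\<close>.\<close>

lemma hensel: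
  assumes t: "t \<in> P" and f: "f \<in> polys U" and i: "coeff f i = 1"
    and tail: "\<And>j. j > i \<Longrightarrow> coeff f j \<in> tU t" and k: "k \<ge> 1"
  obtains f1 f2 where "f1 \<in> polys U" "lead_coeff f1 = 1" "degree f1 = i" "f2 - 1 \<in> polys (tU t)"
    "degree f2 \<le> degree f - i" "f - f1 * f2 \<in> polys (tU (t ^ k))" "degree (f - f1 * f2) \<le> degree f"
proof -
  have iD: "i \<le> degree f" using i by (intro le_degree) auto
  note tU = P_U[OF t]
  have I: "ideal_in U (tU (t ^ k))" for k by (intro tU_ideal subring_power U tU)
  note Ix = ideal_in_polys[OF I]
  have "\<exists>f1 f2. f1 \<in> polys U \<and> lead_coeff f1 = 1 \<and> degree f1 = i \<and> f2 - 1 \<in> polys (tU t) \<and>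
    degree f2 \<le> degree f - i \<and> f - f1 * f2 \<in> polys (tU (t ^ k)) \<and> degree (f - f1 * f2) \<le> degree f"
    using k
  proof (induction k rule: dec_induct)
    case base
    \<comment> \<open>The terms of degree at most \<open>i\<close>, whence the successor in the
      cutoff. The second factor starts as 1.\<close>
    define f1 where "f1 = poly_cutoff (Suc i) f"
    have "f1 \<in> polys U" using f UD by (auto simp: f1_def polys_def coeff_poly_cutoff)
    moreover have d: "degree f1 = i"
      using i by (intro antisym degree_le le_degree) (auto simp: f1_def coeff_poly_cutoff)
    moreover have "lead_coeff f1 = 1" unfolding d using i by (auto simp: f1_def coeff_poly_cutoff)
    moreover have "f - f1 \<in> polys (tU t)"
      using tail ideal_inD(2)[OF I[of 1]] by (auto simp: f1_def polys_def coeff_poly_cutoff)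
    moreover have "degree (f - f1) \<le> degree f" using d iD by (intro degree_diff_le) auto
    moreover have "(1::'k poly) - 1 \<in> polys (tU t)" using ideal_inD(2)[OF Ix[of 1]] by simp
    ultimately show ?case by (intro exI[of _ f1] exI[of _ 1]) auto
  next
    case (step k)
    then obtain f1 f2 where IH: "f1 \<in> polys U" "lead_coeff f1 = 1" "degree f1 = i" "f2 - 1 \<in> polys (tU t)"
      "degree f2 \<le> degree f - i" "f - f1 * f2 \<in> polys (tU (t ^ k))" "degree (f - f1 * f2) \<le> degree f"
      by auto
    obtain q r where qr: "q \<in> polys (tU (t ^ k))" "r \<in> polys (tU (t ^ k))" "f - f1 * f2 = q * f1 + r"
      "r = 0 \<or> degree r < degree f1" and dq: "degree q \<le> degree (f - f1 * f2) - degree f1"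
      by (rule div_monic[OF U I IH(1,2,6)])
    have dq: "degree q \<le> degree f - i" using dq IH(3,7) by linarith
    have tk: "tU (t ^ k) \<subseteq> tU t" using tU_antimono[OF tU, of 1 k] step.hyps by simp
    define e where "e = f - (f1 + r) * (f2 + q)"
    \<comment> \<open>Correcting by \<open>r\<close> and \<open>q\<close> cancels the old error
      \<open>q * f1 + r\<close>. What is left is a product of the small \<open>r\<close> with
      \<open>f2 - 1\<close> and \<open>q\<close>, which are divisible by \<open>t\<close>, so one
      power of \<open>t\<close> is gained.\<close>
    have e: "e = - (r * ((f2 - 1) + q))" using qr(3) by (simp add: e_def algebra_simps)
    have It: "ideal_in (polys U) (polys (tU t))" using Ix[of 1] by simp
    have qt: "q \<in> polys (tU t)" using qr(1) tk by (auto simp: polys_def)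
    have "r * ((f2 - 1) + q) \<in> polys (tU (t ^ k * t))"
      by (intro tU_mult qr ideal_inD(3)[OF It] IH qt)
    then have eI: "e \<in> polys (tU (t ^ Suc k))"
      unfolding e using ideal_in_uminus[OF is_subring_polys[OF U] Ix[of "Suc k"]] by (simp add: mult.commute)
    have dr: "degree (f1 + r) = i \<and> lead_coeff (f1 + r) = 1"
    proof (cases "r = 0")
      case False
      then have "degree r < degree f1" using qr(4) by auto
      then show ?thesis using IH(2,3) by (simp add: degree_add_eq_left coeff_eq_0)
    qed (use IH in simp)
    have fr: "f1 + r \<in> polys U" using IH(1) qr(2) is_subringD(3)[OF is_subring_polys[OF U]] ideal_inD(1)[OF Ix] by blast
    have f2q: "f2 + q - 1 \<in> polys (tU t)" using ideal_inD(3)[OF It IH(4) qt] by (simp add: algebra_simps)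
    have df: "degree (f2 + q) \<le> degree f - i" using IH(5) dq by (intro degree_add_le) auto
    have "degree ((f1 + r) * (f2 + q)) \<le> degree f"
      using degree_mult_le[of "f1 + r" "f2 + q"] dr df iD by linarith
    then have "degree e \<le> degree f" unfolding e_def by (intro degree_diff_le) auto
    then show ?case using fr dr f2q df eI unfolding e_def by (intro exI[of _ "f1 + r"] exI[of _ "f2 + q"]) auto
  qed
  then show thesis using that by blast
qed

text \<open>The remainder depends linearly on \<open>y\<close>. The remainders of the finitely many
  monomials of degree below \<open>d\<close> times \<open>w\<close> have a common denominator
  \<open>r\<close>, and some power of \<open>t\<close> is divisible by it.\<close>

lemma mod_bound:
  assumes "t \<in> P"
  obtains k where "k \<ge> 1" "\<And>y. degree y < d \<Longrightarrow> y \<in> polys (tU (t ^ k)) \<Longrightarrow> (y * w) mod g \<in> polys P"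
proof -
  let ?q = "\<lambda>j. (monom 1 j * w) mod g"
  obtain r where r: "r \<in> P" "r \<noteq> 0" "\<And>q. q \<in> ?q ` {..<d} \<Longrightarrow> smult r q \<in> polys P"
    by (rule P_scale_polys[of "?q ` {..<d}"]) auto
  obtain N where N: "t ^ N / r \<in> V" using rank_one[OF assms r(2)] by auto
  have "(y * w) mod g \<in> polys P" if y: "degree y < d" "y \<in> polys (tU (t ^ Suc N))" for y
  proof -
    have "y = (\<Sum>j<d. monom (coeff y j) j)"
    proof (rule poly_eqI)
      fix m
      show "coeff y m = coeff (\<Sum>j<d. monom (coeff y j) j) m"
        using y(1) coeff_eq_0[of y m] by (cases "m < d") (auto simp: coeff_sum)
    qed
    then have "y * w = (\<Sum>j<d. monom (coeff y j) j) * w" by simp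
    also have "\<dots> = (\<Sum>j<d. monom (coeff y j) j * w)" by (rule sum_distrib_right)
    also have "\<dots> = (\<Sum>j<d. smult (coeff y j) (monom 1 j * w))"
      by (intro sum.cong) (auto simp: smult_monom simp flip: mult_smult_left)
    finally have "(y * w) mod g = (\<Sum>j<d. smult (coeff y j) (?q j))"
      by (simp add: mod_poly_sum mod_smult_left)
    also have "\<dots> \<in> polys P"
    proof (intro ideal_in_sum[OF Px])
      fix j assume j: "j \<in> {..<d}"
      obtain u where u: "u \<in> U" "coeff y j = t ^ Suc N * u" using y(2) by (auto simp: polys_def tU_def)
      have rq: "smult r (?q j) \<in> polys P" using r(3) j by auto
      have "t ^ Suc N / r * u \<in> U"
        using N u assms P_U V_U UD(4)[of "t * (t ^ N / r)" u] UD(4)[of t "t ^ N / r"] by auto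
      then have "smult (t ^ Suc N / r * u) (smult r (?q j)) \<in> polys P"
        by (intro polys_smult_ideal[OF UPi] rq)
      then show "smult (coeff y j) (?q j) \<in> polys P" using r(2) by (simp add: u(2))
    qed
    finally show ?thesis .
  qed
  \<comment> \<open>The successor ensures \<open>k \<ge> 1\<close>.\<close>
  then show thesis using that[of "Suc N"] by auto
qed

text \<open>Dividing \<open>g - 1\<close> by the monic \<open>f1\<close> over \<open>U\<close> gives
  a quotient over \<open>P\<close> and replaces \<open>g\<close> by some \<open>g'\<close>, again
  congruent to 1, whose degree is below that of \<open>f1\<close>.\<close>

lemma T_reduce_monic:
  assumes g: "g - 1 \<in> polys P" and f1: "f1 \<in> polys U" "lead_coeff f1 = 1" and co: "coprime g f1"
    and IH: "\<And>g'. g' - 1 \<in> polys P \<Longrightarrow> coprime g' f1 \<Longrightarrow> degree g' < degree f1 \<Longrightarrow> T g' f1"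
  shows "T g f1"
proof (cases "degree f1 = 0")
  case True
  then obtain c where "f1 = [:c:]" by (rule degree_eq_zeroE)
  then show ?thesis using f1 T_const[OF g] by auto
next
  case False
  obtain q r where qr: "q \<in> polys P" "r \<in> polys P" "g - 1 = q * f1 + r" "r = 0 \<or> degree r < degree f1"
    by (rule div_monic[OF U UPi f1 g])
  define g' where "g' = 1 + r"
  have gg': "g = g' + q * f1" using qr(3) by (simp add: g'_def algebra_simps)
  have g': "g' - 1 \<in> polys P" using qr by (simp add: g'_def)
  have "degree g' < degree f1"
    unfolding g'_def using False qr(4) by (intro degree_add_less) auto
  moreover have "coprime g' f1" 
    using co gcd_add_mult[of f1 q g'] unfolding gg'
    by (simp add: coprime_iff_gcd_eq_1 gcd.commute add.commute)
  ultimately have T: "T g' f1" using IH g' by blast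
  have fU: "range (coeff f1) \<subseteq> U" using f1 by (auto simp: polys_def)
  \<comment> \<open>The symbol lives over \<open>V\<close>, but \<open>f1\<close> only over
    \<open>U\<close>. A unit \<open>s\<close> of \<open>U\<close> moves \<open>f1\<close> to
    \<open>V\<close>, while the quotient divided by \<open>s\<close> stays over
    \<open>P\<close>.\<close>
  obtain s where s: "s \<in> V" "s \<notin> P" "\<And>x. x \<in> range (coeff f1) \<Longrightarrow> s * x \<in> V"
    using U_scale[OF finite_coeffs fU] by metis
  then have s0: "s \<noteq> 0" and sf: "smult s f1 \<in> polys V" using PD by (auto simp: polys_def)
  have "inverse s \<in> U" using s by (simp add: U_def)
  then have q': "smult (inverse s) q \<in> polys P" using qr(1) UP by (auto simp: polys_def)
  have "tri (polys V) g' (smult s f1)" by (rule T_scale[OF g' T s0 sf])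
  then have "tri (polys V) (g' + smult (inverse s) q * smult s f1) (smult s f1)"
    using q' by (intro tri_add_left Vx) (auto intro: PxD(1))
  also have "g' + smult (inverse s) q * smult s f1 = g" unfolding gg' using s0 by simp
  finally show ?thesis unfolding T_def using s0 sf by blast
qed

text \<open>With \<open>w\<close> inverse to \<open>f'\<close> modulo \<open>g\<close> and
  \<open>f1 * f2\<close> approximating \<open>f'\<close>, the remainder \<open>z\<close> of
  \<open>f1 * f2 * w\<close> is congruent to 1 modulo \<open>P\<close>. By symmetry \<open>z\<close>
  and \<open>f2\<close> may take the place of \<open>g\<close>, having smaller degree, and
  \<open>f1\<close> is treated by \<open>T_reduce_monic\<close>. Cancelling \<open>f1 * f2\<close>
  gives the symbol of \<open>(g, w)\<close>; cancelling \<open>w\<close> from \<open>f' * w\<close>,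
  which is 1 modulo \<open>g\<close>, gives that of \<open>(g, f')\<close>.\<close>

theorem T_coprime:
  assumes "g - 1 \<in> polys P" "coprime g f"
  shows "T g f"
  using assms
proof (induction "degree g" arbitrary: g f rule: less_induct)
  case less
  note g = less.prems(1)
  have g0: "g \<noteq> 0" using g one_P ideal_in_uminus[OF V P, of "-1"] by (auto simp: polys_def dest: spec[of _ 0])
  show ?case
  proof (cases "degree g = 0")
    case True
    then obtain c where c: "g = [:c:]" by (rule degree_eq_zeroE)
    then have "T g (1 + (smult (inverse c) (f - 1)) * g)" using g0 T_const[OF g, of 1] by (intro T_add g) (auto simp: one_pCons)
    then show ?thesis using c g0 by simp
  next
    case False
    define f0 where "f0 = f mod g"
    have co0: "coprime g f0" using less.prems(2) by (simp add: f0_def coprime_mod_right_iff g0)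
    have f00: "f0 \<noteq> 0" using co0 False by (auto simp: is_unit_iff_degree g0)
    have df0: "degree f0 < degree g" unfolding f0_def using degree_mod_less'[of g f] f00 g0 by (simp add: f0_def)
    obtain c f' i where f': "c \<noteq> 0" "f0 = smult c f'" "f' \<in> polys U" "coeff f' i = 1"
      "\<And>j. j > i \<Longrightarrow> coeff f' j \<in> P" using U_normalize[OF f00] by metis
    have iD: "i \<le> degree f'" using f'(4) by (intro le_degree) auto
    have df: "degree f' < degree g" using df0 f' by simp
    have "f0 = [:c:] * f'" using f' by simp
    then have co: "coprime g f'" using co0 by (simp only: coprime_mult_right_iff)
    define tl where "tl = f' - poly_cutoff (Suc i) f'"
    have "tl \<in> polys P" using f'(5) PD(2) by (auto simp: tl_def polys_def coeff_poly_cutoff)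
    \<comment> \<open>The content of the terms beyond \<open>i\<close>: all these coefficients
      become multiples of a single \<open>t \<in> P\<close>, as \<open>hensel\<close>
      requires.\<close>
    then obtain t h' where t: "t \<in> P" "h' \<in> polys V" "tl = smult t h'" by (rule P_content)
    have tail: "coeff f' j \<in> tU t" if "j > i" for j
    proof -
      have "coeff f' j = coeff tl j" using that by (simp add: tl_def coeff_poly_cutoff)
      also have "\<dots> = t * coeff h' j" using t by simp
      finally show ?thesis using t(2) V_U by (auto simp: tU_def polys_def)
    qed
    obtain a w where aw: "a * g + w * f' = 1"
      using bezout_coefficients_fst_snd[of g f'] co by (metis coprime_imp_gcd_eq_1)
    \<comment> \<open>The degree bound is doubled because the choice of \<open>k\<close> must also
      control \<open>e * y\<close> for a further \<open>y\<close> of degree below that of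
      \<open>g\<close>.\<close>
    obtain k where k: "k \<ge> 1" "\<And>y. degree y < 2 * degree g \<Longrightarrow> y \<in> polys (tU (t ^ k)) \<Longrightarrow> (y * w) mod g \<in> polys P"
      using mod_bound[OF t(1), of "2 * degree g" w g] by metis
    obtain f1 f2 where f12: "f1 \<in> polys U" "lead_coeff f1 = 1" "degree f1 = i" "f2 - 1 \<in> polys (tU t)"
      "degree f2 \<le> degree f' - i" "f' - f1 * f2 \<in> polys (tU (t ^ k))" "degree (f' - f1 * f2) \<le> degree f'"
      using hensel[OF t(1) f'(3,4) tail k(1)] by blast
    define e where "e = f' - f1 * f2"
    have Ik: "ideal_in (polys U) (polys (tU (t ^ k)))"
      by (intro ideal_in_polys tU_ideal subring_power U P_U t)
    have eI: "e \<in> polys (tU (t ^ k))" and de: "degree e < degree g" using f12 df by (auto simp: e_def)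
    \<comment> \<open>Up to multiples of \<open>g\<close> this is \<open>(f' - e) * w\<close>, that
      is, 1 minus \<open>e * w\<close>, and \<open>k\<close> was chosen so that the latter has its
      remainder over \<open>P\<close>.\<close>
    define z where "z = (f1 * f2 * w) mod g"
    have fw: "f' * w = 1 + (- a) * g" using aw by (simp add: algebra_simps)
    have "f1 * f2 * w = (1 - e * w) + (- a) * g" using fw by (simp add: e_def algebra_simps)
    then have "z = (1 - e * w) mod g" unfolding z_def by (simp only: mod_mult_self1)
    also have "\<dots> = 1 mod g - (e * w) mod g" by (rule poly_mod_diff_left)
    finally have z: "z = 1 - (e * w) mod g" using False by (simp add: mod_poly_less)
    have ew: "(e * w) mod g \<in> polys P" using k(2) eI de by auto
    have z1: "z - 1 \<in> polys P" using ideal_in_uminus[OF Vx Px ew] by (simp add: z)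
    have z0: "z \<noteq> 0" using z1 one_P ideal_in_uminus[OF V P, of "-1"] by (auto simp: polys_def dest: spec[of _ 0])
    have dz: "degree z < degree g" unfolding z_def using degree_mod_less'[of g "f1 * f2 * w"] z0 g0 by (simp add: z_def)
    \<comment> \<open>Multiplication by \<open>z\<close> on K[x]/(g) is the identity minus
      multiplication by \<open>e * w\<close>, and the latter maps polynomials over \<open>U\<close>
      to polynomials over \<open>P\<close>. A polynomial annihilated by \<open>z\<close>, normalized
      over \<open>U\<close> to have a coefficient 1, would therefore lie over
      \<open>P\<close>.\<close>
    have cz: "coprime z g"
    proof (rule ccontr)
      assume n: "\<not> coprime z g"
      define b where "b = gcd z g"
      have b: "b dvd z" "b dvd g" "\<not> is_unit b" using n by (auto simp: b_def is_unit_gcd_iff)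
      obtain y0 where y0: "g = b * y0" using b(2) by auto
      have y00: "y0 \<noteq> 0" "b \<noteq> 0" using g0 y0 by auto
      have dy0: "degree y0 < degree g" using y0 b(3) y00 by (simp add: degree_mult_eq is_unit_iff_degree)
      have "g dvd z * y0" using b(1) y0 by (simp add: mult_dvd_mono)
      obtain c y i where y: "c \<noteq> 0" "y0 = smult c y" "y \<in> polys U" "coeff y i = 1" by (rule U_normalize[OF y00(1)])
      have gy: "g dvd z * y" using \<open>g dvd z * y0\<close> y by (simp add: dvd_smult_iff)
      have dy: "degree y < degree g" using dy0 y by simp
      have "y = y mod g" using dy by (simp add: mod_poly_less)
      also have "\<dots> = (z * y + (e * y * w) + g * ((e * w) div g * (- y))) mod g"
      proof -
        have "e * w = (e * w) div g * g + (1 - z)" using z div_mult_mod_eq[of "e * w" g] by simp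
        then have "e * w * y = ((e * w) div g * g + (1 - z)) * y" by simp
        then have "y = z * y + (e * y * w) + g * ((e * w) div g * (- y))" by (simp add: algebra_simps)
        then show ?thesis by simp
      qed
      also have "\<dots> = (z * y + (e * y * w)) mod g" by (rule mod_mult_self2)
      also have "\<dots> = (e * y * w) mod g" using gy by (simp add: poly_mod_add_left)
      also have "\<dots> \<in> polys P"
      proof (rule k(2))
        show "degree (e * y) < 2 * degree g" using degree_mult_le[of e y] de dy by linarith
        show "e * y \<in> polys (tU (t ^ k))" using eI y by (intro ideal_inD(5)[OF Ik])
      qed
      finally have "coeff y i \<in> P" by (rule polysD)
      then show False using y one_P by simp
    qed
    have "coprime g (f1 * f2 * w)" using cz g0 unfolding z_def by (simp add: coprime_commute)
    then have cc: "coprime g f1" "coprime g f2" "coprime g w" by auto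
    have "T z g" using less.hyps[OF dz z1 cz] .
    then have "T g z" by (rule T_sym[OF g z1])
    then have T3: "T g (f1 * f2 * w)" unfolding z_def by (rule T_mod[OF g])
    have f2P: "f2 - 1 \<in> polys P" using f12(4) tU_P[OF t(1)] by (rule polys_mono)
    \<comment> \<open>The degree of \<open>f2\<close> is at most that of \<open>f'\<close>, which is
      smaller than that of \<open>g\<close>; so the induction hypothesis applies with
      \<open>f2\<close> as first entry.\<close>
    have "T f2 g" using less.hyps[of f2 g] f12(5) df f2P cc(2) by (auto simp: coprime_commute)
    then have T2: "T g f2" by (rule T_sym[OF g f2P])
    have T1: "T g f1"
      by (rule T_reduce_monic[OF g f12(1,2) cc(1)]) (use less.hyps f12(3) iD df in auto)
    have Tw: "T g w"
      using T_divide[OF g, of w "f1 * f2"] T3 T_mult[OF g T1 T2] by (simp add: mult.commute)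
    have "T g (f' * w)" unfolding fw using T_const[OF g, of 1] by (intro T_add g) (simp add: one_pCons)
    then have "T g f'" using T_divide[OF g] Tw by blast
    then have "T g ([:c:] * f')" using T_const[OF g f'(1)] by (intro T_mult g)
    then have "T g f0" using f' by simp
    then show ?thesis unfolding f0_def by (rule T_mod[OF g])
  qed
qed

end

section \<open>Row reduction\<close>

lemma coprime_if_no_common_prime:
  fixes g a :: "'a::factorial_ring_gcd"
  assumes "g \<noteq> 0" "\<And>q. prime_elem q \<Longrightarrow> q dvd g \<Longrightarrow> q dvd a \<Longrightarrow> False"
  shows "coprime g a"
proof (rule ccontr)
  assume "\<not> coprime g a"
  then have "\<not> is_unit (gcd g a)" "gcd g a \<noteq> 0" using assms(1) by (auto simp: is_unit_gcd_iff)
  then obtain q where "q dvd gcd g a" "prime q" using prime_divisor_exists by blast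
  then show False using assms(2)[of q] by auto
qed

text \<open>The multiplier is a constant times the product of the prime factors of \<open>g\<close>
  that do not divide \<open>a\<close>. Such a prime divides \<open>l * b\<close> and hence not the
  sum; a prime dividing \<open>a\<close> does not divide \<open>l\<close>, so dividing the sum
  forces it to divide \<open>b\<close>.\<close>

lemma avoid_primes:
  fixes g a b :: "'k::field_gcd poly"
  assumes g: "g \<noteq> 0" and s: "\<And>q. \<exists>r. r \<noteq> 0 \<and> smult r q \<in> S"
  obtains l where "l \<in> S" "\<And>q. prime_elem q \<Longrightarrow> q dvd g \<Longrightarrow> q dvd a + l * b \<Longrightarrow> q dvd a \<and> q dvd b"
proof -
  define F where "F = {q \<in> prime_factors g. \<not> q dvd a}"
  have F: "finite F" by (simp add: F_def)
  obtain r where r: "r \<noteq> 0" "smult r (\<Prod>F) \<in> S" using s by blast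
  show thesis
  proof (rule that[OF r(2)])
    fix q assume q: "prime_elem q" "q dvd g" "q dvd a + smult r (\<Prod>F) * b"
    have qa: "q dvd a"
    proof (rule ccontr)
      assume n: "\<not> q dvd a"
      then have "normalize q \<in> F" using q g by (auto simp: F_def in_prime_factors_iff)
      then have "normalize q dvd \<Prod>F" using F dvd_prodI[of F "normalize q" "\<lambda>x. x"] by simp
      then have "q dvd smult r (\<Prod>F) * b" using r by (simp add: dvd_smult)
      then have "q dvd a" using q(3) by (simp add: dvd_add_left_iff)
      then show False using n by simp
    qed
    have "\<not> q dvd \<Prod>F"
    proof
      assume "q dvd \<Prod>F"
      then have "normalize q dvd \<Prod>F" by simp
      moreover have nq: "prime (normalize q)" using q(1) by (simp add: prime_normalize_iff)
      ultimately obtain p where p: "p \<in> F" "normalize q dvd p" using prime_dvd_prod_iff[OF F nq, of "\<lambda>x. x"] by auto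
      then have "p = normalize q" using primes_dvd_imp_eq[OF nq] by (auto simp: F_def)
      then show False using p qa by (auto simp: F_def)
    qed
    moreover have "q dvd smult r (\<Prod>F) * b" using q(3) qa by (simp add: dvd_add_right_iff)
    then have "q dvd \<Prod>F * b" using r by (simp add: dvd_smult_iff)
    ultimately have "q dvd b" using q(1) by (simp add: prime_elem_dvd_mult_iff)
    then show "q dvd a \<and> q dvd b" using qa by simp
  qed
qed

lemma avoid_primes_sum:
  fixes g a :: "'k::field_gcd poly"
  assumes g: "g \<noteq> 0" and s: "\<And>q. \<exists>r. r \<noteq> 0 \<and> smult r q \<in> S" and F: "finite F"
  shows "\<exists>l. (\<forall>i\<in>F. l i \<in> S) \<and> (\<forall>q. prime_elem q \<longrightarrow> q dvd g \<longrightarrow> q dvd a + (\<Sum>i\<in>F. b i * l i) \<longrightarrow>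
    q dvd a \<and> (\<forall>i\<in>F. q dvd b i))"
  using F
proof (induction F rule: finite_induct)
    case (insert x F)
    then obtain l where l: "\<forall>i\<in>F. l i \<in> S" "\<forall>q. prime_elem q \<longrightarrow> q dvd g \<longrightarrow> q dvd a + (\<Sum>i\<in>F. b i * l i) \<longrightarrow>
      q dvd a \<and> (\<forall>i\<in>F. q dvd b i)" by blast
    obtain y where y: "y \<in> S" "\<And>q. prime_elem q \<Longrightarrow> q dvd g \<Longrightarrow> q dvd (a + (\<Sum>i\<in>F. b i * l i)) + y * b x \<Longrightarrow>
      q dvd a + (\<Sum>i\<in>F. b i * l i) \<and> q dvd b x"
      using avoid_primes[OF g s, of "a + (\<Sum>i\<in>F. b i * l i)" "b x"] by blast
    define l' where "l' = l(x := y)"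
    have "(\<Sum>i\<in>insert x F. b i * l' i) = y * b x + (\<Sum>i\<in>F. b i * l i)"
      using insert by (auto simp: l'_def mult.commute intro!: sum.cong)
    then have e: "a + (\<Sum>i\<in>insert x F. b i * l' i) = (a + (\<Sum>i\<in>F. b i * l i)) + y * b x" by (simp add: algebra_simps)
    show ?case
    proof (intro exI[of _ l'] conjI allI impI)
      show "\<forall>i\<in>insert x F. l' i \<in> S" using l y by (auto simp: l'_def)
      fix q assume q: "prime_elem q" "q dvd g" "q dvd a + (\<Sum>i\<in>insert x F. b i * l' i)"
      then have "q dvd a + (\<Sum>i\<in>F. b i * l i) \<and> q dvd b x" unfolding e using y(2) by blast
      then show "q dvd a" "\<forall>i\<in>insert x F. q dvd b i" using l(2) q by blast+
    qed
qed auto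

lemma emb_m3_cycle:
  fixes a :: "'a::comm_ring_1"
  shows "emb 3 3 (\<lambda>i. if i = 2 then 0 else Suc i) (m3 a b c d e f g h k) = m3 k g h c a b f d e"
proof -
  let ?s = "\<lambda>i::nat. if i = 2 then 0 else Suc i"
  have i: "inj_on ?s {..<3::nat}" "?s ` {..<3::nat} \<subseteq> {..<3}"
    by (auto simp: inj_on_def)
  note E = emb_entry[OF i, of _ _ "m3 a b c d e f g h k"]
  show ?thesis
    using E[of 0 0] E[of 0 1] E[of 0 2] E[of 1 0] E[of 1 1] E[of 1 2] E[of 2 0] E[of 2 1] E[of 2 2]
    by (intro m3_eqI) (simp_all flip: One_nat_def add: numeral_2_eq_2[symmetric])
qed

lemma cong_mat_mult_one:
  assumes D: "is_subring D" and I: "ideal_in D I" and "A \<in> mats n D" "B \<in> mats n D"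
    "cong_mat n I A (1\<^sub>m n)" "cong_mat n I B (1\<^sub>m n)"
  shows "cong_mat n I (A * B) (1\<^sub>m n)"
  using cong_mat_mult[OF D I assms(3,4) mats_one[OF D] mats_one[OF D] assms(5,6)] by simp

lemma cong_row_mat:
  "ideal_in D I \<Longrightarrow> (\<And>j. j < n \<Longrightarrow> w j \<in> I) \<Longrightarrow> cong_mat n I (row_mat n k w) (1\<^sub>m n)"
  by (auto simp: cong_mat_def row_mat_def ideal_inD)

lemma cong_col_mat:
  "ideal_in D I \<Longrightarrow> (\<And>j. j < n \<Longrightarrow> w j \<in> I) \<Longrightarrow> cong_mat n I (col_mat n k w) (1\<^sub>m n)"
  by (auto simp: cong_mat_def col_mat_def ideal_inD)

lemma det_first_row:
  assumes "A \<in> carrier_mat n n" "0 < n"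
  shows "det A = (\<Sum>j<n. A $$ (0,j) * cofactor A 0 j)"
  using laplace_expansion_row[OF assms] .

lemma det_two:
  assumes A: "A \<in> carrier_mat 2 2"
  shows "det A = A $$ (0,0) * A $$ (1,1) - A $$ (0,1) * A $$ (1,0)"
proof -
  have "mat_delete A 0 j \<in> carrier_mat 1 1" for j using A by (auto simp: mat_delete_def)
  then have "det (mat_delete A 0 j) = mat_delete A 0 j $$ (0,0)" for j by (rule det_single)
  moreover have "mat_delete A 0 0 $$ (0,0) = A $$ (1,1)" "mat_delete A 0 1 $$ (0,0) = A $$ (1,0)"
    using A by (auto simp: mat_delete_def)
  ultimately show ?thesis using det_first_row[OF A] by (simp add: numeral_2_eq_2 cofactor_def)
qed

text \<open>Abstracts the input of the reduction to serve two cases: a valuation ring with its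
  smallest nonzero prime, and a field, where \<open>V\<close> and \<open>P\<close> are both
  everything and the congruences say nothing.\<close>

locale row_reduction =
  fixes V P :: "'k::field_gcd set"
  assumes V: "is_subring V" and P: "ideal_in V P"
    and scale: "\<And>q. \<exists>r. r \<noteq> 0 \<and> smult r q \<in> polys P"
    and mennicke: "\<And>g f. g - 1 \<in> polys P \<Longrightarrow> f \<in> polys P \<Longrightarrow> coprime g f \<Longrightarrow>
      \<exists>u w. u - 1 \<in> polys P \<and> w \<in> polys P \<and> g * u + f * w = 1 \<and> tri (polys V) g f"
begin

lemmas Vx = is_subring_polys[OF V]
lemmas VxD = is_subringD[OF Vx]
lemmas Px = ideal_in_polys[OF P]
lemmas PxD = ideal_inD[OF Px]

lemma nonzero_pivot:
  assumes n: "n \<ge> 2" and A: "A \<in> mats n (polys V)" "det A = 1" "cong_mat n (polys P) A (1\<^sub>m n)"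
  obtains B where "B \<in> mats n (polys V)" "det B = 1" "cong_mat n (polys P) B (1\<^sub>m n)"
    "B $$ (0,0) \<noteq> 0" "B \<in> Eg n (polys V) \<longleftrightarrow> A \<in> Eg n (polys V)"
proof (cases "A $$ (0,0) = 0")
  case True
  have Ac: "A \<in> carrier_mat n n" using A by (simp add: matsD)
  \<comment> \<open>A vanishing corner is possible only if \<open>P\<close> is the unit ideal. Then
    the congruence is no restriction, and a nonzero entry of the first row may be added to the
    corner.\<close>
  have "-1 \<in> polys P" using cong_mat_oneD[OF A(3), of 0 0] True n by simp
  then have PV: "x \<in> polys P" if "x \<in> polys V" for x
    using PxD(4)[of "- x" "-1"] that VxD by auto
  obtain j where j: "j < n" "A $$ (0,j) \<noteq> 0"
  proof (rule ccontr)
    assume "\<not> thesis"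
    then have "\<forall>j<n. A $$ (0,j) = 0" using that by blast
    then have "det A = 0" using det_first_row[OF Ac] n by simp
    then show False using A by simp
  qed
  define B where "B = A * row_mat n j (\<lambda>i. if i = 0 then 1 else 0)"
  have E: "row_mat n j (\<lambda>i. if i = 0 then 1 else 0) \<in> Eg n (polys V)"
    using j VxD by (intro row_mat_Eg Vx) auto
  have BV: "B \<in> mats n (polys V)" unfolding B_def using A Eg_mats[OF Vx E] by (intro mats_mult Vx)
  show ?thesis
  proof (rule that[of B])
    show "det B = 1" unfolding B_def using Ac E A by (simp add: det_mult[of _ n] Eg_det)
    show "cong_mat n (polys P) B (1\<^sub>m n)" unfolding cong_mat_def
      using BV mats_one[OF Vx, of n] by (auto intro!: PV VxD(6) simp: matsD simp del: index_one_mat)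
    have "B $$ (0,0) = A $$ (0,0) + (if 0 \<noteq> j then A $$ (0,j) * (if (0::nat) = 0 then 1 else 0) else 0)"
      unfolding B_def using Ac j n by (subst mult_row_mat) auto
    then show "B $$ (0,0) \<noteq> 0" using True j by (auto split: if_splits)
    show "B \<in> Eg n (polys V) \<longleftrightarrow> A \<in> Eg n (polys V)" unfolding B_def by (rule Eg_right_iff[OF Vx E Ac])
  qed (rule BV)
qed (use A that in blast)

text \<open>Expanding the determinant along the first row shows that its entries have no common
  prime factor. Adding multiples over \<open>P\<close> of the columns from 2 on to column 1 removes
  the common primes of the first two entries and preserves the congruence.\<close>

lemma coprime_pivot:
  assumes n: "n \<ge> 2" and A: "A \<in> mats n (polys V)" "det A = 1" "cong_mat n (polys P) A (1\<^sub>m n)"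
    and A0: "A $$ (0,0) \<noteq> 0"
  obtains B where "B \<in> mats n (polys V)" "det B = 1" "cong_mat n (polys P) B (1\<^sub>m n)"
    "coprime (B $$ (0,0)) (B $$ (0,1))" "B \<in> Eg n (polys V) \<longleftrightarrow> A \<in> Eg n (polys V)"
proof -
  have Ac: "A \<in> carrier_mat n n" using A by (simp add: matsD)
  obtain l where l: "\<forall>i\<in>{2..<n}. l i \<in> polys P"
    "\<forall>q. prime_elem q \<longrightarrow> q dvd A $$ (0,0) \<longrightarrow> q dvd A $$ (0,1) + (\<Sum>i\<in>{2..<n}. A $$ (0,i) * l i) \<longrightarrow>
      q dvd A $$ (0,1) \<and> (\<forall>i\<in>{2..<n}. q dvd A $$ (0,i))"
    using avoid_primes_sum[OF A0 scale, of "{2..<n}" "A $$ (0,1)" "\<lambda>i. A $$ (0,i)"] by blast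
  define v where "v i = (if i \<in> {2..<n} then l i else 0)" for i
  have vP: "v i \<in> polys P" for i using l(1) PxD(2) by (auto simp: v_def)
  have E: "col_mat n 1 v \<in> Eg n (polys V)" using n by (intro col_mat_Eg Vx PxD(1) vP) auto
  define B where "B = A * col_mat n 1 v"
  have Be: "B $$ (i,j) = A $$ (i,j) + (if j = 1 then (\<Sum>k\<in>{..<n}-{1}. A $$ (i,k) * v k) else 0)" if "i < n" "j < n" for i j
    unfolding B_def using that n Ac by (intro mult_col_mat) auto
  have "(\<Sum>k\<in>{..<n}-{1}. A $$ (0,k) * v k) = (\<Sum>k\<in>{2..<n}. A $$ (0,k) * l k)"
    by (rule sum.mono_neutral_cong_right) (auto simp: v_def)
  then have B01: "B $$ (0,1) = A $$ (0,1) + (\<Sum>k\<in>{2..<n}. A $$ (0,k) * l k)" and B00: "B $$ (0,0) = A $$ (0,0)"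
    using Be[of 0 1] Be[of 0 0] n by simp_all
  have co: "coprime (B $$ (0,0)) (B $$ (0,1))"
  proof (rule coprime_if_no_common_prime)
    fix q assume q: "prime_elem q" "q dvd B $$ (0,0)" "q dvd B $$ (0,1)"
    then have "q dvd A $$ (0,1) \<and> (\<forall>i\<in>{2..<n}. q dvd A $$ (0,i))"
      using l(2) unfolding B00 B01 by blast
    then have "q dvd A $$ (0,j)" if "j < n" for j
      using that q(2) B00 by (cases "j = 0"; cases "j = 1") auto
    then have "q dvd (\<Sum>j<n. A $$ (0,j) * cofactor A 0 j)" by (intro dvd_sum dvd_mult2) auto
    then have "q dvd det A" using det_first_row[OF Ac] n by simp
    then show False using A(2) q(1) by auto
  qed (use A0 B00 in simp)
  show ?thesis
  proof (rule that[of B])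
    show "B \<in> mats n (polys V)" unfolding B_def using A Eg_mats[OF Vx E] by (intro mats_mult Vx)
    show "det B = 1" unfolding B_def using Ac E A by (simp add: det_mult[of _ n] Eg_det)
    show "cong_mat n (polys P) B (1\<^sub>m n)" unfolding B_def
      using A Eg_mats[OF Vx E] vP by (intro cong_mat_mult_one[OF Vx Px] cong_col_mat[OF Px])
    show "B \<in> Eg n (polys V) \<longleftrightarrow> A \<in> Eg n (polys V)" unfolding B_def by (rule Eg_right_iff[OF Vx E Ac])
  qed (rule co)
qed

text \<open>From \<open>g * u + a * w = 1\<close> the other entries of the first row are cleared,
  and triviality of the symbol provides an elementary block that sends the row \<open>(g, a)\<close>
  to (1, 0). As \<open>u\<close> is congruent to 1 and \<open>w\<close> to 0, all operations respect
  the congruence.\<close>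

lemma unit_pivot:
  assumes n: "n \<ge> 3" and A: "A \<in> mats n (polys V)" "det A = 1" "cong_mat n (polys P) A (1\<^sub>m n)"
    and co: "coprime (A $$ (0,0)) (A $$ (0,1))"
  obtains B where "B \<in> mats n (polys V)" "det B = 1" "cong_mat n (polys P) B (1\<^sub>m n)"
    "B $$ (0,0) = 1" "B \<in> Eg n (polys V) \<longleftrightarrow> A \<in> Eg n (polys V)"
proof -
  have Ac: "A \<in> carrier_mat n n" using A by (simp add: matsD)
  define g where "g = A $$ (0,0)"
  define a where "a = A $$ (0,1)"
  have A1: "A $$ (i,j) - (if i = j then 1 else 0) \<in> polys P" if "i < n" "j < n" for i j
    using cong_mat_oneD[OF A(3) that] .
  have gP: "g - 1 \<in> polys P" and aP: "a \<in> polys P" using A1[of 0 0] A1[of 0 1] n by (auto simp: g_def a_def)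
  obtain u w where uw: "u - 1 \<in> polys P" "w \<in> polys P" "g * u + a * w = 1" "tri (polys V) g a"
    using mennicke[OF gP aP] co by (auto simp: g_def a_def)
  have uV: "u \<in> polys V" using VxD(3)[of "u - 1" 1] PxD(1)[OF uw(1)] VxD by auto
  have wV: "w \<in> polys V" using PxD(1)[OF uw(2)] .
  have aV: "a \<in> polys V" using A n by (auto simp: a_def matsD)
  \<comment> \<open>Column 0 contributes \<open>- A $$ (0,j) * (g * u)\<close> and column 1
    contributes \<open>- A $$ (0,j) * (a * w)\<close> to entry \<open>j\<close> of the first row;
    together they cancel it.\<close>
  define x where "x c j = (if 2 \<le> j \<and> j < n then - A $$ (0,j) * c else 0)" for c j
  have xP: "x c j \<in> polys P" if "c \<in> polys V" for c j
    using A1[of 0 j] that n ideal_in_uminus[OF Vx Px] PxD(2,5) by (auto simp: x_def)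
  have E0: "row_mat n 0 (x u) \<in> Eg n (polys V)" and E1: "row_mat n 1 (x w) \<in> Eg n (polys V)"
    using n xP[OF uV] xP[OF wV] by (auto intro!: row_mat_Eg Vx intro: PxD(1))
  define C where "C = A * row_mat n 0 (x u)"
  define C' where "C' = C * row_mat n 1 (x w)"
  have Ce: "C $$ (0,j) = A $$ (0,j) + (if j \<noteq> 0 then A $$ (0,0) * x u j else 0)" if "j < n" for j
    unfolding C_def using that n Ac by (intro mult_row_mat) auto
  have Cc: "C \<in> carrier_mat n n" using Ac by (auto simp: C_def)
  have Ce': "C' $$ (0,j) = C $$ (0,j) + (if j \<noteq> 1 then C $$ (0,1) * x w j else 0)" if "j < n" for j
    unfolding C'_def using that n Cc by (intro mult_row_mat) auto
  have C0: "C' $$ (0,0) = g" "C' $$ (0,1) = a"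
    using n by (simp_all add: Ce Ce' x_def g_def a_def)
  have C2: "C' $$ (0,j) = 0" if "2 \<le> j" "j < n" for j
  proof -
    have "C' $$ (0,j) = A $$ (0,j) * (1 - (g * u + a * w))"
      using that n by (simp add: Ce Ce' x_def g_def a_def algebra_simps)
    then show ?thesis using uw(3) by simp
  qed
  have "M2 g a (- w) u \<in> Eg 3 (polys V)"
    using uw uV wV VxD by (intro tri_witness[OF Vx]) auto
  \<comment> \<open>The inverse block has first column \<open>(u, w)\<close> and second column
    \<open>(- a, g)\<close>, so it maps the row \<open>(g, a)\<close> to (1, 0).\<close>
  moreover have "M2 g a (- w) u * M2 u (- a) w g = 1\<^sub>m 3"
  proof -
    have "M2 g a (- w) u * M2 u (- a) w g = M2 1 0 0 1"
      unfolding m3_mult using uw(3) by (simp add: mult.commute add.commute)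
    also have "\<dots> = 1\<^sub>m 3" by (rule m3_eqI[symmetric]) auto
    finally show ?thesis .
  qed
  ultimately have N3: "M2 u (- a) w g \<in> Eg 3 (polys V)"
    using Eg_cancel_left[OF Vx _ m3_carrier] Eg.one by metis
  have inj: "inj_on id {..<3::nat}" "id ` {..<3::nat} \<subseteq> {..<n}" using n by auto
  define N where "N = emb 3 n id (M2 u (- a) w g)"
  have N: "N \<in> Eg n (polys V)" unfolding N_def by (rule emb_Eg[OF inj N3])
  have Ne: "N $$ (i,j) = M2 u (- a) w g $$ (i,j)" if "i < 3" "j < 3" for i j
    unfolding N_def using emb_entry[OF inj that] by simp
  define B where "B = C' * N"
  have C'c: "C' \<in> carrier_mat n n" using Cc by (auto simp: C'_def)
  have CV: "C' \<in> mats n (polys V)" unfolding C'_def C_def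
    using A Eg_mats[OF Vx E0] Eg_mats[OF Vx E1] by (intro mats_mult Vx)
  have Nc: "cong_mat n (polys P) N (1\<^sub>m n)" unfolding cong_mat_def
  proof (intro allI impI)
    fix i j assume ij: "i < n" "j < n"
    show "N $$ (i,j) - (1\<^sub>m n) $$ (i,j) \<in> polys P"
    proof (cases "i < 3 \<and> j < 3")
      case True
      then have "(i = 0 \<or> i = 1 \<or> i = 2) \<and> (j = 0 \<or> j = 1 \<or> j = 2)" by (simp add: less3)
      then show ?thesis using ij True uw gP aP PxD(2) ideal_in_uminus[OF Vx Px aP]
        by (elim conjE disjE; simp add: Ne del: One_nat_def)
    next
      case False
      then have "N $$ (i,j) = (if i = j then 1 else 0)" unfolding N_def using ij by (intro emb_out) auto
      then show ?thesis using ij PxD(2) by simp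
    qed
  qed
  show ?thesis
  proof (rule that[of B])
    show "B \<in> mats n (polys V)" unfolding B_def using CV Eg_mats[OF Vx N] by (intro mats_mult Vx)
    have "det C = 1" unfolding C_def using A E0 by (simp add: det_mult[OF Ac Eg_carrier[OF E0]] Eg_det)
    then have "det C' = 1" unfolding C'_def using E1 det_mult[OF Cc Eg_carrier[OF E1]] by (simp add: Eg_det)
    then show "det B = 1" unfolding B_def using N by (simp add: det_mult[OF C'c Eg_carrier[OF N]] Eg_det)
    show "cong_mat n (polys P) B (1\<^sub>m n)" unfolding B_def C'_def C_def
      using A Eg_mats[OF Vx E0] Eg_mats[OF Vx E1] Eg_mats[OF Vx N] Nc xP[OF uV] xP[OF wV]
      by (intro cong_mat_mult_one[OF Vx Px] mats_mult cong_row_mat[OF Px] Vx)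
    have "B $$ (0,0) = (\<Sum>k<n. C' $$ (0,k) * N $$ (k,0))"
      unfolding B_def using C'c Eg_carrier[OF N] n by (intro mult_mat_entry) auto
    also have "\<dots> = (\<Sum>k\<in>{0,1}. C' $$ (0,k) * N $$ (k,0))"
    proof (rule sum.mono_neutral_right)
      show "\<forall>k\<in>{..<n} - {0,1}. C' $$ (0,k) * N $$ (k,0) = 0"
      proof
        fix k assume "k \<in> {..<n} - {0,1}"
        then have "2 \<le> k" "k < n" by auto
        then show "C' $$ (0,k) * N $$ (k,0) = 0" using C2 by simp
      qed
    qed (use n in auto)
    also have "\<dots> = g * u + a * w" using C0 by (simp add: Ne del: One_nat_def)
    finally show "B $$ (0,0) = 1" using uw(3) by simp
    have "C' \<in> Eg n (polys V) \<longleftrightarrow> A \<in> Eg n (polys V)"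
      unfolding C'_def C_def using Eg_right_iff[OF Vx E1 Cc] Eg_right_iff[OF Vx E0 Ac] by (simp add: C_def)
    then show "B \<in> Eg n (polys V) \<longleftrightarrow> A \<in> Eg n (polys V)"
      unfolding B_def using Eg_right_iff[OF Vx N C'c] by simp
  qed
qed

text \<open>A trivial symbol makes the block elementary only in size 3, with an extra diagonal 1; a
  cyclic permutation of the coordinates moves this 1 in front.\<close>

lemma two_by_two:
  assumes A: "A \<in> mats 2 (polys V)" "det A = 1" "cong_mat 2 (polys P) A (1\<^sub>m 2)"
  shows "emb 2 3 Suc A \<in> Eg 3 (polys V)"
proof -
  let ?a = "A $$ (0,0)" and ?b = "A $$ (0,1)" and ?c = "A $$ (1,0)" and ?d = "A $$ (1,1)"
  have A1: "A $$ (i,j) - (if i = j then 1 else 0) \<in> polys P" if "i < 2" "j < 2" for i j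
    using cong_mat_oneD[OF A(3) that] .
  have det: "?a * ?d - ?b * ?c = 1" using A det_two[of A] by (simp add: matsD)
  have "coprime ?a ?b"
  proof (rule coprimeI)
    fix q assume "q dvd ?a" "q dvd ?b"
    then have "q dvd ?a * ?d - ?b * ?c" by (intro dvd_diff dvd_mult2)
    then show "is_unit q" using det by simp
  qed
  then have "tri (polys V) ?a ?b" using mennicke[of ?a ?b] A1[of 0 0] A1[of 0 1] by auto
  then have M: "M2 ?a ?b ?c ?d \<in> Eg 3 (polys V)"
    using det A by (intro tri_witness[OF Vx]) (auto simp: matsD)
  let ?s = "\<lambda>i::nat. if i = 2 then 0 else Suc i"
  have i: "inj_on ?s {..<3::nat}" "?s ` {..<3::nat} \<subseteq> {..<3}"
    by (auto simp: inj_on_def)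
  have "m3 1 0 0 0 ?a ?b 0 ?c ?d \<in> Eg 3 (polys V)"
    using emb_Eg[OF i M] by (simp only: emb_m3_cycle)
  also have "m3 1 0 0 0 ?a ?b 0 ?c ?d = emb 2 3 Suc A"
  proof (rule m3_eqI[symmetric])
    have j: "inj_on Suc {..<2::nat}" "Suc ` {..<2::nat} \<subseteq> {..<3}" by auto
    note E = emb_entry[OF j, of _ _ A]
    show "emb 2 3 Suc A $$ (1,1) = ?a" "emb 2 3 Suc A $$ (1,2) = ?b"
      "emb 2 3 Suc A $$ (2,1) = ?c" "emb 2 3 Suc A $$ (2,2) = ?d"
      using E[of 0 0] E[of 0 1] E[of 1 0] E[of 1 1] by (simp_all add: numeral_2_eq_2)
  qed (auto simp: emb_out)
  finally show ?thesis .
qed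

text \<open>Each step produces a corner 1 and passes to the complementary block. In size 3 this
  block has size 2, where \<open>two_by_two\<close> takes the place of the induction
  hypothesis.\<close>

theorem Eg_if_cong_one:
  assumes "n \<ge> 3" "A \<in> mats n (polys V)" "det A = 1" "cong_mat n (polys P) A (1\<^sub>m n)"
  shows "A \<in> Eg n (polys V)"
  using assms
proof (induction n arbitrary: A rule: dec_induct)
  case base
  obtain B1 where B1: "B1 \<in> mats 3 (polys V)" "det B1 = 1" "cong_mat 3 (polys P) B1 (1\<^sub>m 3)"
    "B1 $$ (0,0) \<noteq> 0" "B1 \<in> Eg 3 (polys V) \<longleftrightarrow> A \<in> Eg 3 (polys V)" by (rule nonzero_pivot[OF _ base]) auto
  obtain B2 where B2: "B2 \<in> mats 3 (polys V)" "det B2 = 1" "cong_mat 3 (polys P) B2 (1\<^sub>m 3)"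
    "coprime (B2 $$ (0,0)) (B2 $$ (0,1))" "B2 \<in> Eg 3 (polys V) \<longleftrightarrow> B1 \<in> Eg 3 (polys V)"
    by (rule coprime_pivot[OF _ B1(1-4)]) auto
  obtain B3 where B3: "B3 \<in> mats (Suc 2) (polys V)" "det B3 = 1" "cong_mat (Suc 2) (polys P) B3 (1\<^sub>m (Suc 2))"
    "B3 $$ (0,0) = 1" "B3 \<in> Eg 3 (polys V) \<longleftrightarrow> B2 \<in> Eg 3 (polys V)"
    by (rule unit_pivot[OF _ B2(1-4)]) (auto simp: numeral_3_eq_3 numeral_2_eq_2)
  obtain C where C: "C \<in> mats 2 (polys V)" "det C = 1" "cong_mat 2 (polys P) C (1\<^sub>m 2)"
    "emb 2 (Suc 2) Suc C \<in> Eg (Suc 2) (polys V) \<longleftrightarrow> B3 \<in> Eg (Suc 2) (polys V)"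
    by (rule pivot[OF Vx B3(1,4,2) Px B3(3)])
  have "emb 2 (Suc 2) Suc C \<in> Eg (Suc 2) (polys V)" using two_by_two[OF C(1-3)] by (simp add: numeral_3_eq_3 numeral_2_eq_2)
  then show ?case using C(4) B3(5) B2(5) B1(5) by (simp add: numeral_3_eq_3 numeral_2_eq_2)
next
  case (step n)
  obtain B1 where B1: "B1 \<in> mats (Suc n) (polys V)" "det B1 = 1" "cong_mat (Suc n) (polys P) B1 (1\<^sub>m (Suc n))"
    "B1 $$ (0,0) \<noteq> 0" "B1 \<in> Eg (Suc n) (polys V) \<longleftrightarrow> A \<in> Eg (Suc n) (polys V)"
    by (rule nonzero_pivot[OF _ step.prems]) (use step in auto)
  obtain B2 where B2: "B2 \<in> mats (Suc n) (polys V)" "det B2 = 1" "cong_mat (Suc n) (polys P) B2 (1\<^sub>m (Suc n))"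
    "coprime (B2 $$ (0,0)) (B2 $$ (0,1))" "B2 \<in> Eg (Suc n) (polys V) \<longleftrightarrow> B1 \<in> Eg (Suc n) (polys V)"
    by (rule coprime_pivot[OF _ B1(1-4)]) (use step in auto)
  obtain B3 where B3: "B3 \<in> mats (Suc n) (polys V)" "det B3 = 1" "cong_mat (Suc n) (polys P) B3 (1\<^sub>m (Suc n))"
    "B3 $$ (0,0) = 1" "B3 \<in> Eg (Suc n) (polys V) \<longleftrightarrow> B2 \<in> Eg (Suc n) (polys V)"
    by (rule unit_pivot[OF _ B2(1-4)]) (use step in auto)
  obtain C where C: "C \<in> mats n (polys V)" "det C = 1" "cong_mat n (polys P) C (1\<^sub>m n)"
    "emb n (Suc n) Suc C \<in> Eg (Suc n) (polys V) \<longleftrightarrow> B3 \<in> Eg (Suc n) (polys V)"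
    by (rule pivot[OF Vx B3(1,4,2) Px B3(3)])
  have "C \<in> Eg n (polys V)" using step.IH C by blast
  then have "emb n (Suc n) Suc C \<in> Eg (Suc n) (polys V)" by (intro emb_Eg) auto
  then show ?case using C(4) B3(5) B2(5) B1(5) by simp
qed

end

theorem (in valuation_prime) Eg_if_cong_one:
  assumes "n \<ge> 3" "A \<in> mats n (polys V)" "det A = 1" "cong_mat n (polys P) A (1\<^sub>m n)"
  shows "A \<in> Eg n (polys V)"
proof -
  interpret row_reduction V P
  proof
    show "\<exists>r. r \<noteq> 0 \<and> smult r q \<in> polys P" for q
      using P_scale_polys[of "{q}"] by (metis finite.emptyI finite.insertI singletonI)
    fix g f assume gf: "g - 1 \<in> polys P" "f \<in> polys P" "coprime g f"
    obtain u w where "u - 1 \<in> polys P" "w \<in> polys P" "g * u + f * w = 1"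
      using unimodular[OF gf] by metis
    moreover have "tri (polys V) g f"
      using T_scale[OF gf(1) T_coprime[OF gf(1,3)], of 1] PxD(1)[OF gf(2)] by simp
    ultimately show "\<exists>u w. u - 1 \<in> polys P \<and> w \<in> polys P \<and> g * u + f * w = 1 \<and> tri (polys V) g f" by blast
  qed (rule V P)+
  show ?thesis using assms by (rule Eg_if_cong_one)
qed

text \<open>Euclid's algorithm: subtracting multiples and exchanging the entries preserve triviality
  and end at a unit and 0.\<close>

lemma tri_field:
  fixes g f :: "'k::field_gcd poly"
  shows "coprime g f \<Longrightarrow> tri UNIV g f"
proof (induction g f rule: eucl_induct)
  case (zero g)
  then have "is_unit g" by simp
  then obtain h where h: "1 = g * h" by (elim dvdE)
  have "tri UNIV g 1" by (rule tri_sym[OF is_subring_UNIV tri_one_left[OF is_subring_UNIV]]) simp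
  then have "tri UNIV g (1 + (- h) * g)" by (intro tri_add_right) auto
  then show ?case using h by (simp add: mult.commute)
next
  case (mod g f)
  then have "tri UNIV f (g mod f)" by (simp add: coprime_commute)
  then have "tri UNIV (g mod f) f" by (rule tri_sym[OF is_subring_UNIV])
  then have "tri UNIV (g mod f + (g div f) * f) f" by (intro tri_add_left) auto
  then show ?case by simp
qed

theorem SL_field_poly:
  fixes A :: "'k::field_gcd poly mat"
  assumes "n \<ge> 3" "A \<in> carrier_mat n n" "det A = 1"
  shows "A \<in> Eg n UNIV"
proof -
  interpret row_reduction "UNIV :: 'k set" UNIV
  proof
    show "ideal_in UNIV (UNIV :: 'k set)" by (simp add: ideal_in_def)
    show "\<exists>r. r \<noteq> 0 \<and> smult r q \<in> polys UNIV" for q :: "'k poly" by (auto intro: exI[of _ 1])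
    fix g f :: "'k poly" assume "coprime g f"
    moreover from this obtain a b where "a * g + b * f = 1"
      using bezout_coefficients_fst_snd[of g f] by (metis coprime_imp_gcd_eq_1)
    then have "g * a + f * b = 1" by (simp add: mult.commute)
    ultimately show "\<exists>u w. u - 1 \<in> polys UNIV \<and> w \<in> polys UNIV \<and> g * u + f * w = 1 \<and> tri (polys UNIV) g f"
      using tri_field[of g f] by auto
  qed simp
  show ?thesis using Eg_if_cong_one[of n A] assms by (simp add: cong_mat_def)
qed

section \<open>Prime ideals and residue fields\<close>

definition prime_in :: "'a::comm_ring_1 set \<Rightarrow> 'a set \<Rightarrow> bool" where
  "prime_in D J \<longleftrightarrow> ideal_in D J \<and> 1 \<notin> J \<and> (\<forall>a\<in>D. \<forall>b\<in>D. a * b \<in> J \<longrightarrow> a \<in> J \<or> b \<in> J)"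

lemma prime_inD:
  assumes "prime_in D J"
  shows "ideal_in D J" "1 \<notin> J" "a \<in> D \<Longrightarrow> b \<in> D \<Longrightarrow> a * b \<in> J \<Longrightarrow> a \<in> J \<or> b \<in> J"
  using assms unfolding prime_in_def by auto

lemma prime_in_power: "prime_in D J \<Longrightarrow> is_subring D \<Longrightarrow> a \<in> D \<Longrightarrow> a ^ n \<in> J \<Longrightarrow> a \<in> J"
proof (induction n)
  case (Suc n)
  then show ?case using prime_inD(3)[of D J a "a ^ n"] by (auto simp: subring_power)
qed (simp add: prime_in_def)

section \<open>Maximal ideals of a type\<close>

definition max_ideal :: "'a::comm_ring_1 set \<Rightarrow> bool" where
  "max_ideal M \<longleftrightarrow> ideal_in UNIV M \<and> 1 \<notin> M \<and> (\<forall>J. ideal_in UNIV J \<longrightarrow> 1 \<notin> J \<longrightarrow> M \<subseteq> J \<longrightarrow> J = M)"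

lemma ex_max_ideal:
  assumes I: "ideal_in UNIV I" "1 \<notin> I"
  obtains M where "max_ideal M" "I \<subseteq> M"
proof -
  define S where "S = {J. ideal_in UNIV J \<and> 1 \<notin> J \<and> I \<subseteq> J}"
  have "\<exists>M\<in>S. \<forall>J\<in>S. M \<subseteq> J \<longrightarrow> J = M"
  proof (rule subset_Zorn_nonempty)
    show "S \<noteq> {}" using I by (auto simp: S_def)
    fix C assume C: "C \<noteq> {}" "subset.chain S C"
    have add: "a + b \<in> \<Union>C" if ab: "a \<in> \<Union>C" "b \<in> \<Union>C" for a b
    proof -
      obtain J J' where J: "J \<in> C" "a \<in> J" "J' \<in> C" "b \<in> J'" using ab by auto
      then have "J \<subseteq> J' \<or> J' \<subseteq> J" using C by (auto simp: subset.chain_def)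
      moreover have "ideal_in UNIV J" "ideal_in UNIV J'" using J C by (auto simp: subset.chain_def S_def)
      ultimately have "a + b \<in> J \<or> a + b \<in> J'" using J ideal_inD(3) by blast
      then show ?thesis using J by auto
    qed
    have CS: "ideal_in UNIV J" if "J \<in> C" for J using C that by (auto simp: subset.chain_def S_def)
    have "0 \<in> \<Union>C" using C(1) CS by (auto dest: ideal_inD(2))
    moreover have "a * b \<in> \<Union>C" if "b \<in> \<Union>C" for a b
      using that ideal_inD(4)[OF CS, of _ a b] by auto
    ultimately have "ideal_in UNIV (\<Union>C)" unfolding ideal_in_def using add by blast
    then show "\<Union>C \<in> S" using C by (auto simp: subset.chain_def S_def)
  qed
  then obtain M where M: "M \<in> S" "\<forall>J\<in>S. M \<subseteq> J \<longrightarrow> J = M" by auto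
  then show thesis by (intro that[of M]) (auto simp: S_def max_ideal_def)
qed

lemma max_ideal_prime:
  assumes M: "max_ideal M"
  shows "prime_in UNIV M"
proof -
  have I: "ideal_in UNIV M" and one: "1 \<notin> M" using M by (auto simp: max_ideal_def)
  have unit: "\<exists>x. \<exists>m\<in>M. 1 = m + x * a" if a: "a \<notin> M" for a
  proof -
    define J where "J = {m + x * a |m x. m \<in> M}"
    have "ideal_in UNIV J" unfolding ideal_in_def
    proof (intro conjI ballI)
      show "0 \<in> J" unfolding J_def using ideal_inD(2)[OF I] by (auto intro!: exI[of _ 0])
      fix y z assume y: "y \<in> J" and z: "z \<in> J"
      obtain m x m' x' where "y = m + x * a" "m \<in> M" "z = m' + x' * a" "m' \<in> M"
        using y z by (auto simp: J_def)
      then have "y + z = (m + m') + (x + x') * a" "m + m' \<in> M"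
        using ideal_inD(3)[OF I] by (auto simp: algebra_simps)
      then show "y + z \<in> J" unfolding J_def by blast
    next
      fix c y assume y: "y \<in> J"
      obtain m x where "y = m + x * a" "m \<in> M" using y by (auto simp: J_def)
      then have "c * y = c * m + (c * x) * a" "c * m \<in> M"
        using ideal_inD(4)[OF I] by (auto simp: algebra_simps)
      then show "c * y \<in> J" unfolding J_def by blast
    qed simp
    moreover have "M \<subseteq> J"
    proof
      fix y assume "y \<in> M"
      moreover have "y = y + 0 * a" by simp
      ultimately show "y \<in> J" unfolding J_def by blast
    qed
    moreover have "a = 0 + 1 * a" by simp
    then have "a \<in> J" unfolding J_def using ideal_inD(2)[OF I] by blast
    ultimately have "1 \<in> J" using M a unfolding max_ideal_def by blast
    then show ?thesis unfolding J_def by auto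
  qed
  show ?thesis unfolding prime_in_def
  proof (intro conjI ballI impI)
    fix a b assume ab: "a * b \<in> M"
    show "a \<in> M \<or> b \<in> M"
    proof (rule ccontr)
      assume "\<not> (a \<in> M \<or> b \<in> M)"
      then obtain x m y m' where x: "m \<in> M" "1 = m + x * a" "m' \<in> M" "1 = m' + y * b"
        using unit by metis
      have "1 = (m + x * a) * (m' + y * b)" using x(2,4) by (metis mult_1)
      also have "\<dots> = m * (m' + y * b) + (x * a) * m' + (x * y) * (a * b)" by (simp add: algebra_simps)
      also have "\<dots> \<in> M" using x ab by (intro ideal_inD(3)[OF I] ideal_inD(5)[OF I, of m] ideal_inD(4)[OF I, of "x * a"] ideal_inD(4)[OF I, of "x * y"]) auto
      finally show False using one by simp
    qed
  qed (use I one in auto)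
qed

text \<open>Says that the image of \<open>A\<close> over the polynomials over \<open>D / J\<close>
  is elementary, without forming the quotient: elementary matrices over the quotient lift to
  \<open>D\<close>.\<close>

definition elem_mod :: "nat \<Rightarrow> 'a::comm_ring_1 set \<Rightarrow> 'a set \<Rightarrow> 'a poly mat \<Rightarrow> bool" where
  "elem_mod n D J A \<longleftrightarrow> (\<exists>B\<in>Eg n (polys D). cong_mat n (polys J) A B)"

text \<open>In a valuation ring, and for a nonunit \<open>c\<close>, this is the smallest prime
  ideal that contains \<open>c\<close>.\<close>

definition radical :: "'a::comm_ring_1 set \<Rightarrow> 'a \<Rightarrow> 'a set" where
  "radical D c = {y \<in> D. \<exists>N. \<exists>q\<in>D. y ^ N = q * c}"

text \<open>A failure of the theorem over a valuation ring \<open>D / J\<close> all of whose proper quotients satisfy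
  the theorem for the matrix under consideration.\<close>

definition val_failure :: "'a::comm_ring_1 set \<Rightarrow> 'a set \<Rightarrow> bool" where
  "val_failure D J \<longleftrightarrow> is_subring D \<and> prime_in D J \<and> (\<forall>a\<in>D. \<forall>b\<in>D. \<exists>q\<in>D. a = q * b \<or> b = q * a) \<and>
    (\<exists>n\<ge>3. \<exists>A\<in>mats n (polys D). det A = 1 \<and> \<not> elem_mod n D J A \<and>
      ((\<forall>a\<in>D. a \<notin> J \<longrightarrow> (\<exists>b\<in>D. a * b = 1)) \<or>
       (\<exists>c\<in>D. c \<notin> J \<and> (\<forall>b\<in>D. c * b \<noteq> 1) \<and> (\<forall>r\<in>D. r \<notin> J \<longrightarrow> (\<exists>N. \<exists>q\<in>D. c ^ N = q * r)) \<and>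
         elem_mod n D (radical D c) A)))"

text \<open>The substitution of \<open>x + s y\<close> for \<open>x\<close>; the outer variable of \<open>'a poly poly\<close> is \<open>y\<close>.\<close>

definition shift :: "'a::comm_ring_1 \<Rightarrow> 'a poly \<Rightarrow> 'a poly poly" where
  "shift s p = poly (map_poly (\<lambda>a. [:[:a:]:]) p) [:[:0, 1:], [:s:]:]"

text \<open>\<open>shift 0\<close> views \<open>A\<close> as a matrix not involving the variable y,
  so the condition reads A(x + s y) = A(x) E(x, y) with \<open>E\<close> elementary over
  R[x][y].\<close>

definition quillen :: "nat \<Rightarrow> 'a::comm_ring_1 poly mat \<Rightarrow> 'a set" where
  "quillen n A = {s. \<exists>E\<in>Eg n UNIV. map_mat (shift s) A = map_mat (shift 0) A * E}"

text \<open>For a prime \<open>m\<close> this is the preimage in the ring of the nilradical of the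
  localization at \<open>m\<close>.\<close>

definition torsion_nil :: "'a::comm_ring_1 set \<Rightarrow> 'a set" where
  "torsion_nil m = {a. \<exists>s N. s \<notin> m \<and> s * a ^ N = 0}"

text \<open>The condition with \<open>s\<close> and \<open>r\<close> is the valuation property of
  the localization at \<open>m\<close> with denominators cleared. All data apart from
  \<open>J\<close> are hidden under quantifiers, as the type of the residue field can depend on
  \<open>J\<close> alone.\<close>

definition quillen_failure :: "'a::comm_ring_1 set \<Rightarrow> bool" where
  "quillen_failure J \<longleftrightarrow> prime_in UNIV J \<and> (\<exists>n\<ge>3. \<exists>A\<in>carrier_mat n n. det A = 1 \<and> (\<exists>m. prime_in UNIV m \<and>
    quillen n A \<subseteq> m \<and> (\<forall>a b. \<exists>s r. s \<notin> m \<and> (s * a = r * b \<or> s * b = r * a)) \<and> J = torsion_nil m))"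

text \<open>The residue field \<open>Frac (D / J)\<close> depends on values rather than on types. It becomes a type by
  choosing for \<open>(D, J)\<close> a hypothetical failure of one of the local theorems, whenever there is one.\<close>

definition chosen :: "'a::comm_ring_1 set \<times> 'a set" where
  "chosen = (if \<exists>D J. val_failure D (J :: 'a set) then (SOME (D, J). val_failure D J)
    else if \<exists>J. quillen_failure (J :: 'a set) then (UNIV, SOME J. quillen_failure J)
    else (UNIV, SOME J. prime_in UNIV J))"

abbreviation "cD \<equiv> fst chosen"
abbreviation "cJ \<equiv> snd chosen"

lemma chosen_val:
  fixes D J :: "'a::comm_ring_1 set"
  assumes "val_failure D J"
  shows "val_failure cD (cJ :: 'a set)"
proof -
  from assms have ex: "\<exists>D J. val_failure D (J :: 'a set)" by blast
  then have "\<exists>x. case x of (D, J) \<Rightarrow> val_failure D (J :: 'a set)" by auto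
  from someI_ex[OF this] ex show ?thesis by (simp add: chosen_def case_prod_unfold)
qed

lemma chosen_quillen:
  fixes J :: "'a::comm_ring_1 set"
  assumes "quillen_failure J" "\<And>D J. \<not> val_failure D (J :: 'a set)"
  shows "cD = (UNIV :: 'a set)" "quillen_failure (cJ :: 'a set)"
  using assms someI_ex[of quillen_failure] by (auto simp: chosen_def)

text \<open>If nothing fails, the fallback is any prime ideal, which exists since maximal ideals do.
  Thus the type built from \<open>chosen\<close> is a field unconditionally.\<close>

lemma chosen_prime: "is_subring (cD :: 'a::comm_ring_1 set)" "prime_in cD (cJ :: 'a set)"
proof -
  have "is_subring (cD :: 'a set) \<and> prime_in cD (cJ :: 'a set)"
  proof (cases "\<exists>D J. val_failure D (J :: 'a set)")
    case True
    then have "val_failure cD (cJ :: 'a set)" using chosen_val by blast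
    then show ?thesis by (simp add: val_failure_def)
  next
    case F: False
    show ?thesis
    proof (cases "\<exists>J. quillen_failure (J :: 'a set)")
      case True
      then obtain J :: "'a set" where J: "quillen_failure J" by blast
      then show ?thesis using chosen_quillen[OF J] F by (simp add: quillen_failure_def)
    next
      case False
      have "ideal_in UNIV {0 :: 'a}" by (simp add: ideal_in_def)
      then have "\<exists>J. prime_in UNIV (J :: 'a set)" using ex_max_ideal[of "{0::'a}"] max_ideal_prime by (metis singletonD zero_neq_one)
      then have "prime_in UNIV (SOME J. prime_in UNIV (J :: 'a set))" by (rule someI_ex)
      then show ?thesis using F False by (auto simp: chosen_def)
    qed
  qed
  then show "is_subring (cD :: 'a set)" "prime_in cD (cJ :: 'a set)" by auto
qed

section \<open>The residue field at the chosen prime as a type\<close>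

definition resfrac_rel :: "'a::comm_ring_1 \<times> 'a \<Rightarrow> 'a \<times> 'a \<Rightarrow> bool" where
  "resfrac_rel x y \<longleftrightarrow> fst x \<in> cD \<and> snd x \<in> cD \<and> snd x \<notin> cJ \<and> fst y \<in> cD \<and> snd y \<in> cD \<and> snd y \<notin> cJ \<and>
    fst x * snd y - fst y * snd x \<in> cJ"

lemmas cDD = is_subringD[OF chosen_prime(1)]
lemmas cJI = prime_inD(1)[OF chosen_prime(2)]
lemmas cJD = ideal_inD[OF cJI]
lemmas cJp = prime_inD(3)[OF chosen_prime(2)]

lemma cJ_prime: "a \<in> cD \<Longrightarrow> b \<in> cD \<Longrightarrow> a * b \<in> cJ \<longleftrightarrow> a \<in> cJ \<or> b \<in> cJ"
  using cJp cJD(4,5) by blast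

lemma one_cJ [simp]: "(1 :: 'a::comm_ring_1) \<notin> cJ" using prime_inD(2)[OF chosen_prime(2)] .

lemma resfrac_relI:
  assumes "a \<in> cD" "s \<in> cD" "s \<notin> cJ" "b \<in> cD" "t \<in> cD" "t \<notin> cJ" "a * t - b * s \<in> cJ"
  shows "resfrac_rel (a, s) (b, t)"
  using assms by (simp add: resfrac_rel_def)

lemma resfrac_part_equivp: "part_equivp (resfrac_rel :: 'a::comm_ring_1 \<times> 'a \<Rightarrow> _)"
proof (rule part_equivpI)
  have "resfrac_rel (0, 1) (0, 1 :: 'a)" by (rule resfrac_relI) (auto simp: cDD cJD)
  then show "\<exists>x::'a \<times> 'a. resfrac_rel x x" by blast
  show "symp (resfrac_rel :: 'a \<times> 'a \<Rightarrow> _)"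
  proof (rule sympI)
    fix x y :: "'a \<times> 'a" assume r: "resfrac_rel x y"
    then have "- (fst x * snd y - fst y * snd x) \<in> cJ"
      by (intro ideal_in_uminus[OF chosen_prime(1) cJI]) (simp add: resfrac_rel_def)
    then show "resfrac_rel y x" using r by (simp add: resfrac_rel_def)
  qed
  show "transp (resfrac_rel :: 'a \<times> 'a \<Rightarrow> _)"
  proof (rule transpI)
    fix x y z :: "'a \<times> 'a" assume r: "resfrac_rel x y" "resfrac_rel y z"
    obtain a s b t c v where e: "x = (a, s)" "y = (b, t)" "z = (c, v)" by (metis surj_pair)
    have k: "a \<in> cD" "s \<in> cD" "b \<in> cD" "t \<in> cD" "c \<in> cD" "v \<in> cD" "s \<notin> cJ" "t \<notin> cJ" "v \<notin> cJ"
      "a * t - b * s \<in> cJ" "b * v - c * t \<in> cJ" using r by (auto simp: resfrac_rel_def e)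
    have "t * (a * v - c * s) = (a * t - b * s) * v + (b * v - c * t) * s" by (simp add: algebra_simps)
    also have "\<dots> \<in> cJ" using k by (intro cJD(3) cJD(5))
    finally have "a * v - c * s \<in> cJ" using k cJp[of t "a * v - c * s"] by (auto simp: cDD)
    then show "resfrac_rel x z" unfolding e using k by (intro resfrac_relI)
  qed
qed

quotient_type (overloaded) 'a resfrac = "'a::comm_ring_1 \<times> 'a" / partial: resfrac_rel
  by (rule resfrac_part_equivp)

instantiation resfrac :: (comm_ring_1) field
begin

lift_definition zero_resfrac :: "'a resfrac" is "(0, 1)"
  by (rule resfrac_relI) (auto simp: cDD cJD)

lift_definition one_resfrac :: "'a resfrac" is "(1, 1)"
  by (rule resfrac_relI) (auto simp: cDD cJD)

lift_definition plus_resfrac :: "'a resfrac \<Rightarrow> 'a resfrac \<Rightarrow> 'a resfrac"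
  is "\<lambda>x y. (fst x * snd y + fst y * snd x, snd x * snd y)"
proof -
  fix x x' y y' :: "'a \<times> 'a" assume r: "resfrac_rel x x'" "resfrac_rel y y'"
  obtain a s a' s' b t b' t' where e: "x = (a, s)" "x' = (a', s')" "y = (b, t)" "y' = (b', t')" by (metis surj_pair)
  have k: "a \<in> cD" "s \<in> cD" "a' \<in> cD" "s' \<in> cD" "b \<in> cD" "t \<in> cD" "b' \<in> cD" "t' \<in> cD"
    "s \<notin> cJ" "s' \<notin> cJ" "t \<notin> cJ" "t' \<notin> cJ" "a * s' - a' * s \<in> cJ" "b * t' - b' * t \<in> cJ"
    using r by (auto simp: resfrac_rel_def e)
  have "(a * t + b * s) * (s' * t') - (a' * t' + b' * s') * (s * t) =
    (a * s' - a' * s) * (t * t') + (b * t' - b' * t) * (s * s')" by (simp add: algebra_simps)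
  also have "\<dots> \<in> cJ" using k by (intro cJD(3) cJD(5) cDD(4))
  finally show "resfrac_rel (fst x * snd y + fst y * snd x, snd x * snd y) (fst x' * snd y' + fst y' * snd x', snd x' * snd y')"
    unfolding e using k by (intro resfrac_relI) (auto simp: cDD cJ_prime)
qed

lift_definition times_resfrac :: "'a resfrac \<Rightarrow> 'a resfrac \<Rightarrow> 'a resfrac"
  is "\<lambda>x y. (fst x * fst y, snd x * snd y)"
proof -
  fix x x' y y' :: "'a \<times> 'a" assume r: "resfrac_rel x x'" "resfrac_rel y y'"
  obtain a s a' s' b t b' t' where e: "x = (a, s)" "x' = (a', s')" "y = (b, t)" "y' = (b', t')" by (metis surj_pair)
  have k: "a \<in> cD" "s \<in> cD" "a' \<in> cD" "s' \<in> cD" "b \<in> cD" "t \<in> cD" "b' \<in> cD" "t' \<in> cD"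
    "s \<notin> cJ" "s' \<notin> cJ" "t \<notin> cJ" "t' \<notin> cJ" "a * s' - a' * s \<in> cJ" "b * t' - b' * t \<in> cJ"
    using r by (auto simp: resfrac_rel_def e)
  have "(a * b) * (s' * t') - (a' * b') * (s * t) =
    (a * s' - a' * s) * (b * t') + (b * t' - b' * t) * (a' * s)" by (simp add: algebra_simps)
  also have "\<dots> \<in> cJ" using k by (intro cJD(3) cJD(5) cDD(4))
  finally show "resfrac_rel (fst x * fst y, snd x * snd y) (fst x' * fst y', snd x' * snd y')"
    unfolding e using k by (intro resfrac_relI) (auto simp: cDD cJ_prime)
qed

lift_definition uminus_resfrac :: "'a resfrac \<Rightarrow> 'a resfrac" is "\<lambda>x. (- fst x, snd x)"
proof -
  fix x x' :: "'a \<times> 'a" assume r: "resfrac_rel x x'"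
  have "- (fst x * snd x' - fst x' * snd x) \<in> cJ"
    using r by (intro ideal_in_uminus[OF chosen_prime(1) cJI]) (auto simp: resfrac_rel_def)
  then show "resfrac_rel (- fst x, snd x) (- fst x', snd x')"
    using r by (auto simp: resfrac_rel_def cDD)
qed

lift_definition inverse_resfrac :: "'a resfrac \<Rightarrow> 'a resfrac" is "\<lambda>x. if fst x \<in> cJ then (0, 1) else (snd x, fst x)"
proof -
  fix x x' :: "'a \<times> 'a" assume r: "resfrac_rel x x'"
  obtain a s a' s' where e: "x = (a, s)" "x' = (a', s')" by (metis surj_pair)
  have k: "a \<in> cD" "s \<in> cD" "a' \<in> cD" "s' \<in> cD" "s \<notin> cJ" "s' \<notin> cJ" "a * s' - a' * s \<in> cJ"
    using r by (auto simp: resfrac_rel_def e)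
  have "a * s' \<in> cJ \<longleftrightarrow> a' * s \<in> cJ"
    using cJD(3)[OF k(7), of "a' * s"] ideal_in_diff[OF chosen_prime(1) cJI _ k(7), of "a * s'"] by auto
  then have iff: "a \<in> cJ \<longleftrightarrow> a' \<in> cJ" using k by (simp add: cJ_prime)
  have "- (a * s' - a' * s) \<in> cJ" using k by (intro ideal_in_uminus[OF chosen_prime(1) cJI])
  then have "s * a' - s' * a \<in> cJ" by (simp add: algebra_simps)
  then show "resfrac_rel (if fst x \<in> cJ then (0, 1) else (snd x, fst x)) (if fst x' \<in> cJ then (0, 1) else (snd x', fst x'))"
    unfolding e using k iff by (auto intro!: resfrac_relI simp: cDD cJD)
qed

definition minus_resfrac :: "'a resfrac \<Rightarrow> 'a resfrac \<Rightarrow> 'a resfrac" where "minus_resfrac x y = x + - y"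
definition divide_resfrac :: "'a resfrac \<Rightarrow> 'a resfrac \<Rightarrow> 'a resfrac" where "divide_resfrac x y = x * inverse y"

definition rf :: "'a \<Rightarrow> 'a \<Rightarrow> 'a resfrac" where "rf a s = abs_resfrac (a, s)"

lemma rf_rel: "a \<in> cD \<Longrightarrow> s \<in> cD \<Longrightarrow> s \<notin> cJ \<Longrightarrow> resfrac_rel (a, s) (a, s)"
  by (rule resfrac_relI) (auto simp: cJD)

lemma rf_cases: 
  obtains a s where "a \<in> cD" "s \<in> cD" "s \<notin> cJ" "x = rf a s"
proof -
  obtain y where y: "resfrac_rel y y" "x = abs_resfrac y"
    using Quotient3_abs_rep[OF Quotient3_resfrac, of x] Quotient3_rep_reflp[OF Quotient3_resfrac, of x] by metis
  then show thesis using that[of "fst y" "snd y"] by (auto simp: rf_def resfrac_rel_def)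
qed

lemma rf_eq_iff:
  assumes "a \<in> cD" "s \<in> cD" "s \<notin> cJ" "b \<in> cD" "t \<in> cD" "t \<notin> cJ"
  shows "rf a s = rf b t \<longleftrightarrow> a * t - b * s \<in> cJ"
  using Quotient3_rel[OF Quotient3_resfrac, of "(a, s)" "(b, t)"] rf_rel[OF assms(1-3)] rf_rel[OF assms(4-6)] assms
  by (auto simp: rf_def resfrac_rel_def)

lemma rf_plus: "a \<in> cD \<Longrightarrow> s \<in> cD \<Longrightarrow> s \<notin> cJ \<Longrightarrow> b \<in> cD \<Longrightarrow> t \<in> cD \<Longrightarrow> t \<notin> cJ \<Longrightarrow>
    rf a s + rf b t = rf (a * t + b * s) (s * t)"
  and rf_times: "a \<in> cD \<Longrightarrow> s \<in> cD \<Longrightarrow> s \<notin> cJ \<Longrightarrow> b \<in> cD \<Longrightarrow> t \<in> cD \<Longrightarrow> t \<notin> cJ \<Longrightarrow>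
    rf a s * rf b t = rf (a * b) (s * t)"
  unfolding rf_def by (simp_all add: plus_resfrac.abs_eq times_resfrac.abs_eq rf_rel)

lemma rf_uminus: "a \<in> cD \<Longrightarrow> s \<in> cD \<Longrightarrow> s \<notin> cJ \<Longrightarrow> - rf a s = rf (- a) s"
  and rf_inverse: "a \<in> cD \<Longrightarrow> s \<in> cD \<Longrightarrow> s \<notin> cJ \<Longrightarrow> inverse (rf a s) = (if a \<in> cJ then rf 0 1 else rf s a)"
  unfolding rf_def by (simp_all add: uminus_resfrac.abs_eq inverse_resfrac.abs_eq rf_rel)

lemma rf_zero: "0 = rf 0 1" and rf_one: "1 = rf 1 1"
  unfolding rf_def by (simp_all add: zero_resfrac_def one_resfrac_def)

lemmas rf_simps = rf_plus rf_times rf_uminus rf_inverse rf_zero rf_one cDD cJ_prime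

instance
proof
  have rfI: "rf a s = rf b t" if "a \<in> cD" "s \<in> cD" "s \<notin> cJ" "b \<in> cD" "t \<in> cD" "t \<notin> cJ" "a * t - b * s = 0"
    for a s b t :: 'a using that rf_eq_iff[of a s b t] cJD(2) by simp
  fix x y z :: "'a resfrac"
  obtain a s where x: "a \<in> cD" "s \<in> cD" "s \<notin> cJ" "x = rf a s" by (rule rf_cases)
  obtain b t where y: "b \<in> cD" "t \<in> cD" "t \<notin> cJ" "y = rf b t" by (rule rf_cases)
  obtain c v where z: "c \<in> cD" "v \<in> cD" "v \<notin> cJ" "z = rf c v" by (rule rf_cases)
  note k = x y z
  show "x * y * z = x * (y * z)" using k by (simp add: rf_simps mult.assoc)
  show "x * y = y * x" using k by (simp add: rf_simps mult.commute)
  show "1 * x = x" using k by (simp add: rf_simps)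
  show "x + y + z = x + (y + z)" using k by (simp add: rf_simps algebra_simps)
  show "x + y = y + x" using k by (simp add: rf_simps mult.commute add.commute)
  show "0 + x = x" using k by (simp add: rf_simps)
  show "- x + x = 0" unfolding x(4) rf_zero using k by (simp add: rf_simps) (rule rfI; simp add: cDD cJ_prime algebra_simps)
  show "(x + y) * z = x * z + y * z"
    unfolding x(4) y(4) z(4) using k by (simp add: rf_simps) (rule rfI; simp add: cDD cJ_prime algebra_simps)
  have "(-1 :: 'a) \<notin> cJ" using ideal_in_uminus[OF chosen_prime(1) cJI, of "-1"] one_cJ by auto
  then show "(0 :: 'a resfrac) \<noteq> 1" unfolding rf_zero rf_one by (subst rf_eq_iff) (auto simp: cDD)
  show "x \<noteq> 0 \<Longrightarrow> inverse x * x = 1"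
  proof -
    assume n: "x \<noteq> 0"
    have "a \<notin> cJ"
    proof
      assume "a \<in> cJ"
      then have "rf a s = rf 0 1" using x by (subst rf_eq_iff) (auto simp: cDD)
      then show False using n x by (simp add: rf_zero)
    qed
    then show "inverse x * x = 1"
      unfolding x(4) rf_one using k by (simp add: rf_simps) (rule rfI; simp add: cDD cJ_prime mult.commute)
  qed
  show "inverse (0 :: 'a resfrac) = 0" unfolding rf_zero by (simp add: rf_inverse cDD cJD)
qed (simp_all add: minus_resfrac_def divide_resfrac_def)

end

instantiation resfrac :: (comm_ring_1) "{unique_euclidean_ring, normalization_euclidean_semiring, normalization_semidom_multiplicative}"
begin

definition [simp]: "normalize_resfrac = (normalize_field :: 'a resfrac \<Rightarrow> _)"
definition [simp]: "unit_factor_resfrac = (unit_factor_field :: 'a resfrac \<Rightarrow> _)"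
definition [simp]: "modulo_resfrac = (mod_field :: 'a resfrac \<Rightarrow> _)"
definition [simp]: "euclidean_size_resfrac = (euclidean_size_field :: 'a resfrac \<Rightarrow> _)"
definition [simp]: "division_segment (x :: 'a resfrac) = 1"

instance
  by standard (simp_all add: dvd_field_iff field_split_simps split: if_splits)

end

instantiation resfrac :: (comm_ring_1) euclidean_ring_gcd
begin

definition gcd_resfrac :: "'a resfrac \<Rightarrow> 'a resfrac \<Rightarrow> 'a resfrac" where "gcd_resfrac = Euclidean_Algorithm.gcd"
definition lcm_resfrac :: "'a resfrac \<Rightarrow> 'a resfrac \<Rightarrow> 'a resfrac" where "lcm_resfrac = Euclidean_Algorithm.lcm"
definition Gcd_resfrac :: "'a resfrac set \<Rightarrow> 'a resfrac" where "Gcd_resfrac = Euclidean_Algorithm.Gcd"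
definition Lcm_resfrac :: "'a resfrac set \<Rightarrow> 'a resfrac" where "Lcm_resfrac = Euclidean_Algorithm.Lcm"

instance by standard (simp_all add: gcd_resfrac_def lcm_resfrac_def Gcd_resfrac_def Lcm_resfrac_def)

end

instance resfrac :: (comm_ring_1) field_gcd ..

definition res :: "'a::comm_ring_1 \<Rightarrow> 'a resfrac" where "res a = rf a 1"

lemma hom_on_res: "hom_on cD res"
  unfolding hom_on_def res_def using chosen_prime(1) by (auto simp: rf_simps)

lemma res_eq_iff: "a \<in> cD \<Longrightarrow> b \<in> cD \<Longrightarrow> res a = res b \<longleftrightarrow> a - b \<in> cJ"
  unfolding res_def using rf_eq_iff[of a 1 b 1] by (simp add: cDD)

lemma res_eq_0_iff: "(a :: 'a::comm_ring_1) \<in> cD \<Longrightarrow> res a = 0 \<longleftrightarrow> a \<in> cJ"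
  using res_eq_iff[of a 0] hom_onD(5)[OF hom_on_res, where 'a='a] by (simp add: cDD)

lemma resfrac_cases:
  obtains a s where "a \<in> cD" "s \<in> cD" "s \<notin> cJ" "x = res a / res s"
proof -
  obtain a s where x: "a \<in> cD" "s \<in> cD" "s \<notin> cJ" "x = rf a s" by (rule rf_cases)
  have "res a / res s = rf a s"
    unfolding res_def divide_resfrac_def using x by (simp add: rf_simps)
  then show thesis using that x by metis
qed

lemma polys_lift:
  assumes h: "hom_on D f" and p: "p \<in> polys (f ` D)"
  obtains q where "q \<in> polys D" "map_poly f q = p"
proof -
  have "coeff p i \<in> f ` D" for i using p by (simp add: polys_def)
  then have "\<forall>i. \<exists>a. a \<in> D \<and> f a = coeff p i" by (metis imageE)
  then obtain c where c: "\<And>i. c i \<in> D" "\<And>i. f (c i) = coeff p i" by metis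
  define q where "q = (\<Sum>i\<le>degree p. monom (c i) i)"
  have cq: "coeff q i = (if i \<le> degree p then c i else 0)" for i
    by (auto simp: q_def coeff_sum)
  have "map_poly f q = p"
    by (rule poly_eqI) (auto simp: coeff_map_poly_hom[OF h] cq c hom_onD(5)[OF h] coeff_eq_0)
  moreover have "q \<in> polys D" using c is_subringD[OF hom_onD(1)[OF h]] by (auto simp: polys_def cq)
  ultimately show thesis using that by blast
qed

lemma map_poly_polys: "hom_on D f \<Longrightarrow> p \<in> polys I \<Longrightarrow> map_poly f p \<in> polys (f ` I)"
  by (auto simp: polys_def coeff_map_poly_hom)

lemma ideal_in_image:
  assumes h: "hom_on D f" and I: "ideal_in D I"
  shows "ideal_in (f ` D) (f ` I)"
proof -
  note h' = hom_onD[OF h] and I' = ideal_inD[OF I]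
  have "f a + f b \<in> f ` I" if "a \<in> I" "b \<in> I" for a b
    using that h'(3)[of a b, symmetric] I' by auto
  moreover have "f a * f b \<in> f ` I" if "a \<in> D" "b \<in> I" for a b
    using that h'(4)[of a b, symmetric] I' by auto
  moreover have "0 \<in> f ` I" using imageI[OF I'(2), of f] h'(5) by simp
  moreover have "f ` I \<subseteq> f ` D" using I' by auto
  ultimately show ?thesis unfolding ideal_in_def by blast
qed

section \<open>Radicals in valuation rings\<close>

locale valuation_domain_in =
  fixes D :: "'a::comm_ring_1 set"
  assumes D: "is_subring D" and val: "\<And>a b. a \<in> D \<Longrightarrow> b \<in> D \<Longrightarrow> \<exists>q\<in>D. a = q * b \<or> b = q * a"
begin

lemmas DD = is_subringD[OF D]

lemma radicalI: "y \<in> D \<Longrightarrow> q \<in> D \<Longrightarrow> y ^ N = q * c \<Longrightarrow> y \<in> radical D c"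
  unfolding radical_def by blast

text \<open>One summand is a multiple of the other, so the sum is a multiple of a single element of
  the radical; no binomial expansion is needed.\<close>

lemma radical_add:
  assumes y: "y \<in> radical D c" "z \<in> radical D c"
  shows "y + z \<in> radical D c"
proof -
  have *: "a + b \<in> radical D c" if ab: "a = q * b" "a \<in> D" "b \<in> radical D c" "q \<in> D" for a b q
  proof -
    obtain N r where r: "b \<in> D" "r \<in> D" "b ^ N = r * c" using ab(3) by (auto simp: radical_def)
    have "(a + b) ^ N = ((q + 1) ^ N * r) * c"
    proof -
      have "a + b = (q + 1) * b" by (simp add: ab(1) distrib_right)
      then show ?thesis using r by (simp add: power_mult_distrib mult.assoc)
    qed
    moreover have "(q + 1) ^ N * r \<in> D" using ab(4) r by (intro DD(4) subring_power D DD(3) DD(2))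
    ultimately show ?thesis using ab(2) r(1) by (intro radicalI[of "a + b" "(q + 1) ^ N * r" N]) (auto intro: DD)
  qed
  have "y \<in> D" "z \<in> D" using y by (auto simp: radical_def)
  moreover from this obtain q where q: "q \<in> D" "y = q * z \<or> z = q * y" using val by blast
  moreover have "z + y = y + z" by (rule add.commute)
  ultimately show ?thesis using *[of y q z] *[of z q y] y by metis
qed

lemma radical_ideal: "ideal_in D (radical D c)"
  unfolding ideal_in_def
proof (intro conjI ballI)
  have "(0::'a) ^ 1 = 0 * c" by simp
  then show "0 \<in> radical D c" by (rule radicalI[OF DD(1) DD(1)])
  fix a b assume a: "a \<in> D" and b: "b \<in> radical D c"
  obtain N r where r: "b \<in> D" "r \<in> D" "b ^ N = r * c" using b by (auto simp: radical_def)
  have "(a * b) ^ N = (a ^ N * r) * c" using r by (simp add: power_mult_distrib mult.assoc)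
  then show "a * b \<in> radical D c" using a r by (intro radicalI[of "a * b" "a ^ N * r" N] DD(4) subring_power D)
qed (auto simp: radical_add, auto simp: radical_def)

text \<open>If \<open>a = q * b\<close>, then \<open>a ^ 2 = q * (a * b)\<close>, so a power of
  \<open>a\<close> is a multiple of a power of the product.\<close>

lemma radical_prime:
  assumes a: "a \<in> D" "b \<in> D" "a * b \<in> radical D c"
  shows "a \<in> radical D c \<or> b \<in> radical D c"
proof -
  have *: "a \<in> radical D c" if ab: "a = q * b" "a \<in> D" "b \<in> D" "q \<in> D" "a * b \<in> radical D c" for a b q
  proof -
    obtain N r where r: "r \<in> D" "(a * b) ^ N = r * c" using ab by (auto simp: radical_def)
    have "a ^ (2 * N) = q ^ N * (a * b) ^ N"
    proof -
      have "a ^ 2 = q * (a * b)" using ab(1) by (simp add: power2_eq_square mult_ac)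
      then show ?thesis by (simp add: power_mult power_mult_distrib)
    qed
    then have "a ^ (2 * N) = (q ^ N * r) * c" using r by (simp add: mult.assoc)
    then show ?thesis using ab r by (intro radicalI[of a "q ^ N * r" "2 * N"] DD(4) subring_power D)
  qed
  obtain q where q: "q \<in> D" "a = q * b \<or> b = q * a" using val a by blast
  moreover have "b * a = a * b" by (rule mult.commute)
  ultimately show ?thesis using *[of a q b] *[of b q a] a by metis
qed

lemma subset_radical:
  assumes J: "prime_in D J" and c: "c \<in> D" "c \<notin> J"
  shows "J \<subseteq> radical D c"
proof
  fix j assume j: "j \<in> J"
  then have jD: "j \<in> D" using ideal_inD(1)[OF prime_inD(1)[OF J]] by auto
  obtain q where q: "q \<in> D" "j = q * c \<or> c = q * j" using val[OF jD c(1)] by auto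
  then have "j ^ 1 = q * c" using c ideal_inD(4)[OF prime_inD(1)[OF J], of q j] j by auto
  then show "j \<in> radical D c" by (rule radicalI[OF jD q(1)])
qed

end

text \<open>By choice, a failure exists also for \<open>cD\<close> and \<open>cJ\<close>, whose
  residue field is a type. There the quotient of \<open>cD\<close> by \<open>cJ\<close> becomes the
  valuation subring \<open>V\<close>, and either \<open>SL_field_poly\<close> or the congruence
  theorem applies.\<close>

theorem no_val_failure:
  fixes D J :: "'a::comm_ring_1 set"
  shows "\<not> val_failure D J"
proof
  assume "val_failure D J"
  then have "val_failure cD (cJ :: 'a set)" by (rule chosen_val)
  note vf = this[unfolded val_failure_def]
  have val: "\<exists>q\<in>cD. a = q * b \<or> b = q * a" if "a \<in> cD" "b \<in> cD" for a b :: 'a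
    using vf[THEN conjunct2, THEN conjunct2, THEN conjunct1] that by blast
  obtain n and A :: "'a poly mat" where n: "n \<ge> 3" and A: "A \<in> mats n (polys cD)" "det A = 1" "\<not> elem_mod n cD cJ A"
    and alt: "(\<forall>a\<in>cD. a \<notin> cJ \<longrightarrow> (\<exists>b\<in>cD. a * b = (1::'a))) \<or>
       (\<exists>c\<in>cD. c \<notin> cJ \<and> (\<forall>b\<in>cD. c * b \<noteq> 1) \<and> (\<forall>r\<in>cD. r \<notin> cJ \<longrightarrow> (\<exists>N. \<exists>q\<in>cD. c ^ N = q * r)) \<and>
         elem_mod n cD (radical cD c) A)"
    using vf[THEN conjunct2, THEN conjunct2, THEN conjunct2] by (elim exE conjE bexE)
  interpret vd: valuation_domain_in "cD :: 'a set"
    by unfold_locales (rule chosen_prime(1), rule val)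
  define V where "V = res ` (cD :: 'a set)"
  have h: "hom_on (cD :: 'a set) res" by (rule hom_on_res)
  have hx: "hom_on (polys cD) (map_poly (res :: 'a \<Rightarrow> _))" by (rule hom_on_map_poly[OF h])
  have V: "is_subring V" unfolding V_def by (rule hom_on_image[OF h])
  note Vx = is_subring_polys[OF V]
  have surj: "polys V \<subseteq> map_poly res ` polys (cD :: 'a set)"
    unfolding V_def by (auto elim!: polys_lift[OF h])
  have V_sub: "map_poly res ` polys (cD :: 'a set) \<subseteq> polys V"
    unfolding V_def using map_poly_polys[OF h] by auto
  define A' where "A' = map_mat (map_poly res) A"
  have A': "A' \<in> mats n (polys V)" using A(1) V_sub by (auto simp: A'_def mats_def)
  have dA': "det A' = 1" unfolding A'_def hom_on_det[OF hx A(1)] A(2) by (rule hom_onD(2)[OF hx])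
  have not_E: "A' \<notin> Eg n (polys V)"
  proof
    assume "A' \<in> Eg n (polys V)"
    then obtain B where B: "B \<in> Eg n (polys cD)" "map_mat (map_poly res) B = A'" by (rule Eg_lift[OF hx surj])
    have "cong_mat n (polys cJ) A B" unfolding cong_mat_def
    proof (intro allI impI polysI)
      fix i j k assume ij: "i < n" "j < n"
      have Bm: "B \<in> mats n (polys cD)" using Eg_mats[OF is_subring_polys[OF chosen_prime(1)] B(1)] .
      have "map_mat (map_poly res) B $$ (i,j) = map_mat (map_poly res) A $$ (i,j)" using B by (simp add: A'_def)
      then have "map_poly res (B $$ (i,j)) = map_poly res (A $$ (i,j))" using ij A(1) Bm by (auto simp: mats_def)
      then have "res (coeff (B $$ (i,j)) k) = res (coeff (A $$ (i,j)) k)"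
        by (metis coeff_map_poly_hom[OF h])
      then show "coeff (A $$ (i,j) - B $$ (i,j)) k \<in> cJ"
        using res_eq_iff[of "coeff (A $$ (i,j)) k" "coeff (B $$ (i,j)) k"] A(1) Bm ij by (simp add: mats_def polys_def)
    qed
    then show False using A(3) B(1) unfolding elem_mod_def by blast
  qed
  from alt show False
  proof
    \<comment> \<open>Elements outside \<open>cJ\<close> are units, so the quotient is already its
      own field of fractions.\<close>
    assume u: "\<forall>a\<in>cD. a \<notin> cJ \<longrightarrow> (\<exists>b\<in>cD. a * b = (1::'a))"
    have "x \<in> V" for x
    proof -
      obtain a s :: 'a where x: "a \<in> cD" "s \<in> cD" "s \<notin> cJ" "x = res a / res s" by (rule resfrac_cases)
      obtain b where b: "b \<in> cD" "s * b = 1" using u x by blast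
      have "res s * res b = 1" using hom_onD(4)[OF h x(2) b(1)] b(2) hom_onD(2)[OF h] by simp
      then have "inverse (res s) = res b" by (rule inverse_unique)
      then have "x = res (a * b)" using x hom_onD(4)[OF h x(1) b(1)] by (simp add: divide_inverse)
      then show "x \<in> V" unfolding V_def using cDD(4)[OF x(1) b(1)] by simp
    qed
    then have "V = UNIV" by auto
    then show False using SL_field_poly[OF n, of A'] A' dA' not_E by (auto simp: mats_def)
  next
    assume "\<exists>c\<in>cD. c \<notin> cJ \<and> (\<forall>b\<in>cD. c * b \<noteq> 1) \<and> (\<forall>r\<in>cD. r \<notin> cJ \<longrightarrow> (\<exists>N. \<exists>q\<in>cD. c ^ N = q * r)) \<and>
         elem_mod n cD (radical cD c) A"
    then obtain c where c: "c \<in> cD" "c \<notin> cJ" "\<And>b. b \<in> cD \<Longrightarrow> c * b \<noteq> 1"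
      "\<And>r. r \<in> cD \<Longrightarrow> r \<notin> cJ \<Longrightarrow> \<exists>N. \<exists>q\<in>cD. c ^ N = q * r" "elem_mod n cD (radical cD c) A" by (elim bexE conjE) blast
    define Q where "Q = radical cD c"
    define P where "P = res ` Q"
    have Q: "ideal_in cD Q" unfolding Q_def by (rule vd.radical_ideal)
    have JQ: "cJ \<subseteq> Q" unfolding Q_def by (rule vd.subset_radical[OF chosen_prime(2) c(1,2)])
    \<comment> \<open>Since \<open>Q\<close> contains the kernel \<open>cJ\<close>, membership in
      \<open>Q\<close> can be read off from the residue.\<close>
    have PQ: "a \<in> Q" if "a \<in> cD" "res a \<in> P" for a
    proof -
      obtain y where y: "y \<in> Q" "res a = res y" using \<open>res a \<in> P\<close> by (auto simp: P_def)
      then have "a - y \<in> Q" using res_eq_iff[of a y] that ideal_inD(1)[OF Q] JQ by auto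
      then have "(a - y) + y \<in> Q" using y by (intro ideal_inD(3)[OF Q])
      then show ?thesis by simp
    qed
    interpret vp: valuation_prime V P
    proof
      show "is_subring V" by (rule V)
      show "ideal_in V P" unfolding V_def P_def by (rule ideal_in_image[OF h Q])
      fix x :: "'a resfrac"
      obtain a s where x: "a \<in> cD" "s \<in> cD" "s \<notin> cJ" "x = res a / res s" by (rule resfrac_cases)
      have s0: "res s \<noteq> 0" using x res_eq_0_iff by auto
      obtain q where q: "q \<in> cD" "a = q * s \<or> s = q * a" using val[OF x(1,2)] by auto
      have "x = res q \<or> inverse x = res q \<or> x = 0"
      proof (cases "a = q * s")
        case True
        then show ?thesis using x q s0 hom_onD(4)[OF h q(1) x(2)] by simp
      next
        case False
        then have "res s = res q * res a" using q hom_onD(4)[OF h q(1) x(1)] by simp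
        then show ?thesis using x s0 by (auto simp: inverse_eq_divide)
      qed
      then show "x \<in> V \<or> inverse x \<in> V" using q is_subringD(1)[OF V] by (auto simp: V_def)
    next
      show "1 \<notin> P"
      proof
        assume "1 \<in> P"
        then have "1 \<in> Q" using PQ[of 1] hom_onD(2)[OF h] cDD by simp
        then obtain N q where "q \<in> cD" "1 ^ N = q * c" by (auto simp: Q_def radical_def)
        then show False using c(3)[of q] by (simp add: mult.commute)
      qed
      fix a b assume ab: "a \<in> V" "b \<in> V" "a * b \<in> P"
      obtain a' b' where a': "a' \<in> cD" "b' \<in> cD" "a = res a'" "b = res b'" using ab by (auto simp: V_def)
      then have "a' * b' \<in> Q" using PQ[of "a' * b'"] ab(3) hom_onD(4)[OF h a'(1,2)] cDD(4)[OF a'(1,2)] by simp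
      then show "a \<in> P \<or> b \<in> P" using vd.radical_prime[OF a'(1,2)] a' by (auto simp: P_def Q_def)
    next
      fix t r assume t: "t \<in> P" and r: "r \<noteq> (0 :: 'a resfrac)"
      obtain y N q where y: "t = res y" "y \<in> cD" "q \<in> cD" "y ^ N = q * c" using t by (auto simp: P_def Q_def radical_def)
      obtain a s where x: "a \<in> cD" "s \<in> cD" "s \<notin> cJ" "r = res a / res s" by (rule resfrac_cases)
      have a0: "res a \<noteq> 0" and s0: "res s \<noteq> 0" using r x res_eq_0_iff[OF x(2)] by auto
      then have "a \<notin> cJ" using res_eq_0_iff[OF x(1)] by auto
      then obtain k q' where q': "q' \<in> cD" "c ^ k = q' * a" using c(4)[OF x(1)] by auto
      define z where "z = q ^ k * q'"
      have z: "z \<in> cD" unfolding z_def using y q' by (intro cDD subring_power chosen_prime)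
      \<comment> \<open>Rank one in two stages: a power of \<open>y\<close> is a multiple of
        \<open>c\<close>, and a power of \<open>c\<close> is a multiple of the numerator
        \<open>a\<close> of \<open>r\<close>.\<close>
      have "y ^ (N * k) = z * a" using y q' by (simp add: power_mult power_mult_distrib z_def mult.assoc)
      then have "t ^ (N * k) = res z * res a"
        using hom_on_power[OF h y(2), of "N * k"] hom_onD(4)[OF h z x(1)] y by simp
      then have "t ^ (N * k) / r = res (z * s)" using a0 s0 x hom_onD(4)[OF h z x(2)] by simp
      then show "\<exists>N. t ^ N / r \<in> V" unfolding V_def using cDD(4)[OF z x(2)] by blast
    next
      have "c ^ 1 = 1 * c" by simp
      then have "c \<in> Q" unfolding Q_def by (rule vd.radicalI[OF c(1) cDD(2)])
      then show "\<exists>c\<in>P. c \<noteq> 0" using res_eq_0_iff[OF c(1)] c(2) by (auto simp: P_def)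
    qed
    obtain B where B: "B \<in> Eg n (polys cD)" "cong_mat n (polys Q) A B"
      using c(5) unfolding elem_mod_def Q_def by auto
    have Bm: "B \<in> mats n (polys cD)" using Eg_mats[OF is_subring_polys[OF chosen_prime(1)] B(1)] .
    define B' where "B' = map_mat (map_poly res) B"
    have B': "B' \<in> Eg n (polys V)" unfolding B'_def by (rule Eg_hom[OF hx V_sub B(1)])
    have cong: "cong_mat n (polys P) A' B'" unfolding cong_mat_def
    proof (intro allI impI)
      fix i j assume ij: "i < n" "j < n"
      have "map_poly res (A $$ (i,j) - B $$ (i,j)) \<in> polys P"
        unfolding P_def using B(2) ij by (intro map_poly_polys[OF h]) (auto simp: cong_mat_def)
      then show "A' $$ (i,j) - B' $$ (i,j) \<in> polys P"
        using ij A(1) Bm hom_onD(7)[OF hx, of "A $$ (i,j)" "B $$ (i,j)"] by (auto simp: A'_def B'_def mats_def)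
    qed
    \<comment> \<open>Dividing \<open>A'\<close> by the elementary matrix to which it is congruent
      modulo \<open>P\<close> leaves a matrix congruent to 1.\<close>
    obtain N where N: "N \<in> Eg n (polys V)" "N * B' = 1\<^sub>m n" using Eg_inverse[OF Vx B'] by metis
    have Nm: "N \<in> mats n (polys V)" and B'm: "B' \<in> mats n (polys V)" using Eg_mats[OF Vx] N B' by auto
    have "cong_mat n (polys P) N N" using ideal_inD(2)[OF vp.Px] by (auto simp: cong_mat_def)
    then have "cong_mat n (polys P) (N * A') (1\<^sub>m n)"
      using cong_mat_mult[OF Vx vp.Px Nm A' Nm B'm _ cong] N(2) by simp
    moreover have "det (N * A') = 1"
      using det_mult[of N n A'] Nm A' dA' Eg_det[OF N(1)] by (simp add: mats_def)
    ultimately have "N * A' \<in> Eg n (polys V)"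
      using mats_mult[OF Vx Nm A'] n by (intro vp.Eg_if_cong_one)
    then show False using not_E Eg_cancel_left[OF Vx N(1)] A' by (auto simp: mats_def)
  qed
qed

section \<open>Valuation rings of finite rank\<close>

definition is_subfield :: "'k::field set \<Rightarrow> bool" where
  "is_subfield F \<longleftrightarrow> is_subring F \<and> (\<forall>x\<in>F. inverse x \<in> F)"

lemma is_subfieldD:
  assumes "is_subfield F"
  shows "is_subring F" "0 \<in> F" "1 \<in> F" "a \<in> F \<Longrightarrow> b \<in> F \<Longrightarrow> a + b \<in> F" "a \<in> F \<Longrightarrow> b \<in> F \<Longrightarrow> a * b \<in> F"
    "a \<in> F \<Longrightarrow> - a \<in> F" "a \<in> F \<Longrightarrow> b \<in> F \<Longrightarrow> a - b \<in> F" "a \<in> F \<Longrightarrow> inverse a \<in> F" "a \<in> F \<Longrightarrow> b \<in> F \<Longrightarrow> a / b \<in> F"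
  using assms unfolding is_subfield_def by (auto simp: is_subringD divide_inverse)

text \<open>Gaussian elimination on the last coordinate with a pivot vector \<open>p\<close>; all
  divisions stay in \<open>F\<close>, so the dependence has coefficients in
  \<open>F\<close>.\<close>

lemma linear_dependence:
  fixes v :: "'i \<Rightarrow> nat \<Rightarrow> 'k::field"
  assumes F: "is_subfield F" and "finite I" "card I > M" "\<And>i k. i \<in> I \<Longrightarrow> k < M \<Longrightarrow> v i k \<in> F"
  obtains f where "\<And>i. i \<in> I \<Longrightarrow> f i \<in> F" "\<exists>i\<in>I. f i \<noteq> 0" "\<And>k. k < M \<Longrightarrow> (\<Sum>i\<in>I. f i * v i k) = 0"
proof -
  have "\<exists>f. (\<forall>i\<in>I. f i \<in> F) \<and> (\<exists>i\<in>I. f i \<noteq> 0) \<and> (\<forall>k<M. (\<Sum>i\<in>I. f i * v i k) = 0)"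
    using assms(2-)
  proof (induction M arbitrary: I v)
    case 0
    then show ?case using is_subfieldD(3)[OF F] by (intro exI[of _ "\<lambda>_. 1"]) (auto simp: card_gt_0_iff)
  next
    case (Suc M)
    show ?case
    proof (cases "\<forall>i\<in>I. v i M = 0")
      case True
      have "card I > M" "\<And>i k. i \<in> I \<Longrightarrow> k < M \<Longrightarrow> v i k \<in> F" using Suc.prems(2,3) by auto
      then obtain f where f: "\<forall>i\<in>I. f i \<in> F" "\<exists>i\<in>I. f i \<noteq> 0" "\<forall>k<M. (\<Sum>i\<in>I. f i * v i k) = 0"
        using Suc.IH[of I v, OF Suc.prems(1)] by blast
      have "(\<Sum>i\<in>I. f i * v i M) = 0" using True by simp
      then have "\<forall>k<Suc M. (\<Sum>i\<in>I. f i * v i k) = 0" using f(3) by (auto elim: less_SucE)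
      then show ?thesis using f(1,2) by (intro exI[of _ f] conjI)
    next
      case False
      then obtain p where p: "p \<in> I" "v p M \<noteq> 0" by auto
      define I' where "I' = I - {p}"
      define r where "r i = v i M / v p M" for i
      have rF: "r i \<in> F" if "i \<in> I" for i unfolding r_def using that p Suc.prems by (intro is_subfieldD(9)[OF F]) auto
      define v' where "v' i k = v i k - r i * v p k" for i k
      have I': "finite I'" "card I' > M" using Suc.prems p by (auto simp: I'_def)
      have vF: "v' i k \<in> F" if "i \<in> I'" "k < M" for i k
        unfolding v'_def using that p Suc.prems rF I'_def by (intro is_subfieldD(5,7)[OF F]) auto
      obtain f where f: "\<forall>i\<in>I'. f i \<in> F" "\<exists>i\<in>I'. f i \<noteq> 0" "\<forall>k<M. (\<Sum>i\<in>I'. f i * v' i k) = 0"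
        using Suc.IH[of I' v', OF I' vF] by blast
      define g where "g i = (if i = p then - (\<Sum>j\<in>I'. f j * r j) else f i)" for i
      have sum: "(\<Sum>i\<in>I. g i * v i k) = (\<Sum>i\<in>I'. f i * v' i k)" for k
      proof -
        have "(\<Sum>i\<in>I. g i * v i k) = g p * v p k + (\<Sum>i\<in>I'. g i * v i k)"
          using Suc.prems p by (simp add: I'_def sum.remove)
        also have "(\<Sum>i\<in>I'. g i * v i k) = (\<Sum>i\<in>I'. f i * v i k)"
          by (intro sum.cong) (auto simp: g_def I'_def)
        also have "g p * v p k = - (\<Sum>i\<in>I'. f i * r i * v p k)" by (simp add: g_def sum_distrib_right)
        finally show ?thesis by (simp add: v'_def right_diff_distrib sum_subtractf mult.assoc)
      qed
      have gk: "(\<Sum>i\<in>I. g i * v i k) = 0" if "k < Suc M" for k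
      proof (cases "k = M")
        case True
        then show ?thesis unfolding sum using p by (simp add: v'_def r_def)
      next
        case False
        then show ?thesis using f(3) that sum[of k] by simp
      qed
      have "(\<Sum>j\<in>I'. f j * r j) \<in> F"
        using f(1) rF I'_def by (intro subring_sum is_subfieldD(1,5)[OF F]) auto
      then have gF: "\<forall>i\<in>I. g i \<in> F"
        using f(1) is_subfieldD(6)[OF F] by (auto simp: g_def I'_def)
      obtain i where "i \<in> I'" "f i \<noteq> 0" using f(2) by blast
      then have "i \<in> I" "g i \<noteq> 0" by (simp_all add: g_def I'_def)
      then show ?thesis using gk gF by (intro exI[of _ g] conjI) auto
    qed
  qed
  then show thesis using that by blast
qed

context valuation_subring
begin

definition nonunit :: "'k \<Rightarrow> bool" where "nonunit c \<longleftrightarrow> c \<in> V \<and> c \<noteq> 0 \<and> inverse c \<notin> V"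

text \<open>The rank of the valuation ring \<open>V \<inter> F\<close> is bounded below by means of sequences of elements, each of
  which is divisible by all powers of its predecessor, instead of chains of prime ideals.\<close>

definition deeper :: "'k \<Rightarrow> 'k \<Rightarrow> bool" where "deeper y z \<longleftrightarrow> (\<forall>N. z / y ^ N \<in> V)"

text \<open>For nonunits of \<open>V\<close> this means lying in the same prime ideals of
  \<open>V\<close>.\<close>

definition arch :: "'k \<Rightarrow> 'k \<Rightarrow> bool" where "arch y z \<longleftrightarrow> (\<exists>N. z ^ N / y \<in> V) \<and> (\<exists>N. y ^ N / z \<in> V)"

definition chain :: "'k set \<Rightarrow> 'k list \<Rightarrow> bool" where
  "chain F xs \<longleftrightarrow> sorted_wrt deeper xs \<and> (\<forall>x\<in>set xs. x \<in> F \<and> nonunit x)"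

definition rank_le :: "'k set \<Rightarrow> nat \<Rightarrow> bool" where
  "rank_le F k \<longleftrightarrow> (\<forall>xs. chain F xs \<longrightarrow> length xs \<le> k)"

lemma V_power: "a \<in> V \<Longrightarrow> a ^ n \<in> V" by (rule subring_power[OF V])

text \<open>Valuation rings are closed under taking roots: if \<open>x\<close> were outside,
  multiplying the power by powers of the inverse of \<open>x\<close>, which lies in
  \<open>V\<close>, would bring it back.\<close>

lemma V_root:
  assumes "x ^ m \<in> V" "m > 0"
  shows "x \<in> V"
proof (rule ccontr)
  assume n: "x \<notin> V"
  then have "inverse x \<in> V" "x \<noteq> 0" using val VD by auto
  then have "x ^ m * inverse x ^ (m - 1) \<in> V" using VD(4)[OF assms(1) V_power] by blast
  also have "x ^ m * inverse x ^ (m - 1) = x"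
    using assms \<open>x \<noteq> 0\<close> by (cases m) (auto simp: field_simps)
  finally show False using n by simp
qed

lemma deeper_trans:
  assumes "deeper x y" "deeper y z" "y \<noteq> 0"
  shows "deeper x z"
  unfolding deeper_def
proof
  fix N
  have "y / x ^ N * (z / y ^ 1) \<in> V" using assms unfolding deeper_def by (intro VD(4)) blast+
  then show "z / x ^ N \<in> V" using assms(3) by simp
qed

lemma deeper_if_not_power:
  assumes "\<And>N. y ^ N / z \<notin> V" "y \<noteq> 0"
  shows "deeper y z"
  unfolding deeper_def
proof
  fix N
  show "z / y ^ N \<in> V" using val_divide[of "y ^ N" z] assms by auto
qed

lemma nonunit_mult:
  assumes "nonunit a" "b \<in> V" "b \<noteq> 0"
  shows "nonunit (a * b)"
  unfolding nonunit_def
proof (intro conjI notI)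
  assume "inverse (a * b) \<in> V"
  then have "inverse (a * b) * b \<in> V" using assms VD by auto
  then show False using assms by (simp add: nonunit_def field_simps)
qed (use assms VD in \<open>auto simp: nonunit_def\<close>)

lemma nonunit_deeper:
  assumes "nonunit y" "deeper y z" "z \<noteq> 0"
  shows "nonunit z"
proof -
  have "z / y ^ 1 \<in> V" using assms unfolding deeper_def by blast
  then have "nonunit (y * (z / y))" using assms by (intro nonunit_mult) (auto simp: nonunit_def)
  then show ?thesis using assms by (simp add: nonunit_def)
qed

text \<open>Depth depends only on archimedean classes. Comparison through powers yields the claim
  for a power of the quotient, and \<open>V_root\<close> removes the power.\<close>

lemma deeper_arch:
  assumes nu: "nonunit c" "nonunit c'" "nonunit e" "nonunit e'"
    and "deeper c c'" "arch e c" "arch e' c'"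
  shows "deeper e e'"
  unfolding deeper_def
proof
  fix N
  have nz: "c \<noteq> 0" "c' \<noteq> 0" "e \<noteq> 0" "e' \<noteq> 0" using nu by (auto simp: nonunit_def)
  obtain m where m: "e' ^ m / c' \<in> V" using assms(7) by (auto simp: arch_def)
  obtain l where l: "c ^ l / e \<in> V" using assms(6) by (auto simp: arch_def)
  have m0: "m > 0" using m nu by (cases m) (auto simp: nonunit_def inverse_eq_divide)
  have d: "c' / c ^ (l * (N * m)) \<in> V" using assms(5) unfolding deeper_def by blast
  have "(e' ^ m / c') * (c' / c ^ (l * (N * m)) * (c ^ l / e) ^ (N * m)) \<in> V"
    by (rule VD(4)[OF m VD(4)[OF d V_power[OF l]]])
  also have "(e' ^ m / c') * (c' / c ^ (l * (N * m)) * (c ^ l / e) ^ (N * m)) = (e' / e ^ N) ^ m"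
    using nz by (simp add: power_divide power_mult)
  finally show "e' / e ^ N \<in> V" using V_root m0 by blast
qed

lemma nonunit_add:
  assumes "x \<noteq> 0 \<Longrightarrow> nonunit x" "y \<noteq> 0 \<Longrightarrow> nonunit y" "x + y \<noteq> 0"
  shows "nonunit (x + y)"
proof -
  have *: "nonunit (a + b)" if "nonunit b" "a / b \<in> V" "a + b \<noteq> 0" for a b
  proof -
    have "b * (1 + a / b) = a + b" using that by (simp add: nonunit_def field_simps)
    moreover have "1 + a / b \<in> V" using that VD by blast
    moreover have "1 + a / b \<noteq> 0" using calculation(1) that(3) by auto
    ultimately show ?thesis using nonunit_mult[of b "1 + a / b"] that by auto
  qed
  show ?thesis
    using *[of y x] *[of x y] val_divide[of x y] assms by (cases "x = 0"; cases "y = 0") (auto simp: add.commute)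
qed

lemma nonunit_sum:
  assumes "finite S" "\<And>i. i \<in> S \<Longrightarrow> x i \<noteq> 0 \<Longrightarrow> nonunit (x i)" "sum x S \<noteq> 0"
  shows "nonunit (sum x S)"
  using assms
proof (induction S rule: finite_induct)
  case (insert i S)
  then show ?case using nonunit_add[of "x i" "sum x S"] by auto
qed simp

text \<open>Divide by a term that divides all others. If no other term had the same value, the
  remaining quotients would be nonunits with sum -1, which is a unit.\<close>

lemma sum_zero_equal_value:
  assumes S: "finite S" "S \<noteq> {}" "\<And>i. i \<in> S \<Longrightarrow> x i \<noteq> 0" "sum x S = 0"
  shows "\<exists>i\<in>S. \<exists>j\<in>S. i \<noteq> j \<and> x i / x j \<in> V \<and> x j / x i \<in> V"
proof -
  have fin: "finite (x ` S)" and ne: "x ` S \<noteq> {}" and nz: "0 \<notin> x ` S" using S by auto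
  obtain m where m: "m \<in> x ` S" "\<And>y. y \<in> x ` S \<Longrightarrow> y / m \<in> V"
    using val_max[OF fin ne nz] by blast
  then obtain j where j: "j \<in> S" "\<And>i. i \<in> S \<Longrightarrow> x i / x j \<in> V" by auto
  show ?thesis
  proof (rule ccontr)
    assume n: "\<not> ?thesis"
    have nu: "nonunit (x i / x j)" if i: "i \<in> S - {j}" for i
    proof -
      have "x i / x j \<in> V" using i j by auto
      moreover from this have "x j / x i \<notin> V" using n i j(1) by blast
      moreover have "x i / x j \<noteq> 0" using S(3) i j(1) by auto
      ultimately show ?thesis by (simp add: nonunit_def)
    qed
    have "(\<Sum>i\<in>S - {j}. x i / x j) = (sum x S - x j) / x j"
      using S(1) j(1) by (simp add: sum_divide_distrib[symmetric] sum_diff1)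
    also have "\<dots> = - 1" using S(3,4) j(1) by simp
    finally have "(\<Sum>i\<in>S - {j}. x i / x j) = - 1" .
    then have "nonunit (- 1)" using nonunit_sum[of "S - {j}" "\<lambda>i. x i / x j"] nu S(1) by simp
    then show False using VD by (auto simp: nonunit_def)
  qed
qed

text \<open>The monomials \<open>c\<^sup>i c'\<^sup>j\<close> have distinct values modulo \<open>F\<close>.\<close>

lemma equal_value_arch:
  assumes nu: "nonunit c" "nonunit c'" and d: "deeper c c'"
    and F: "is_subfield F" "f \<in> F" "f' \<in> F" "f \<noteq> 0" "f' \<noteq> 0"
    and ij: "j > j' \<or> j = j' \<and> i > i'"
    and eq: "(f * c ^ i * c' ^ j) / (f' * c ^ i' * c' ^ j') \<in> V" "(f' * c ^ i' * c' ^ j') / (f * c ^ i * c' ^ j) \<in> V"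
  shows "\<exists>e\<in>F. nonunit e \<and> (arch e c \<or> arch e c')"
proof -
  have nz: "c \<noteq> 0" "c' \<noteq> 0" and cV: "c \<in> V" "c' \<in> V" using nu by (auto simp: nonunit_def)
  define E where "E = (c ^ i * c' ^ j) / (c ^ i' * c' ^ j')"
  have E0: "E \<noteq> 0" using nz by (simp add: E_def)
  \<comment> \<open>By \<open>eq\<close>, \<open>e\<close> and \<open>E\<close> differ by a unit of
    \<open>V\<close>. So the archimedean class of \<open>E\<close>, computed from exponents alone,
    is represented in \<open>F\<close>.\<close>
  define e where "e = f' / f"
  have eF: "e \<in> F" and e0: "e \<noteq> 0" unfolding e_def using F by (auto simp: is_subfieldD)
  have u: "E / e \<in> V" "e / E \<in> V" using eq F nz by (simp_all add: E_def e_def field_simps)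
  have dN: "c' / c ^ N \<in> V" for N using d unfolding deeper_def by blast
  have key: "nonunit E \<and> (arch E c \<or> arch E c')"
  proof (cases "j > j'")
    case True
    \<comment> \<open>The exponent \<open>i - i'\<close> may be negative, but every power of
      \<open>c\<close> divides \<open>c'\<close>. The exponents 2 and \<open>n + 2\<close> below
      leave a spare factor \<open>c'\<close> that absorbs the powers of \<open>c\<close>, so
      \<open>E\<close> is in the class of \<open>c'\<close>.\<close>
    define n where "n = j - j' - 1"
    have j: "j = j' + Suc n" using True by (simp add: n_def)
    have E: "E = c' ^ n * (c ^ i * (c' / c ^ i'))" using nz by (simp add: E_def j power_add)
    have E2: "E = c * (c' ^ n * (c ^ i * (c' / c ^ Suc i')))" using nz by (simp add: E)
    have "nonunit E" unfolding E2
    proof (rule nonunit_mult[OF nu(1)])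
      show "c' ^ n * (c ^ i * (c' / c ^ Suc i')) \<in> V" by (intro VD(4) V_power cV dN)
    qed (use nz in auto)
    moreover have "E ^ 2 / c' = (c' ^ n) ^ 2 * ((c ^ i) ^ 2 * (c' / c ^ (i' * 2)))"
      using nz by (simp add: E power_mult power2_eq_square field_simps)
    then have "E ^ 2 / c' \<in> V" by (simp only:) (intro VD(4) V_power cV dN)
    moreover have "c' ^ (n + 2) / E = c ^ i' * (c' / c ^ i)" using nz by (simp add: E field_simps power_add power2_eq_square)
    then have "c' ^ (n + 2) / E \<in> V" by (simp only:) (intro VD(4) V_power cV dN)
    ultimately show ?thesis unfolding arch_def by blast
  next
    case False
    define n where "n = i - i' - 1"
    have ij': "j = j'" "i = i' + Suc n" using False ij by (auto simp: n_def)
    have E: "E = c * c ^ n" using nz by (simp add: E_def ij' power_add)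
    have "nonunit E" unfolding E using nz by (intro nonunit_mult nu V_power cV) auto
    moreover have "E ^ 1 / c \<in> V" using nz V_power[OF cV(1)] by (simp add: E)
    moreover have "c ^ Suc n / E \<in> V" using nz VD by (simp add: E)
    ultimately show ?thesis unfolding arch_def by blast
  qed
  have nue: "nonunit e" using nonunit_mult[of E "e / E"] key u e0 E0 by simp
  have tr: "arch e y" if ar: "arch E y" for y
  proof -
    obtain N M where NM: "y ^ N / E \<in> V" "E ^ M / y \<in> V" using ar by (auto simp: arch_def)
    have "y ^ N / E * (E / e) \<in> V" "(e / E) ^ M * (E ^ M / y) \<in> V"
      using VD(4)[OF NM(1) u(1)] VD(4)[OF V_power[OF u(2)] NM(2)] by auto
    then have "y ^ N / e \<in> V" "e ^ M / y \<in> V" using E0 by (simp_all add: power_divide)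
    then show ?thesis unfolding arch_def by blast
  qed
  show ?thesis using nue tr key eF by blast
qed

end

text \<open>The field generated by \<open>a\<close> over \<open>F\<close>. Pairs with
  \<open>poly q a = 0\<close> contribute only 0, by the convention for division.\<close>

definition adjoin :: "'k::field set \<Rightarrow> 'k \<Rightarrow> 'k set" where
  "adjoin F a = {poly p a / poly q a | p q. p \<in> polys F \<and> q \<in> polys F}"

lemma adjoinE:
  assumes F: "is_subfield F" and x: "x \<in> adjoin F a"
  obtains p q where "p \<in> polys F" "q \<in> polys F" "poly q a \<noteq> 0" "x = poly p a / poly q a"
proof -
  note Fx = is_subringD[OF is_subring_polys[OF is_subfieldD(1)[OF F]]]
  obtain p q where pq: "p \<in> polys F" "q \<in> polys F" "x = poly p a / poly q a" using x unfolding adjoin_def by blast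
  show thesis
  proof (cases "poly q a = 0")
    case True
    then show thesis using that[of 0 1] pq Fx by simp
  next
    case False
    show thesis by (rule that[OF pq(1,2) False pq(3)])
  qed
qed

lemma adjoinI: "p \<in> polys F \<Longrightarrow> q \<in> polys F \<Longrightarrow> x = poly p a / poly q a \<Longrightarrow> x \<in> adjoin F a"
  unfolding adjoin_def by blast

lemma is_subfield_adjoin:
  assumes F: "is_subfield F"
  shows "is_subfield (adjoin F a)" "F \<subseteq> adjoin F a" "a \<in> adjoin F a"
proof -
  note Fx = is_subringD[OF is_subring_polys[OF is_subfieldD(1)[OF F]]]
  show sub: "F \<subseteq> adjoin F a"
  proof
    fix x assume "x \<in> F"
    then show "x \<in> adjoin F a"
      using Fx is_subfieldD[OF F] by (intro adjoinI[of "[:x:]" F 1]) (auto simp: polys_const)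
  qed
  show "a \<in> adjoin F a"
    using Fx is_subfieldD[OF F] by (intro adjoinI[of "[:0, 1:]" F 1]) (auto simp: polys_def coeff_pCons split: nat.splits)
  have ops: "x + y \<in> adjoin F a \<and> x * y \<in> adjoin F a \<and> - x \<in> adjoin F a \<and> inverse x \<in> adjoin F a"
    if xy: "x \<in> adjoin F a" "y \<in> adjoin F a" for x y
  proof -
    obtain p q where pq: "p \<in> polys F" "q \<in> polys F" "poly q a \<noteq> 0" "x = poly p a / poly q a"
      by (rule adjoinE[OF F xy(1)])
    obtain r s where rs: "r \<in> polys F" "s \<in> polys F" "poly s a \<noteq> 0" "y = poly r a / poly s a"
      by (rule adjoinE[OF F xy(2)])
    have "x + y = poly (p * s + r * q) a / poly (q * s) a"
      unfolding pq(4) rs(4) using pq(3) rs(3) by (simp add: field_simps)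
    moreover have "x * y = poly (p * r) a / poly (q * s) a" using pq rs by simp
    moreover have "- x = poly (- p) a / poly q a" "inverse x = poly q a / poly p a" using pq by simp_all
    moreover have "p * s + r * q \<in> polys F" "q * s \<in> polys F" "p * r \<in> polys F" "- p \<in> polys F"
      using Fx(4)[OF pq(1) rs(2)] Fx(4)[OF rs(1) pq(2)] Fx(3) Fx(4)[OF pq(2) rs(2)] Fx(4)[OF pq(1) rs(1)] Fx(5)[OF pq(1)] by auto
    ultimately show ?thesis using pq(1,2) adjoinI[of _ F _ _ a] by blast
  qed
  have "0 \<in> adjoin F a" "1 \<in> adjoin F a" using sub is_subfieldD[OF F] by auto
  then show "is_subfield (adjoin F a)" unfolding is_subfield_def is_subring_def using ops by blast
qed

text \<open>In positive characteristic, denominators that vanish contribute only 0, so one formula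
  serves all characteristics.\<close>

definition prime_field :: "'k::field set" where
  "prime_field = {of_int i / of_int j | i j. True}"

lemma prime_fieldE:
  fixes x :: "'k::field"
  assumes "x \<in> prime_field"
  obtains i j where "of_int j \<noteq> (0 :: 'k)" "x = of_int i / of_int j"
proof -
  obtain i j where ij: "x = of_int i / of_int j" using assms unfolding prime_field_def by blast
  show thesis
  proof (cases "of_int j = (0 :: 'k)")
    case True
    then have "x = of_int 0 / of_int 1" using ij by simp
    then show thesis by (intro that[where i = 0 and j = 1]) simp_all
  next
    case False
    then show thesis using ij by (rule that)
  qed
qed

lemma is_subfield_prime_field: "is_subfield (prime_field :: 'k::field set)"
proof -
  have I: "of_int i / of_int j \<in> prime_field" for i j unfolding prime_field_def by blast
  have ops: "x + y \<in> prime_field \<and> x * y \<in> prime_field \<and> - x \<in> prime_field \<and> inverse x \<in> prime_field"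
    if xy: "x \<in> prime_field" "y \<in> prime_field" for x y :: 'k
  proof -
    obtain i j where ij: "of_int j \<noteq> (0 :: 'k)" "x = of_int i / of_int j" by (rule prime_fieldE[OF xy(1)])
    obtain k l where kl: "of_int l \<noteq> (0 :: 'k)" "y = of_int k / of_int l" by (rule prime_fieldE[OF xy(2)])
    have "x + y = of_int (i * l + k * j) / of_int (j * l)"
      unfolding ij(2) kl(2) using ij(1) kl(1) by (simp add: field_simps)
    moreover have "x * y = of_int (i * k) / of_int (j * l)" using ij kl by simp
    moreover have "- x = of_int (- i) / of_int j" "inverse x = of_int j / of_int i" using ij by simp_all
    ultimately show ?thesis using I by metis
  qed
  have "0 \<in> prime_field" "1 \<in> prime_field" using I[of 0 1] I[of 1 1] by simp_all
  then show ?thesis unfolding is_subfield_def is_subring_def using ops by blast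
qed

context valuation_subring
begin

text \<open>A case of Abhyankar's inequality: adjoining one element raises the rank by at most one.
  Rational functions of a single \<open>a\<close> make many monomials in \<open>c\<close> and
  \<open>c'\<close> linearly dependent over \<open>F\<close>; in a vanishing combination two terms
  have equal value, which places \<open>c\<close> or \<open>c'\<close> in the class of an element of
  \<open>F\<close>.\<close>

lemma adjoin_arch:
  assumes F: "is_subfield F" and c: "c \<in> adjoin F a" "c' \<in> adjoin F a" "nonunit c" "nonunit c'" "deeper c c'"
  shows "\<exists>e\<in>F. nonunit e \<and> (arch e c \<or> arch e c')"
proof -
  note Fx = is_subringD[OF is_subring_polys[OF is_subfieldD(1)[OF F]]]
  have nz: "c \<noteq> 0" "c' \<noteq> 0" using c by (auto simp: nonunit_def)
  obtain p1 q1 where 1: "p1 \<in> polys F" "q1 \<in> polys F" "poly q1 a \<noteq> 0" "c = poly p1 a / poly q1 a"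
    by (rule adjoinE[OF F c(1)])
  obtain p2 q2 where 2: "p2 \<in> polys F" "q2 \<in> polys F" "poly q2 a \<noteq> 0" "c' = poly p2 a / poly q2 a"
    by (rule adjoinE[OF F c(2)])
  define Y Z Q where "Y = p1 * q2" and "Z = p2 * q1" and "Q = q1 * q2"
  have YZ: "Y \<in> polys F" "Z \<in> polys F" "Q \<in> polys F" "poly Q a \<noteq> 0"
    using 1 2 Fx(4) by (auto simp: Y_def Z_def Q_def)
  have cc: "c = poly Y a / poly Q a" "c' = poly Z a / poly Q a" using 1 2 by (auto simp: Y_def Z_def Q_def)
  \<comment> \<open>The counting: with \<open>L = 2 * d\<close>, the homogenized monomials have
    degree at most \<open>2 * L * d\<close>, that is, \<open>M\<close> coefficients with
    \<open>M = 4 * d ^ 2 + 1\<close>, while there are \<open>(2 * d + 1) ^ 2\<close> of them. The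
    successor makes \<open>d\<close> positive, so there are more monomials than
    coefficients.\<close>
  define d where "d = Suc (degree Y + degree Z + degree Q)"
  define L where "L = 2 * d"
  define I where "I = {..L} \<times> {..L}"
  \<comment> \<open>The polynomial that becomes the monomial in \<open>c\<close> and
    \<open>c'\<close> after evaluation at \<open>a\<close> and division by the fixed power
    \<open>2 * L\<close> of the common denominator.\<close>
  define mon where "mon ij = Y ^ fst ij * Z ^ snd ij * Q ^ (2 * L - fst ij - snd ij)" for ij :: "nat \<times> nat"
  define M where "M = 2 * L * d + 1"
  have deg: "degree (mon ij) < M" if I: "ij \<in> I" for ij
  proof -
    obtain i j where ij: "ij = (i, j)" "i \<le> L" "j \<le> L" using I by (auto simp: I_def)
    have "degree (mon ij) \<le> degree (Y ^ i) + degree (Z ^ j) + degree (Q ^ (2 * L - i - j))"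
      unfolding mon_def ij fst_conv snd_conv
      using degree_mult_le[of "Y ^ i" "Z ^ j"] degree_mult_le[of "Y ^ i * Z ^ j" "Q ^ (2 * L - i - j)"] by linarith
    also have "\<dots> \<le> d * i + d * j + d * (2 * L - i - j)"
      using degree_power_le[of Y i] degree_power_le[of Z j] degree_power_le[of Q "2 * L - i - j"]
        mult_le_mono1[of "degree Y" d i] mult_le_mono1[of "degree Z" d j] mult_le_mono1[of "degree Q" d "2 * L - i - j"]
      by (simp add: d_def)
    also have "\<dots> = d * (i + j + (2 * L - i - j))" by (simp add: distrib_left)
    also have "i + j + (2 * L - i - j) = 2 * L" using ij by simp
    finally show ?thesis by (simp add: M_def mult.commute)
  qed
  have "card I = (L + 1) * (L + 1)" by (simp add: I_def card_cartesian_product)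
  then have card: "card I > M" by (simp add: M_def L_def algebra_simps d_def)
  have fin: "finite I" by (simp add: I_def)
  have vF: "coeff (mon ij) k \<in> F" for ij k
    unfolding mon_def using YZ by (intro polysD Fx(4) subring_power is_subring_polys is_subfieldD(1)[OF F])
  obtain f where f: "\<And>ij. ij \<in> I \<Longrightarrow> f ij \<in> F" "\<exists>ij\<in>I. f ij \<noteq> 0" "\<And>k. k < M \<Longrightarrow> (\<Sum>ij\<in>I. f ij * coeff (mon ij) k) = 0"
    by (rule linear_dependence[OF F fin card, of "\<lambda>ij k. coeff (mon ij) k"]) (use vF in blast)+
  have "(\<Sum>ij\<in>I. smult (f ij) (mon ij)) = 0"
  proof (rule poly_eqI)
    fix k
    show "coeff (\<Sum>ij\<in>I. smult (f ij) (mon ij)) k = coeff 0 k"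
    proof (cases "k < M")
      case True
      then show ?thesis using f(3) by (simp add: coeff_sum)
    next
      case False
      then have "coeff (mon ij) k = 0" if "ij \<in> I" for ij using deg[OF that] by (intro coeff_eq_0) simp
      then show ?thesis by (simp add: coeff_sum)
    qed
  qed
  then have "poly (\<Sum>ij\<in>I. smult (f ij) (mon ij)) a = 0" by simp
  then have "(\<Sum>ij\<in>I. f ij * poly (mon ij) a) = 0" by (simp add: poly_sum)
  then have "(\<Sum>ij\<in>I. f ij * poly (mon ij) a) / poly Q a ^ (2 * L) = 0" by simp
  then have "(\<Sum>ij\<in>I. f ij * poly (mon ij) a / poly Q a ^ (2 * L)) = 0" by (simp only: sum_divide_distrib)
  also have "(\<Sum>ij\<in>I. f ij * poly (mon ij) a / poly Q a ^ (2 * L)) = (\<Sum>ij\<in>I. f ij * c ^ fst ij * c' ^ snd ij)"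
  proof (rule sum.cong)
    fix ij assume "ij \<in> I"
    then have le: "fst ij + snd ij \<le> 2 * L" by (auto simp: I_def)
    then have "poly Q a ^ (2 * L) = poly Q a ^ fst ij * poly Q a ^ snd ij * poly Q a ^ (2 * L - fst ij - snd ij)"
      by (simp flip: power_add)
    then show "f ij * poly (mon ij) a / poly Q a ^ (2 * L) = f ij * c ^ fst ij * c' ^ snd ij"
      using YZ(4) by (simp add: mon_def cc power_divide)
  qed simp
  finally have sum0: "(\<Sum>ij\<in>I. f ij * c ^ fst ij * c' ^ snd ij) = 0" .
  define S where "S = {ij \<in> I. f ij \<noteq> 0}"
  define x where "x ij = f ij * c ^ fst ij * c' ^ snd ij" for ij
  have "sum x S = sum x I" unfolding S_def using fin by (intro sum.mono_neutral_left) (auto simp: x_def)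
  then have "sum x S = 0" using sum0 by (simp add: x_def)
  moreover have "finite S" "S \<noteq> {}" "\<And>ij. ij \<in> S \<Longrightarrow> x ij \<noteq> 0" using fin f(2) nz by (auto simp: S_def x_def)
  ultimately have "\<exists>ij\<in>S. \<exists>kl\<in>S. ij \<noteq> kl \<and> x ij / x kl \<in> V \<and> x kl / x ij \<in> V"
    by (intro sum_zero_equal_value)
  then obtain ij kl where e: "ij \<in> S" "kl \<in> S" "ij \<noteq> kl" "x ij / x kl \<in> V" "x kl / x ij \<in> V" by blast
  have fF: "f ij \<in> F" "f kl \<in> F" "f ij \<noteq> 0" "f kl \<noteq> 0" using e f(1) by (auto simp: S_def)
  have "(snd ij > snd kl \<or> snd ij = snd kl \<and> fst ij > fst kl) \<or> (snd kl > snd ij \<or> snd kl = snd ij \<and> fst kl > fst ij)"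
    using e(3) by (auto simp: prod_eq_iff)
  then show ?thesis
  proof
    assume "snd ij > snd kl \<or> snd ij = snd kl \<and> fst ij > fst kl"
    then show ?thesis
      by (rule equal_value_arch[OF c(3,4,5) F fF(1,2,3,4) _ e(4)[unfolded x_def] e(5)[unfolded x_def]])
  next
    assume "snd kl > snd ij \<or> snd kl = snd ij \<and> fst kl > fst ij"
    then show ?thesis
      by (rule equal_value_arch[OF c(3,4,5) F fF(2,1,4,3) _ e(5)[unfolded x_def] e(4)[unfolded x_def]])
  qed
qed

text \<open>Elements of a chain that share their class with an element of \<open>F\<close> are
  replaced by it, which keeps a chain. By \<open>adjoin_arch\<close>, two elements without such a
  partner cannot both occur, so at most one is lost.\<close>

lemma rank_le_adjoin:
  assumes F: "is_subfield F" and rk: "rank_le F k"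
  shows "rank_le (adjoin F a) (Suc k)"
  unfolding rank_le_def
proof (intro allI impI)
  fix xs assume ch: "chain (adjoin F a) xs"
  define good where "good x \<longleftrightarrow> (\<exists>e\<in>F. nonunit e \<and> arch e x)" for x
  define g where "g x = (SOME e. e \<in> F \<and> nonunit e \<and> arch e x)" for x
  have g: "g x \<in> F \<and> nonunit (g x) \<and> arch (g x) x" if "good x" for x
    using someI_ex[of "\<lambda>e. e \<in> F \<and> nonunit e \<and> arch e x"] that unfolding good_def g_def by blast
  have xs: "sorted_wrt deeper xs" "\<And>x. x \<in> set xs \<Longrightarrow> x \<in> adjoin F a \<and> nonunit x"
    using ch by (auto simp: chain_def)
  have "sorted_wrt (\<lambda>x y. deeper (g x) (g y)) (filter good xs)"
  proof (rule sorted_wrt_mono_rel)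
    show "sorted_wrt deeper (filter good xs)" using xs(1) by (rule sorted_wrt_filter)
    fix x y assume xy: "x \<in> set (filter good xs)" "y \<in> set (filter good xs)" "deeper x y"
    have "nonunit x" "nonunit y" using xy xs(2) by auto
    moreover have "nonunit (g x)" "arch (g x) x" "nonunit (g y)" "arch (g y) y" using xy g by auto
    ultimately show "deeper (g x) (g y)" using xy(3) deeper_arch by blast
  qed
  then have "chain F (map g (filter good xs))" using g by (auto simp: chain_def sorted_wrt_map)
  then have l1: "length (filter good xs) \<le> k" using rk unfolding rank_le_def by (metis length_map)
  have l2: "length (filter (\<lambda>x. \<not> good x) xs) \<le> 1"
  proof (rule ccontr)
    assume n: "\<not> ?thesis"
    define ys where "ys = filter (\<lambda>x. \<not> good x) xs"
    obtain x y zs where "ys = x # y # zs"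
      using n unfolding ys_def[symmetric] by (cases ys rule: remdups_adj.cases) auto
    then have z: "filter (\<lambda>x. \<not> good x) xs = x # y # zs" by (simp add: ys_def)
    have "sorted_wrt deeper (x # y # zs)" using sorted_wrt_filter[OF xs(1), of "\<lambda>x. \<not> good x"] z by simp
    then have d: "deeper x y" by simp
    have "x \<in> set (filter (\<lambda>x. \<not> good x) xs)" "y \<in> set (filter (\<lambda>x. \<not> good x) xs)" unfolding z by auto
    then have xy: "x \<in> set xs" "\<not> good x" "y \<in> set xs" "\<not> good y" by auto
    then have "\<exists>e\<in>F. nonunit e \<and> (arch e x \<or> arch e y)"
      using xs(2) d by (intro adjoin_arch[OF F, of x a y]) auto
    then show False using xy by (auto simp: good_def)
  qed
  show "length xs \<le> Suc k" using sum_length_filter_compl[of good xs] l1 l2 by linarith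
qed

lemma of_int_V: "of_int i \<in> V"
proof (induction i rule: int_induct[of _ 0])
  case (step1 i)
  then show ?case using VD(3)[of "of_int i" 1] VD(2) by simp
next
  case (step2 i)
  then show ?case using VD(6)[of "of_int i" 1] VD(2) by simp
qed (use VD in simp)

text \<open>In lowest terms, a Bezout identity for \<open>i\<close> and \<open>j\<close> divided by
  \<open>j\<close> writes the inverse of \<open>j\<close> as an integral combination of
  \<open>c\<close> and 1.\<close>

lemma prime_field_unit_fraction:
  assumes "c \<in> prime_field" "c \<in> V" "c \<noteq> 0"
  obtains i j where "c = of_int i / of_int j" "of_int j \<noteq> (0 :: 'k)" "inverse (of_int j) \<in> V"
proof -
  obtain a b where ab: "of_int b \<noteq> (0 :: 'k)" "c = of_int a / of_int b" by (rule prime_fieldE[OF assms(1)])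
  define h where "h = gcd a b"
  have h0: "h \<noteq> 0" using ab(1) by (auto simp: h_def)
  obtain i j where ij: "a = h * i" "b = h * j" "coprime i j"
    using gcd_coprime_exists[of a b] h0 unfolding h_def mult.commute[of "gcd a b"] by blast
  have nz: "of_int h \<noteq> (0 :: 'k)" "of_int j \<noteq> (0 :: 'k)" using ab(1) ij(2) by auto
  have cij: "c = of_int i / of_int j" using ab ij nz by simp
  obtain u v where "u * i + v * j = gcd i j" using bezout_int[of i j] by blast
  then have "u * i + v * j = 1" using ij(3) by simp
  then have "of_int (u * i + v * j) = (1 :: 'k)" by simp
  then have "of_int u * of_int i + of_int v * of_int j = (1 :: 'k)" by simp
  then have "of_int j * (of_int u * c + of_int v) = (1 :: 'k)" using nz by (simp add: cij algebra_simps)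
  then have "inverse (of_int j) = of_int u * c + of_int v" by (rule inverse_unique)
  also have "\<dots> \<in> V" using assms(2) by (intro VD(3,4) of_int_V)
  finally have "inverse (of_int j) \<in> V" .
  then show thesis by (rule that[OF cij nz(2)])
qed

text \<open>Elementary substitute for the classification of valuation rings of the prime field. In a
  chain of two elements, the numerator \<open>k\<close> would be divisible in \<open>V\<close> by
  all powers of the nonunit \<open>i\<close>, which the finitely many integer divisors of
  \<open>k\<close> forbid.\<close>

lemma rank_le_prime_field: "rank_le prime_field 1"
  unfolding rank_le_def
proof (intro allI impI, rule ccontr)
  fix xs assume ch: "chain prime_field xs" and n: "\<not> length xs \<le> 1"
  then obtain c c' zs where z: "xs = c # c' # zs"
    by (cases xs rule: remdups_adj.cases) auto
  then have c: "c \<in> prime_field" "nonunit c" "c' \<in> prime_field" "nonunit c'" "deeper c c'"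
    using ch by (auto simp: chain_def)
  obtain i j where ij: "c = of_int i / of_int j" "of_int j \<noteq> (0 :: 'k)" "inverse (of_int j) \<in> V"
    by (rule prime_field_unit_fraction[of c]) (use c in \<open>auto simp: nonunit_def\<close>)
  obtain k l where kl: "c' = of_int k / of_int l" "of_int l \<noteq> (0 :: 'k)" "inverse (of_int l) \<in> V"
    by (rule prime_field_unit_fraction[of c']) (use c in \<open>auto simp: nonunit_def\<close>)
  have nz: "of_int i \<noteq> (0 :: 'k)" "of_int k \<noteq> (0 :: 'k)" using c ij kl by (auto simp: nonunit_def)
  have inu: "inverse (of_int i) \<notin> V"
  proof
    assume "inverse (of_int i) \<in> V"
    then have "of_int j * inverse (of_int i) \<in> V" by (intro VD(4) of_int_V)
    moreover have "of_int j * inverse (of_int i) = inverse c" unfolding ij(1) by (simp add: divide_inverse mult.commute)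
    ultimately show False using c by (simp add: nonunit_def)
  qed
  have kN: "of_int k / of_int i ^ N \<in> V" for N
  proof -
    have d: "c' / c ^ N \<in> V" using c(5) by (simp add: deeper_def)
    have "(c' / c ^ N) * (of_int l * inverse (of_int j) ^ N) \<in> V"
      by (rule VD(4)[OF d VD(4)[OF of_int_V V_power[OF ij(3)]]])
    also have "(c' / c ^ N) * (of_int l * inverse (of_int j) ^ N) = of_int k / of_int i ^ N"
      unfolding ij(1) kl(1) using ij(2) kl(2) nz by (simp add: field_simps power_divide)
    finally show ?thesis .
  qed
  have k0: "k \<noteq> 0" using nz by auto
  \<comment> \<open>The gcds take finitely many values, so two powers of \<open>i\<close> have the
    same gcd with \<open>k\<close>.\<close>
  define g where "g N = gcd (i ^ N) k" for N
  have "g N dvd k" for N by (simp add: g_def)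
  then have "range g \<subseteq> {d. d dvd k}" by auto
  moreover have "finite {d. d dvd k}" using k0 by (rule finite_divisors_int)
  ultimately have "finite (range g)" by (rule finite_subset)
  then have "\<not> inj g" using finite_imageD[of g UNIV] infinite_UNIV_nat by auto
  then obtain N' M' where NM': "g N' = g M'" "N' \<noteq> M'" by (auto simp: inj_def)
  define N M where "N = min N' M'" and "M = max N' M'"
  have NM: "g N = g M" "N < M" using NM' by (auto simp: N_def M_def min_def max_def)
  \<comment> \<open>The cofactor \<open>s\<close> of the gcd in \<open>i ^ N\<close> is coprime to
    the cofactor \<open>t\<close> in \<open>k\<close>, and it divides \<open>t\<close> in
    \<open>V\<close>; by Bezout it is a unit. So two powers of \<open>i\<close> with equal gcd
    differ by a unit.\<close>
  have unit: "\<exists>s. of_int i ^ N = of_int (g N) * (s :: 'k) \<and> s \<in> V \<and> inverse s \<in> V \<and> s \<noteq> 0" for N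
  proof -
    have g0: "g N \<noteq> 0" using k0 by (simp add: g_def)
    obtain s t where st: "i ^ N = g N * s" "k = g N * t" "coprime s t"
      using gcd_coprime_exists[of "i ^ N" k] g0 unfolding g_def mult.commute[of "gcd (i ^ N) k"] by blast
    obtain u v where "u * s + v * t = gcd s t" using bezout_int[of s t] by blast
    then have "u * s + v * t = 1" using st(3) by simp
    then have "of_int (u * s + v * t) = (1 :: 'k)" by simp
    then have 1: "of_int u * of_int s + of_int v * of_int t = (1 :: 'k)" by simp
    have i': "(of_int i :: 'k) ^ N = of_int (g N) * of_int s"
      using arg_cong[OF st(1), of "of_int :: int \<Rightarrow> 'k"] by simp
    have k': "(of_int k :: 'k) = of_int (g N) * of_int t"
      using arg_cong[OF st(2), of "of_int :: int \<Rightarrow> 'k"] by simp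
    have nz': "of_int (g N) \<noteq> (0 :: 'k)" "of_int s \<noteq> (0 :: 'k)" using nz i' k' by auto
    have "of_int t / of_int s = of_int k / (of_int i :: 'k) ^ N" unfolding i' k' using nz' by simp
    then have w: "of_int t / of_int s \<in> V" using kN by simp
    have "of_int s * (of_int u + of_int v * (of_int t / of_int s)) = (1 :: 'k)" using 1 nz' by (simp add: algebra_simps)
    then have "inverse (of_int s) = of_int u + of_int v * (of_int t / of_int s :: 'k)" by (rule inverse_unique)
    also have "\<dots> \<in> V" using w by (intro VD(3,4) of_int_V)
    finally have "inverse (of_int s) \<in> V" .
    then show ?thesis using i' nz'(2) of_int_V[of s] by (intro exI[of _ "of_int s"] conjI)
  qed
  obtain s where s: "of_int i ^ N = of_int (g N) * (s :: 'k)" "s \<in> V" "inverse s \<in> V" "s \<noteq> 0" using unit by blast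
  obtain t where t: "of_int i ^ M = of_int (g M) * (t :: 'k)" "t \<in> V" "inverse t \<in> V" "t \<noteq> 0" using unit by blast
  have "(of_int i :: 'k) ^ M = of_int i ^ N * of_int i ^ (M - N)" using NM by (simp flip: power_add)
  then have "of_int (g N) * t = of_int (g N) * (s * of_int i ^ (M - N))"
    unfolding t(1)[unfolded NM(1)[symmetric]] s(1) by (simp only: mult.assoc)
  moreover have "of_int (g N) \<noteq> (0 :: 'k)" using s(1) nz(1) by auto
  ultimately have e: "t = s * of_int i ^ (M - N)" by simp
  have "inverse (of_int i) ^ (M - N) = s * inverse t"
    unfolding e using s(4) nz(1) by (simp add: power_inverse)
  also have "\<dots> \<in> V" by (rule VD(4)[OF s(2) t(3)])
  finally have "inverse (of_int i) \<in> V" by (rule V_root) (use NM(2) in simp)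
  then show False using inu by simp
qed

lemma finite_rank_subfield:
  assumes "finite S"
  obtains F k where "is_subfield F" "S \<subseteq> F" "rank_le F k"
proof -
  from assms have "\<exists>F k. is_subfield F \<and> S \<subseteq> F \<and> rank_le F k"
  proof (induction S rule: finite_induct)
    case empty
    then show ?case using is_subfield_prime_field rank_le_prime_field by blast
  next
    case (insert a S)
    then obtain F k where F: "is_subfield F" "S \<subseteq> F" "rank_le F k" by blast
    then show ?case using is_subfield_adjoin[OF F(1), of a] rank_le_adjoin[OF F(1,3), of a] by blast
  qed
  then show thesis using that by blast
qed

end

section \<open>Climbing the chain of primes\<close>

context valuation_subring
begin

text \<open>Induction on a bound for the lengths of chains outside \<open>J\<close>, which stands
  for the number of primes above \<open>J\<close>. The next prime above \<open>J\<close> admits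
  shorter chains only, so \<open>A\<close> is elementary modulo it, and failing modulo
  \<open>J\<close> would be a \<open>val_failure\<close>.\<close>

lemma elem_mod_prime:
  fixes F J :: "'k set"
  defines "D \<equiv> V \<inter> F"
  assumes F: "is_subfield F" and n: "n \<ge> 3" and A: "A \<in> mats n (polys D)" "det A = 1"
    and J: "prime_in D J" and rk: "\<And>xs. chain F xs \<Longrightarrow> set xs \<inter> J = {} \<Longrightarrow> length xs \<le> k"
  shows "elem_mod n D J A"
  using J rk
proof (induction k arbitrary: J rule: less_induct)
  case (less k)
  note J = less.prems(1) and rk = less.prems(2)
  note FD = is_subfieldD[OF F]
  have D: "is_subring D" unfolding D_def is_subring_def using VD FD by auto
  have DV: "x \<in> D \<Longrightarrow> x \<in> V" and DF: "x \<in> D \<Longrightarrow> x \<in> F" for x by (auto simp: D_def)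
  have Dv: "\<exists>q\<in>D. a = q * b \<or> b = q * a" if ab: "a \<in> D" "b \<in> D" for a b
  proof (cases "a = 0 \<or> b = 0")
    case True
    then have "a = 0 * b \<or> b = 0 * a" by auto
    then show ?thesis using is_subringD(1)[OF D] by blast
  next
    case False
    then have "a / b \<in> D \<or> b / a \<in> D" using val_divide[of a b] ab FD(9) by (auto simp: D_def)
    moreover have "a = a / b * b" "b = b / a * a" using False by auto
    ultimately show ?thesis by blast
  qed
  interpret vd: valuation_domain_in D by unfold_locales (rule D, rule Dv)
  have J0: "0 \<in> J" using ideal_inD(2)[OF prime_inD(1)[OF J]] .
  have nonunitI: "nonunit a" if a: "a \<in> D" "a \<noteq> 0" "\<forall>b\<in>D. a * b \<noteq> 1" for a
  proof -
    have "inverse a \<notin> V"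
    proof
      assume "inverse a \<in> V"
      then have "inverse a \<in> D" using a FD(8) by (auto simp: D_def)
      then show False using a by auto
    qed
    then show ?thesis using a DV by (simp add: nonunit_def)
  qed
  have nonunitD: "a * b \<noteq> 1" if "nonunit a" "b \<in> D" for a b
    using that DV inverse_unique[of a b] by (auto simp: nonunit_def)
  show ?case
  proof (rule ccontr)
    assume not: "\<not> elem_mod n D J A"
    show False
    proof (cases "\<forall>a\<in>D. a \<notin> J \<longrightarrow> (\<exists>b\<in>D. a * b = 1)")
      case True
      have "val_failure D J" unfolding val_failure_def
        using D J Dv n A not True by blast
      then show False using no_val_failure by blast
    next
      case False
      then obtain a where a: "a \<in> D" "a \<notin> J" "\<forall>b\<in>D. a * b \<noteq> 1" by blast
      \<comment> \<open>The last element \<open>c\<close> of a longest chain outside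
        \<open>J\<close> will have as its radical the smallest prime properly above
        \<open>J\<close>.\<close>
      define L where "L = {l. \<exists>xs. chain F xs \<and> set xs \<inter> J = {} \<and> length xs = l}"
      have Lk: "L \<subseteq> {..k}" using rk by (auto simp: L_def)
      then have Lfin: "finite L" by (rule finite_subset) simp
      have "nonunit a" using a J0 by (intro nonunitI) auto
      then have "chain F [a]" using DF a by (simp add: chain_def)
      then have 1: "1 \<in> L" unfolding L_def using a by (intro CollectI exI[of _ "[a]"]) auto
      define l where "l = Max L"
      have l: "l \<in> L" "1 \<le> l" "l \<le> k" using Max_in[OF Lfin] Max_ge[OF Lfin 1] 1 Lk by (auto simp: l_def)
      then obtain xs where xs: "chain F xs" "set xs \<inter> J = {}" "length xs = l" by (auto simp: L_def)
      then obtain ys c where ys: "xs = ys @ [c]" using l(2) by (cases xs rule: rev_cases) auto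
      have c: "c \<in> F" "nonunit c" "c \<notin> J" using xs ys by (auto simp: chain_def)
      have cD: "c \<in> D" using c by (auto simp: D_def nonunit_def)
      have c0: "c \<noteq> 0" using c by (auto simp: nonunit_def)
      have ex: "chain F (zs @ [r])" if zs: "chain F zs" "r \<in> F" "nonunit r" "\<And>z. z \<in> set zs \<Longrightarrow> deeper z r" for zs r
        using zs by (auto simp: chain_def sorted_wrt_append)
      \<comment> \<open>If \<open>r\<close> divided no power of \<open>c\<close>, it would be deeper
        than \<open>c\<close> and could prolong the longest chain.\<close>
      have pow: "\<exists>N. \<exists>q\<in>D. c ^ N = q * r" if r: "r \<in> D" "r \<notin> J" for r
      proof (rule ccontr)
        assume n: "\<not> ?thesis"
        have r0: "r \<noteq> 0" using r J0 by auto
        have "c ^ N / r \<notin> V" for N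
        proof
          assume "c ^ N / r \<in> V"
          then have "c ^ N / r \<in> D" using c(1) DF[OF r(1)] FD(9) subring_power[OF FD(1)] by (auto simp: D_def)
          moreover have "c ^ N = c ^ N / r * r" using r0 by simp
          ultimately show False using n by blast
        qed
        then have d: "deeper c r" using c0 by (intro deeper_if_not_power)
        have "deeper z r" if "z \<in> set xs" for z
        proof (cases "z = c")
          case False
          then have "z \<in> set ys" using that ys by auto
          then have "deeper z c" using xs(1) ys by (auto simp: chain_def sorted_wrt_append)
          then show ?thesis using d c0 by (rule deeper_trans)
        qed (use d in simp)
        then have "chain F (xs @ [r])"
          using xs(1) DF[OF r(1)] nonunit_deeper[OF c(2) d r0] by (intro ex)
        moreover have "set (xs @ [r]) \<inter> J = {}" using xs(2) r(2) by auto
        ultimately have "Suc l \<in> L" unfolding L_def using xs(3) by (intro CollectI exI[of _ "xs @ [r]"]) simp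
        then show False using Max_ge[OF Lfin] by (fastforce simp: l_def)
      qed
      have one: "1 \<notin> radical D c"
      proof
        assume "1 \<in> radical D c"
        then obtain q where "q \<in> D" "1 = q * c" by (auto simp: radical_def)
        then show False using nonunitD[OF c(2), of q] by (simp add: mult.commute)
      qed
      have J': "prime_in D (radical D c)"
        unfolding prime_in_def using vd.radical_ideal one vd.radical_prime by blast
      have JJ': "J \<subseteq> radical D c" by (rule vd.subset_radical[OF J cD c(3)])
      have "elem_mod n D (radical D c) A"
      proof (rule less.IH[OF _ J'])
        show "k - 1 < k" using l by simp
        fix zs assume zs: "chain F zs" "set zs \<inter> radical D c = {}"
        have "deeper z c" if z: "z \<in> set zs" for z
        proof (rule deeper_if_not_power)
          have zF: "z \<in> F" "nonunit z" using zs z by (auto simp: chain_def)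
          then have zD: "z \<in> D" by (auto simp: D_def nonunit_def)
          show "z ^ N / c \<notin> V" for N
          proof
            assume "z ^ N / c \<in> V"
            then have "z ^ N / c \<in> D" using c(1) zF(1) FD(9) subring_power[OF FD(1)] by (auto simp: D_def)
            moreover have "z ^ N = z ^ N / c * c" using c0 by simp
            ultimately have "z \<in> radical D c" by (rule vd.radicalI[OF zD])
            then show False using zs(2) z by blast
          qed
          show "z \<noteq> 0" using zF by (auto simp: nonunit_def)
        qed
        \<comment> \<open>Elements outside the radical of \<open>c\<close> have \<open>c\<close>
          below them, so \<open>c\<close> can be appended. Hence chains outside the radical are
          shorter by one than the bound for \<open>J\<close>.\<close>
        then have "chain F (zs @ [c])" using zs(1) c by (intro ex)
        moreover have "set (zs @ [c]) \<inter> J = {}" using zs(2) JJ' c(3) by auto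
        ultimately have "length (zs @ [c]) \<le> k" by (rule rk)
        then show "length zs \<le> k - 1" by simp
      qed
      then have "val_failure D J" unfolding val_failure_def
        using D J Dv n A not cD c(3) nonunitD[OF c(2)] pow by blast
      then show False using no_val_failure by blast
    qed
  qed
qed

text \<open>The coefficients of \<open>A\<close> lie in a subfield of finite rank, and
  \<open>elem_mod_prime\<close> is applied over its intersection with \<open>V\<close> to the zero
  ideal, where congruence is equality.\<close>

theorem SL_valuation_poly:
  assumes n: "n \<ge> 3" and A: "A \<in> mats n (polys V)" "det A = 1"
  shows "A \<in> Eg n (polys V)"
proof -
  define S where "S = (\<Union>ij\<in>{..<n} \<times> {..<n}. range (coeff (A $$ ij)))"
  have "finite S" unfolding S_def by (auto simp: finite_coeffs)
  then obtain F k where F: "is_subfield F" "S \<subseteq> F" "rank_le F k" by (rule finite_rank_subfield)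
  define D where "D = V \<inter> F"
  have "coeff (A $$ (i,j)) l \<in> F" if "i < n" "j < n" for i j l
    using F(2) that by (auto simp: S_def)
  then have AD: "A \<in> mats n (polys D)" using A by (auto simp: mats_def polys_def D_def)
  have "prime_in D {0}" unfolding prime_in_def ideal_in_def D_def
    using VD is_subfieldD[OF F(1)] by auto
  then have "elem_mod n D {0} A"
    unfolding D_def using F n A(2) AD by (intro elem_mod_prime[of F n A "{0}" k]) (auto simp: rank_le_def D_def)
  then obtain B where B: "B \<in> Eg n (polys D)" "cong_mat n (polys {0}) A B" unfolding elem_mod_def by blast
  have "A $$ (i,j) = B $$ (i,j)" if "i < n" "j < n" for i j
  proof -
    have "A $$ (i,j) - B $$ (i,j) \<in> polys {0}" using B(2) that unfolding cong_mat_def by blast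
    then show ?thesis by (simp add: polys_def poly_eq_iff)
  qed
  then have "A = B" using A(1) Eg_carrier[OF B(1)] by (intro eq_matI) (auto simp: mats_def)
  then show ?thesis using Eg_mono[OF B(1), of "polys V"] by (auto simp: polys_def D_def)
qed

end

section \<open>Matrices congruent to the identity modulo a nil ideal\<close>

lemma addrow_mult_entry:
  assumes "A \<in> carrier_mat n n" "k < n" "l < n" "r < n" "c < n"
  shows "(addrow_mat n a k l * A) $$ (r,c) = A $$ (r,c) + (if r = k then a * A $$ (l,c) else (0::'a::comm_ring_1))"
proof -
  have "addrow_mat n a k l * A = addrow a k l A" using addrow_mat[OF assms(1,3)] by simp
  then show ?thesis using assms by (simp add: mat_addrow_gen_def)
qed

lemma mult_addrow_entry:
  assumes "A \<in> carrier_mat n n" "k < n" "l < n" "r < n" "c < n"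
  shows "(A * addrow_mat n a k l) $$ (r,c) = A $$ (r,c) + (if c = l then A $$ (r,k) * a else (0::'a::comm_ring_1))"
proof -
  have "A * addrow_mat n a k l = addcol a l k A" using addcol_mat[OF assms(1,2), of a l] by simp
  then show ?thesis using assms by (simp add: mat_addcol_def mult.commute)
qed

lemma cong_mat_addrow:
  assumes I: "ideal_in D I" and "a - b \<in> I" "i \<noteq> j"
  shows "cong_mat n I (addrow_mat n a i j) (addrow_mat n b i j)"
  using assms ideal_inD(2)[OF I] by (auto simp: cong_mat_def)

lemma addrow_zero: "i \<noteq> j \<Longrightarrow> addrow_mat n 0 i j = (1\<^sub>m n :: 'a::comm_ring_1 mat)"
  by (rule eq_matI) auto

text \<open>The corner is a unit. It is turned into 1 by a product of transvections that is itself
  congruent to 1, so that the complementary block again satisfies the hypotheses.\<close>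

lemma Eg_if_cong_one_units:
  fixes I :: "'a::comm_ring_1 set"
  assumes I: "ideal_in UNIV I" and unit: "\<And>a. a \<in> I \<Longrightarrow> \<exists>v. (1 + a) * v = 1"
    and "n \<ge> 1" "A \<in> carrier_mat n n" "det A = 1" "cong_mat n I A (1\<^sub>m n)"
  shows "A \<in> Eg n UNIV"
  using assms(3-)
proof (induction n arbitrary: A rule: dec_induct)
  case base
  then show ?case by (intro Eg_one_by_one)
next
  case (step n)
  let ?n = "Suc n"
  note UU = is_subring_UNIV[where 'a='a]
  have n: "1 < ?n" "0 < ?n" using step.hyps by auto
  define u where "u = A $$ (0,0)"
  define b where "b = A $$ (0,1)"
  have u: "u - 1 \<in> I" and b: "b \<in> I"
    using cong_mat_oneD[OF step.prems(3), of 0 0] cong_mat_oneD[OF step.prems(3), of 0 1] n by (auto simp: u_def b_def)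
  obtain v where v: "u * v = 1" using unit[OF u] by auto
  \<comment> \<open>With this parameter the first transvection turns the entry \<open>b\<close> into
    \<open>b + u * w = 1\<close>; this 1 is then used to replace the corner \<open>u\<close> by
    1.\<close>
  define w where "w = v * (1 - b)"
  have "v - 1 = - v * (u - 1)" using v by (simp add: algebra_simps)
  then have "v - 1 \<in> I" using ideal_inD(4)[OF I _ u, of "- v"] by simp
  then have "(v - 1) + - v * b \<in> I" using ideal_inD(3)[OF I _ ideal_inD(4)[OF I _ b]] by blast
  then have w: "w - 1 \<in> I" by (simp add: w_def algebra_simps)
  let ?E1 = "addrow_mat ?n w 0 1" and ?E2 = "addrow_mat ?n (1 - u) 1 0" and ?E3 = "addrow_mat ?n (-1 :: 'a) 0 1"
  \<comment> \<open>The last factor leaves the corner alone. It is there because modulo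
    \<open>I\<close> the first factor has parameter 1 and the second parameter 0, so that the
    product is congruent to 1.\<close>
  define E where "E = ?E1 * (?E2 * ?E3)"
  have Eg: "?E1 \<in> Eg ?n UNIV" "?E2 \<in> Eg ?n UNIV" "?E3 \<in> Eg ?n UNIV" using n by (auto intro!: Eg_addrow)
  have E: "E \<in> Eg ?n UNIV" unfolding E_def using Eg by (intro Eg_mult)
  have u': "1 - u - 0 \<in> I" using ideal_in_uminus[OF UU I u] by simp
  have "cong_mat ?n I E (addrow_mat ?n 1 0 1 * (addrow_mat ?n 0 1 0 * ?E3))"
    unfolding E_def using Eg_carrier[OF Eg(1)] ideal_inD(2)[OF I]
    by (intro cong_mat_mult[OF UU I] cong_mat_addrow[OF I] w u') (auto intro!: mult_carrier_mat)
  also have "addrow_mat ?n 1 0 1 * (addrow_mat ?n 0 1 0 * ?E3) = 1\<^sub>m ?n"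
  proof -
    have "addrow_mat ?n 0 1 0 * ?E3 = ?E3" using left_mult_one_mat[of ?E3 ?n ?n] by (simp add: addrow_zero)
    then show ?thesis using n addrow_mat_inv[of 0 ?n 1 1] by simp
  qed
  finally have EI: "cong_mat ?n I E (1\<^sub>m ?n)" .
  define B where "B = A * E"
  note Ac = step.prems(1)
  have Bc: "B \<in> carrier_mat ?n ?n" using Ac Eg_carrier[OF E] by (simp add: B_def)
  have "B = A * ?E1 * ?E2 * ?E3"
  proof -
    have "B = A * ?E1 * (?E2 * ?E3)" unfolding B_def E_def
      by (rule assoc_mult_mat[symmetric, OF Ac addrow_mat_carrier]) (auto intro!: mult_carrier_mat)
    also have "\<dots> = A * ?E1 * ?E2 * ?E3"
      by (rule assoc_mult_mat[symmetric, OF mult_carrier_mat[OF Ac addrow_mat_carrier] addrow_mat_carrier addrow_mat_carrier])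
    finally show ?thesis .
  qed
  moreover have "(A * ?E1) $$ (0,0) = u"
    using n Ac by (subst mult_addrow_entry) (auto simp: u_def)
  moreover have "(A * ?E1) $$ (0,1) = b + u * w"
    using n Ac by (subst mult_addrow_entry) (auto simp: u_def b_def)
  then have "(A * ?E1) $$ (0,1) = 1" using v by (simp add: w_def flip: mult.assoc)
  ultimately have "(A * ?E1 * ?E2) $$ (0,0) = 1" and B: "B = A * ?E1 * ?E2 * ?E3"
    using n mult_addrow_entry[OF mult_carrier_mat[OF Ac addrow_mat_carrier], of 1 0 0 0 w 0 1 "1 - u"]
    by (simp_all del: index_mult_mat(1))
  then have "(A * ?E1 * ?E2 * ?E3) $$ (0,0) = 1"
    using n mult_addrow_entry[OF mult_carrier_mat[OF mult_carrier_mat[OF Ac addrow_mat_carrier] addrow_mat_carrier], of 0 1 0 0 w 0 1 "1 - u" 1 0 "-1"]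
    by (simp del: index_mult_mat(1))
  then have B00: "B $$ (0,0) = 1" unfolding B .
  have dB: "det B = 1" unfolding B_def using step.prems by (simp add: det_mult[OF Ac Eg_carrier[OF E]] Eg_det[OF E])
  have BI: "cong_mat ?n I B (1\<^sub>m ?n)" unfolding B_def
    using step.prems Eg_carrier[OF E] EI by (intro cong_mat_mult_one[OF UU I]) auto
  have BU: "B \<in> mats ?n UNIV" using Bc by simp
  obtain C where C: "C \<in> mats n UNIV" "det C = 1" "cong_mat n I C (1\<^sub>m n)"
    "emb n ?n Suc C \<in> Eg ?n UNIV \<longleftrightarrow> B \<in> Eg ?n UNIV"
    by (rule pivot[OF UU BU B00 dB I BI])
  have "C \<in> Eg n UNIV" using step.IH C by simp
  then have "emb n ?n Suc C \<in> Eg ?n UNIV" by (intro emb_Eg) auto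
  then have "B \<in> Eg ?n UNIV" using C(4) by simp
  then show ?case unfolding B_def using Eg_cancel_right[OF UU E Ac] by simp
qed

definition nilradical :: "'a::comm_ring_1 set" where "nilradical = {a. \<exists>N. a ^ N = 0}"

lemma nilpotent_add:
  fixes a b :: "'a::comm_ring_1"
  assumes "a ^ N = 0" "b ^ M = 0"
  shows "(a + b) ^ (N + M) = 0"
proof -
  have "of_nat (N + M choose k) * a ^ k * b ^ (N + M - k) = 0" for k
  proof (cases "k \<ge> N")
    case True
    then have "a ^ k = a ^ N * a ^ (k - N)" by (simp flip: power_add)
    then show ?thesis using assms by simp
  next
    case False
    then have "N + M - k = M + (N - k)" by simp
    then have "b ^ (N + M - k) = b ^ M * b ^ (N - k)" by (simp only: power_add)
    then show ?thesis using assms by simp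
  qed
  then show ?thesis unfolding binomial_ring by (intro sum.neutral) auto
qed

lemma ideal_in_nilradical: "ideal_in UNIV (nilradical :: 'a::comm_ring_1 set)"
  unfolding ideal_in_def nilradical_def
proof (intro conjI ballI)
  show "(0 :: 'a) \<in> {a. \<exists>N. a ^ N = 0}" by (auto intro: exI[of _ 1])
  fix a b :: 'a assume "a \<in> {a. \<exists>N. a ^ N = 0}" "b \<in> {a. \<exists>N. a ^ N = 0}"
  then show "a + b \<in> {a. \<exists>N. a ^ N = 0}" using nilpotent_add by blast
next
  fix a b :: 'a assume "b \<in> {a. \<exists>N. a ^ N = 0}"
  then obtain N where "b ^ N = 0" by blast
  then have "(a * b) ^ N = 0" by (simp add: power_mult_distrib)
  then show "a * b \<in> {a. \<exists>N. a ^ N = 0}" by blast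
qed simp

lemma nilpotent_unit:
  fixes a :: "'a::comm_ring_1"
  assumes "a \<in> nilradical"
  shows "\<exists>v. (1 + a) * v = 1"
proof -
  obtain N where "a ^ N = 0" using assms by (auto simp: nilradical_def)
  then have "(- a) ^ N = 0" by (simp add: power_minus[of a])
  then have "(1 + a) * (\<Sum>i<N. (- a) ^ i) = 1" using one_diff_power_eq[of "- a" N] by simp
  then show ?thesis by blast
qed

lemma polys_nilradical: "polys nilradical \<subseteq> (nilradical :: 'a::comm_ring_1 poly set)"
proof
  fix p :: "'a poly" assume p: "p \<in> polys nilradical"
  have "monom (coeff p i) i \<in> nilradical" for i
  proof -
    obtain N where "coeff p i ^ N = 0" using p by (auto simp: polys_def nilradical_def)
    then have "monom (coeff p i) i ^ N = 0" by (simp add: monom_power)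
    then show ?thesis by (auto simp: nilradical_def)
  qed
  then have "(\<Sum>i\<le>degree p. monom (coeff p i) i) \<in> nilradical" by (intro ideal_in_sum[OF ideal_in_nilradical])
  then show "p \<in> nilradical" by (simp only: poly_as_sum_of_monoms)
qed

section \<open>Denominators in conjugates of elementary matrices\<close>

context
  fixes n i j k :: nat
  assumes ijk: "i < n" "j < n" "k < n" "i \<noteq> j" "i \<noteq> k" "j \<noteq> k"
begin

lemma addrow_conj_left:
  "addrow_mat n a k i * addrow_mat n x i j * addrow_mat n (- a) k i =
    addrow_mat n x i j * addrow_mat n (a * x) k (j::nat) * (1\<^sub>m n :: 'a::comm_ring_1 mat)"
  using ijk by (intro eq_matI) (auto simp: mult_addrow_entry[of _ n] mult_carrier_mat[of _ n n _ n] simp del: index_mult_mat(1))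

lemma addrow_conj_right:
  "addrow_mat n a j k * addrow_mat n x i j * addrow_mat n (- a) j k =
    addrow_mat n x i j * addrow_mat n (- (x * a)) i (k::nat) * (1\<^sub>m n :: 'a::comm_ring_1 mat)"
  using ijk by (intro eq_matI) (auto simp: mult_addrow_entry[of _ n] mult_carrier_mat[of _ n n _ n] simp del: index_mult_mat(1))

lemma addrow_commutator:
  "addrow_mat n u i k * (addrow_mat n v k j * (addrow_mat n (- u) i k * addrow_mat n (- v) k j)) =
    (addrow_mat n (u * v) i j :: 'a::comm_ring_1 mat)"
  using ijk by (intro eq_matI) (auto simp: addrow_mult_entry[of _ n] mult_carrier_mat[of _ n n _ n] simp del: index_mult_mat(1))

end

lemma addrow_conj_disjoint:
  assumes "i < n" "j < n" "k < n" "l < n" "i \<noteq> j" "k \<noteq> l" "l \<noteq> i" "k \<noteq> j"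
  shows "addrow_mat n a k l * addrow_mat n x i j * addrow_mat n (- a) k l = (addrow_mat n x i j :: 'a::comm_ring_1 mat)"
  using assms by (intro eq_matI) (auto simp: mult_addrow_entry[of _ n] mult_carrier_mat[of _ n n _ n] simp del: index_mult_mat(1))

lemma Eg_conj_generators:
  assumes gd: "g \<in> carrier_mat n n" "d \<in> carrier_mat n n" "d * g = 1\<^sub>m n" "g * d = (1\<^sub>m n :: 'a::comm_ring_1 mat)"
    and gen: "\<And>i j x. i < n \<Longrightarrow> j < n \<Longrightarrow> i \<noteq> j \<Longrightarrow> x \<in> S \<Longrightarrow> g * addrow_mat n x i j * d \<in> Eg n S'"
    and M: "M \<in> Eg n S"
  shows "g * M * d \<in> Eg n S'"
  using M
proof (induction rule: Eg.induct)
  case one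
  then show ?case using gd by (simp add: Eg.one)
next
  case (step M i j x)
  let ?E = "addrow_mat n x i j"
  have Mc: "M \<in> carrier_mat n n" using Eg_carrier[OF step.hyps(1)] .
  have "(g * M * d) * (g * ?E * d) = g * M * (d * (g * (?E * d)))"
    using gd Mc by (simp add: assoc_mult_mat[of _ n n _ n _ n] mult_carrier_mat[of _ n n _ n])
  also have "d * (g * (?E * d)) = ?E * d"
    using gd(1-3) by (subst assoc_mult_mat[symmetric, of d n n g n "?E * d" n]) (auto simp: mult_carrier_mat[of _ n n _ n])
  also have "g * M * (?E * d) = g * (M * ?E) * d"
    using gd Mc by (simp add: assoc_mult_mat[of _ n n _ n _ n] mult_carrier_mat[of _ n n _ n])
  finally have "g * (M * ?E) * d = (g * M * d) * (g * ?E * d)" by simp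
  then show ?case using Eg_mult[OF step.IH gen[OF step.hyps(2-5)]] by simp
qed

text \<open>\<open>V\<close> plays the part of a ring of fractions of \<open>R\<close> with
  denominators in \<open>S\<close>. Both lie in one ring, so no injectivity of a localization map is
  involved.\<close>

locale denominators =
  fixes n :: nat and R S V :: "'a::comm_ring_1 set"
  assumes n: "n \<ge> 3" and R: "is_subring R" and V: "is_subring V"
    and S: "1 \<in> S" "S \<subseteq> R" "\<And>s t. s \<in> S \<Longrightarrow> t \<in> S \<Longrightarrow> s * t \<in> S"
    and den: "\<And>v. v \<in> V \<Longrightarrow> \<exists>s\<in>S. s * v \<in> R"
begin

lemmas RD = is_subringD[OF R]

abbreviation "mR s \<equiv> (*) s ` R"

lemma mRI: "x = s * z \<Longrightarrow> z \<in> R \<Longrightarrow> x \<in> mR s" by blast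

text \<open>Steinberg relations: the conjugate is the transvection itself, possibly times one whose
  parameter carries an extra factor \<open>a\<close>. The factor \<open>s\<close> clears the
  denominator of \<open>a\<close>, and \<open>t\<close> survives. The excluded opposite position has
  no such formula.\<close>

lemma conj_root:
  assumes ij: "i < n" "j < n" "i \<noteq> j" and kl: "k < n" "l < n" "k \<noteq> l" "\<not> (k = j \<and> l = i)"
    and s: "s \<in> S" "s * a \<in> R" "t \<in> S" and z: "z \<in> R"
  shows "addrow_mat n a k l * addrow_mat n (s * t * z) i j * addrow_mat n (- a) k l \<in> Eg n (mR t)"
proof -
  have sR: "s \<in> R" "t \<in> R" using S s by auto
  have x: "s * t * z \<in> mR t" using RD(4)[OF sR(1) z] by (intro mRI[of _ t "s * z"]) (auto simp: mult_ac)
  have ax: "a * (s * t * z) \<in> mR t" using RD(4)[OF s(2) z] by (intro mRI[of _ t "s * a * z"]) (auto simp: mult_ac)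
  have xa: "- (s * t * z * a) \<in> mR t" using RD(5)[OF RD(4)[OF s(2) z]] by (intro mRI[of _ t "- (s * a * z)"]) (auto simp: mult_ac)
  consider "l = i" "k \<noteq> j" | "l \<noteq> i" "k = j" | "l \<noteq> i" "k \<noteq> j" using kl by auto
  then show ?thesis
  proof cases
    case 1
    then have "addrow_mat n a k l * addrow_mat n (s * t * z) i j * addrow_mat n (- a) k l =
      addrow_mat n (s * t * z) i j * addrow_mat n (a * (s * t * z)) k j * 1\<^sub>m n"
      using ij kl addrow_conj_left[of i n j k a "s * t * z"] by simp
    then show ?thesis using 1 ij kl x ax by (auto intro!: Eg_mult Eg_addrow Eg.one)
  next
    case 2
    then have "addrow_mat n a k l * addrow_mat n (s * t * z) i j * addrow_mat n (- a) k l =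
      addrow_mat n (s * t * z) i j * addrow_mat n (- (s * t * z * a)) i l * 1\<^sub>m n"
      using ij kl addrow_conj_right[of i n j l a "s * t * z"] by simp
    then show ?thesis using 2 ij kl x xa by (auto intro!: Eg_mult Eg_addrow Eg.one)
  next
    case 3
    then show ?thesis using ij kl x addrow_conj_disjoint[of i n j k l a "s * t * z"] by (auto intro!: Eg_addrow)
  qed
qed

text \<open>In the opposite position the transvection is written as a commutator through a third
  index, and each factor is conjugated by \<open>conj_root\<close>. Both factors need their own
  \<open>s * t\<close>, hence the square in \<open>r\<close>.\<close>

lemma conj_single:
  assumes kl: "k < n" "l < n" "k \<noteq> l" and a: "a \<in> V" and t: "t \<in> S"
  shows "\<exists>r\<in>S. \<forall>i<n. \<forall>j<n. i \<noteq> j \<longrightarrow> (\<forall>z\<in>R.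
    addrow_mat n a k l * addrow_mat n (r * z) i j * addrow_mat n (- a) k l \<in> Eg n (mR t))"
proof -
  obtain s where s: "s \<in> S" "s * a \<in> R" using den[OF a] by blast
  let ?g = "addrow_mat n a k l" and ?d = "addrow_mat n (- a) k l"
  define r where "r = (s * t) * (s * t)"
  have rS: "r \<in> S" unfolding r_def using s t by (intro S(3))
  have stR: "s * t \<in> R" using S s t by auto
  have gd: "?g * ?d = 1\<^sub>m n" "?d * ?g = 1\<^sub>m n"
    using addrow_mat_inv[OF kl, of a] addrow_mat_inv[OF kl, of "- a"] by auto
  show ?thesis
  proof (intro bexI[OF _ rS] allI impI ballI)
    fix i j z assume ij: "i < n" "j < n" "i \<noteq> j" and z: "z \<in> R"
    show "?g * addrow_mat n (r * z) i j * ?d \<in> Eg n (mR t)"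
    proof (cases "k = j \<and> l = i")
      case False
      have "s * t * z \<in> R" using RD(4)[OF stR z] .
      then have "?g * addrow_mat n (s * t * (s * t * z)) i j * ?d \<in> Eg n (mR t)"
        by (intro conj_root ij kl False s t)
      then show ?thesis by (simp add: r_def mult_ac)
    next
      case True
      obtain q where q: "q < n" "q \<noteq> i" "q \<noteq> j"
      proof -
        have "\<not> {..<n} \<subseteq> {i, j}" using card_mono[of "{i,j}" "{..<n}"] ij n by auto
        then show thesis using that by auto
      qed
      define u v where "u = s * t * z" and "v = s * t"
      have conj: "?g * addrow_mat n (s * t * y) i q * ?d \<in> Eg n (mR t)" "?g * addrow_mat n (s * t * y) q j * ?d \<in> Eg n (mR t)"
        if "y \<in> R" for y
        using that True q ij kl s t by (intro conj_root; auto)+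
      have c: "?g * addrow_mat n u i q * ?d \<in> Eg n (mR t)" "?g * addrow_mat n v q j * ?d \<in> Eg n (mR t)"
        "?g * addrow_mat n (- u) i q * ?d \<in> Eg n (mR t)" "?g * addrow_mat n (- v) q j * ?d \<in> Eg n (mR t)"
        using conj(1)[OF z] conj(2)[OF RD(2)] conj(1)[OF RD(5)[OF z]] conj(2)[OF RD(5)[OF RD(2)]]
        by (simp_all add: u_def v_def)
      have sp: "?g * (A * B) * ?d = (?g * A * ?d) * (?g * B * ?d)" if AB: "A \<in> carrier_mat n n" "B \<in> carrier_mat n n" for A B
      proof -
        have "(?g * A * ?d) * (?g * B * ?d) = ?g * A * (?d * (?g * (B * ?d)))"
          using AB by (simp add: assoc_mult_mat[of _ n n _ n _ n] mult_carrier_mat[of _ n n _ n])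
        also have "?d * (?g * (B * ?d)) = B * ?d"
          using AB gd by (subst assoc_mult_mat[symmetric, of ?d n n ?g n "B * ?d" n]) (auto simp: mult_carrier_mat[of _ n n _ n])
        finally show ?thesis using AB by (simp add: assoc_mult_mat[of _ n n _ n _ n] mult_carrier_mat[of _ n n _ n])
      qed
      have "r * z = u * v" by (simp add: r_def u_def v_def mult_ac)
      then have "addrow_mat n (r * z) i j =
        addrow_mat n u i q * (addrow_mat n v q j * (addrow_mat n (- u) i q * addrow_mat n (- v) q j))"
        using addrow_commutator[of i n j q u v] ij q by simp
      then have "?g * addrow_mat n (r * z) i j * ?d = (?g * addrow_mat n u i q * ?d) * ((?g * addrow_mat n v q j * ?d) *
        ((?g * addrow_mat n (- u) i q * ?d) * (?g * addrow_mat n (- v) q j * ?d)))"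
        by (simp add: sp mult_carrier_mat[of _ n n _ n])
      then show ?thesis using c by (auto intro!: Eg_mult)
    qed
  qed
qed

text \<open>The prescribed factor \<open>t\<close> makes the induction along the word run:
  conjugating by the last letter is arranged to land in transvections divisible by the
  \<open>r\<close> that the rest of the word requires.\<close>

lemma conj_denominator:
  assumes g: "g \<in> Eg n V" and t: "t \<in> S"
  shows "\<exists>d\<in>carrier_mat n n. g * d = 1\<^sub>m n \<and> d * g = 1\<^sub>m n \<and> (\<exists>r\<in>S. \<forall>i<n. \<forall>j<n. i \<noteq> j \<longrightarrow> (\<forall>z\<in>R.
    g * addrow_mat n (r * z) i j * d \<in> Eg n (mR t)))"
  using g
proof (induction rule: Eg.induct)
  case one
  have "1\<^sub>m n * addrow_mat n (t * z) i j * 1\<^sub>m n \<in> Eg n (mR t)" if "i < n" "j < n" "i \<noteq> j" "z \<in> R" for i j z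
    using that left_mult_one_mat[of "addrow_mat n (t * z) i j" n n] right_mult_one_mat[of "addrow_mat n (t * z) i j" n n]
    by (auto intro!: Eg_addrow)
  then show ?case using t by (intro bexI[of _ "1\<^sub>m n"]) auto
next
  case (step g k l a)
  obtain d r where d: "d \<in> carrier_mat n n" "g * d = 1\<^sub>m n" "d * g = 1\<^sub>m n" and r: "r \<in> S"
    "\<forall>i<n. \<forall>j<n. i \<noteq> j \<longrightarrow> (\<forall>z\<in>R. g * addrow_mat n (r * z) i j * d \<in> Eg n (mR t))"
    using step.IH by blast
  let ?g = "addrow_mat n a k l" and ?d = "addrow_mat n (- a) k l"
  have gd: "?g * ?d = 1\<^sub>m n" "?d * ?g = 1\<^sub>m n"
    using addrow_mat_inv[OF step.hyps(2-4), of a] addrow_mat_inv[OF step.hyps(2-4), of "- a"] by auto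
  obtain r' where r': "r' \<in> S" "\<forall>i<n. \<forall>j<n. i \<noteq> j \<longrightarrow> (\<forall>z\<in>R. ?g * addrow_mat n (r' * z) i j * ?d \<in> Eg n (mR r))"
    using conj_single[OF step.hyps(2-5) r(1)] by blast
  have gc: "g \<in> carrier_mat n n" using Eg_carrier[OF step.hyps(1)] .
  have conj: "g * M * d \<in> Eg n (mR t)" if "M \<in> Eg n (mR r)" for M
    by (rule Eg_conj_generators[OF gc d(1,3,2) _ that]) (use r(2) in auto)
  have c: "g * ?g * addrow_mat n (r' * z) i j * (?d * d) \<in> Eg n (mR t)" if "i < n" "j < n" "i \<noteq> j" "z \<in> R" for i j z
  proof -
    have "g * ?g * addrow_mat n (r' * z) i j * (?d * d) = g * (?g * addrow_mat n (r' * z) i j * ?d) * d"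
      using gc d by (simp add: assoc_mult_mat[of _ n n _ n _ n] mult_carrier_mat[of _ n n _ n])
    then show ?thesis using conj r'(2) that by simp
  qed
  have e: "g * ?g * (?d * d) = g * (?g * ?d * d)" "?d * d * (g * ?g) = ?d * (d * g * ?g)"
    using gc d(1) by (simp_all add: assoc_mult_mat[of _ n n _ n _ n] mult_carrier_mat[of _ n n _ n])
  have "?g * ?d * d = d" "d * g * ?g = ?g" using d gd(1) by (simp_all only: left_mult_one_mat left_mult_one_mat[OF addrow_mat_carrier])
  then have "g * ?g * (?d * d) = 1\<^sub>m n" "?d * d * (g * ?g) = 1\<^sub>m n"
    using gd(2) d(2) e by simp_all
  then show ?case using d(1) r'(1) c by (intro bexI[of _ "?d * d"] conjI bexI[of _ r']) (auto intro!: mult_carrier_mat)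
qed

end

lemma map_mat_one: "f 0 = 0 \<Longrightarrow> f 1 = 1 \<Longrightarrow> map_mat f (1\<^sub>m n) = (1\<^sub>m n)"
  by (rule eq_matI) auto

lemma hom_on_mat_one: "hom_on D f \<Longrightarrow> map_mat f (1\<^sub>m n) = 1\<^sub>m n"
  by (intro map_mat_one) (auto simp: hom_onD)

lemma hom_mat_mult:
  "hom_on UNIV f \<Longrightarrow> A \<in> carrier_mat n n \<Longrightarrow> B \<in> carrier_mat n n \<Longrightarrow> map_mat f (A * B) = map_mat f A * map_mat f B"
  using hom_on_mat_mult[of UNIV f A n B] by simp

lemma map_mat_map_mat: "map_mat f (map_mat g A) = map_mat (\<lambda>x. f (g x)) A"
  by (rule eq_matI) auto

section \<open>Quillen patching\<close>

definition const_part :: "'a::comm_ring_1 poly \<Rightarrow> 'a poly" where "const_part p = [:coeff p 0:]"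

definition scale :: "'a::comm_ring_1 \<Rightarrow> 'a poly \<Rightarrow> 'a poly" where "scale s p = pcompose p [:0, s:]"

lemma coeff_scale: "coeff (scale s p) i = s ^ i * coeff p i"
  unfolding scale_def by (rule coeff_pcompose_linear)

lemma coeff_const_part: "coeff (const_part p) i = (if i = 0 then coeff p 0 else 0)"
  unfolding const_part_def by (cases i) auto

lemma hom_scale: "hom_on UNIV (scale s)"
  unfolding hom_on_def scale_def by (simp add: pcompose_add pcompose_mult pcompose_1)

lemma hom_const_part: "hom_on UNIV const_part"
  unfolding hom_on_def const_part_def by (simp add: coeff_mult mult_ac)

lemma hom_map_poly: "hom_on UNIV f \<Longrightarrow> hom_on UNIV (map_poly f)"
  using hom_on_map_poly[of UNIV f] by simp

lemma scale_scale: "scale s (scale t p) = scale (s * t) p"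
  by (rule poly_eqI) (simp add: coeff_scale power_mult_distrib mult_ac)

lemma const_part_scale: "const_part (scale s p) = const_part p" "scale s (const_part p) = const_part p"
  "const_part (const_part p) = const_part p"
  by (auto intro!: poly_eqI simp: coeff_const_part coeff_scale)

lemma map_poly_scale: "hom_on UNIV f \<Longrightarrow> map_poly f (scale s p) = scale (f s) (map_poly f p)"
  by (rule poly_eqI) (simp add: coeff_map_poly_hom coeff_scale hom_onD hom_on_power)

lemma map_poly_const_part: "hom_on UNIV f \<Longrightarrow> map_poly f (const_part p) = const_part (map_poly f p)"
  by (rule poly_eqI) (simp add: coeff_map_poly_hom coeff_const_part hom_onD)

lemma right_inverse_unique:
  fixes A B C :: "'a::comm_ring_1 mat"
  assumes "A \<in> carrier_mat n n" "B \<in> carrier_mat n n" "C \<in> carrier_mat n n" "A * B = 1\<^sub>m n" "C * A = 1\<^sub>m n"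
  shows "B = C"
proof -
  have "B = C * A * B" using assms by simp
  also have "\<dots> = C" using assms by (subst assoc_mult_mat[of C n n A n B n]) auto
  finally show ?thesis .
qed

lemma finite_multiplier:
  assumes "1 \<in> S" "\<And>s t. s \<in> S \<Longrightarrow> t \<in> S \<Longrightarrow> s * t \<in> (S :: 'a::comm_ring_1 set)" "finite K"
    and "\<And>k. k \<in> K \<Longrightarrow> \<exists>s\<in>S. P s k" and "\<And>s t k. t \<in> S \<Longrightarrow> P s k \<Longrightarrow> P (t * s) k"
  shows "\<exists>s\<in>S. \<forall>k\<in>K. P s k"
  using assms(3,4)
proof (induction K rule: finite_induct)
  case empty
  then show ?case using assms(1) by blast
next
  case (insert k K)
  then obtain s t where s: "s \<in> S" "\<forall>k\<in>K. P s k" and t: "t \<in> S" "P t k" by blast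
  have "\<forall>k'\<in>insert k K. P (s * t) k'"
    using s t assms(5)[OF s(1) t(2)] assms(5)[OF t(1)] by (auto simp: mult.commute)
  then show ?case using assms(2)[OF s(1) t(1)] by blast
qed

text \<open>Models a localization followed by reduction modulo its nilradical: \<open>V\<close>
  consists of fractions with denominators from \<open>S\<close>, and the kernel of \<open>f\<close>
  is nilpotent up to factors from \<open>S\<close>. It is used for \<open>res\<close> and for the
  map it induces on polynomials.\<close>

locale poly_denominators =
  fixes n :: nat and f :: "'r::comm_ring_1 \<Rightarrow> 's::comm_ring_1" and S V
  assumes n: "n \<ge> 3" and f: "hom_on UNIV f" and V: "is_subring V"
    and S: "1 \<in> S" "\<And>s t. s \<in> S \<Longrightarrow> t \<in> S \<Longrightarrow> s * t \<in> S"
    and den: "\<And>v. v \<in> V \<Longrightarrow> \<exists>s\<in>S. \<exists>a. f s * v = f a"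
    and kernel: "\<And>a. f a = 0 \<Longrightarrow> \<exists>s\<in>S. \<exists>N. s * a ^ N = 0"
begin

sublocale cd: denominators n "range (map_poly f)" "(\<lambda>s. [:f s:]) ` S" "(\<lambda>v. [:v:]) ` V"
proof
  show "is_subring (range (map_poly f))" using hom_on_image[OF hom_map_poly[OF f]] by simp
  have "hom_on V (\<lambda>v. [:v:])" using V by (simp add: hom_on_def)
  then show "is_subring ((\<lambda>v. [:v:]) ` V)" by (rule hom_on_image)
  have e: "[:f s:] = map_poly f [:s:]" for s
    by (rule poly_eqI) (simp add: coeff_map_poly_hom[OF f] coeff_pCons hom_onD[OF f] split: nat.split)
  show "(\<lambda>s. [:f s:]) ` S \<subseteq> range (map_poly f)" unfolding e by blast
  have "[:f 1:] = 1" by (simp add: hom_onD[OF f])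
  then show "1 \<in> (\<lambda>s. [:f s:]) ` S" using S(1) by (metis imageI)
  fix x y assume "x \<in> (\<lambda>s. [:f s:]) ` S" "y \<in> (\<lambda>s. [:f s:]) ` S"
  then obtain s t where "s \<in> S" "t \<in> S" "x = [:f s:]" "y = [:f t:]" by blast
  moreover from this have "x * y = [:f (s * t):]" by (simp add: hom_onD[OF f] mult.commute)
  ultimately show "x * y \<in> (\<lambda>s. [:f s:]) ` S" using S(2) by blast
next
  fix v assume "v \<in> (\<lambda>v. [:v:]) ` V"
  then obtain w where w: "w \<in> V" "v = [:w:]" by blast
  obtain s a where s: "s \<in> S" "f s * w = f a" using den[OF w(1)] by blast
  have "[:f s:] * v = map_poly f [:a:]"
    by (rule poly_eqI) (simp add: w(2) s(2)[symmetric] mult.commute coeff_map_poly_hom[OF f] coeff_pCons hom_onD[OF f] split: nat.split)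
  then show "\<exists>s\<in>(\<lambda>s. [:f s:]) ` S. s * v \<in> range (map_poly f)" using s(1) by blast
qed (rule n)

text \<open>The multiplier works for all \<open>t\<close> at once, so that \<open>t\<close> may
  afterwards be chosen depending on it.\<close>

lemma scaled_in_range:
  assumes h: "h \<in> polys V"
  shows "\<exists>s\<in>S. \<forall>t. smult (f s) (scale (f t) h) \<in> range (map_poly f)"
proof -
  have "\<exists>s\<in>S. \<forall>i\<in>{..degree h}. \<exists>a. f s * coeff h i = f a"
  proof (rule finite_multiplier[OF S])
    show "\<exists>s\<in>S. \<exists>a. f s * coeff h i = f a" for i using den polysD[OF h] by blast
    fix s t i assume "\<exists>a. f s * coeff h i = f a"
    then obtain a where a: "f s * coeff h i = f a" by blast
    have "f (t * s) * coeff h i = f (t * a)" by (simp add: hom_onD[OF f] mult.assoc a)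
    then show "\<exists>a. f (t * s) * coeff h i = f a" by blast
  qed auto
  then obtain s where s: "s \<in> S" "\<forall>i\<le>degree h. \<exists>a. f s * coeff h i = f a" by auto
  have "\<exists>a. f s * coeff h i = f a" for i
  proof (cases "i \<le> degree h")
    case False
    then have "f s * coeff h i = f 0" by (simp add: coeff_eq_0 hom_onD[OF f])
    then show ?thesis by blast
  qed (use s in auto)
  then obtain a where a: "\<And>i. f s * coeff h i = f (a i)" by metis
  have "smult (f s) (scale (f t) h) \<in> range (map_poly f)" for t
  proof -
    define q where "q = (\<Sum>i\<le>degree h. monom (t ^ i * a i) i)"
    have q: "coeff q i = (if i \<le> degree h then t ^ i * a i else 0)" for i
      by (simp add: q_def coeff_sum)
    have "smult (f s) (scale (f t) h) = map_poly f q"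
    proof (rule poly_eqI)
      fix i
      have "f s * (f t ^ i * coeff h i) = f t ^ i * (f s * coeff h i)" by (simp add: mult_ac)
      also have "\<dots> = f (coeff q i)" using a[of i]
        by (cases "i \<le> degree h") (auto simp: q hom_onD[OF f] hom_on_power[OF f] coeff_eq_0)
      finally show "coeff (smult (f s) (scale (f t) h)) i = coeff (map_poly f q) i"
        by (simp add: coeff_scale coeff_map_poly_hom[OF f])
    qed
    then show ?thesis by blast
  qed
  then show ?thesis using s(1) by blast
qed

text \<open>Denominators are cleared by the substitution of s x for x. The lift is normalized to be
  1 at x = 0, because a constant term would not be changed by further scaling.\<close>

definition lifts :: "'s poly mat \<Rightarrow> bool" where
  "lifts N \<longleftrightarrow> N \<in> carrier_mat n n \<and> (\<exists>s\<in>S. \<exists>C\<in>Eg n UNIV.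
    map_mat (map_poly f) C = map_mat (scale (f s)) N \<and> map_mat const_part C = 1\<^sub>m n)"

lemma lifts_mult:
  assumes "lifts N" "lifts N'"
  shows "lifts (N * N')"
proof -
  obtain s C t D where c: "N \<in> carrier_mat n n" "N' \<in> carrier_mat n n" and s: "s \<in> S" "t \<in> S"
    and C: "C \<in> Eg n UNIV" "map_mat (map_poly f) C = map_mat (scale (f s)) N" "map_mat const_part C = 1\<^sub>m n"
    and D: "D \<in> Eg n UNIV" "map_mat (map_poly f) D = map_mat (scale (f t)) N'" "map_mat const_part D = 1\<^sub>m n"
    using assms unfolding lifts_def by blast
  \<comment> \<open>Each lift is scaled by the constant of the other, so that both belong to the
    common constant \<open>s * t\<close>.\<close>
  define CD where "CD = map_mat (scale t) C * map_mat (scale s) D"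
  have Cc: "map_mat (scale t) C \<in> Eg n UNIV" "map_mat (scale s) D \<in> Eg n UNIV"
    using C D by (auto intro: Eg_hom[OF hom_scale])
  then have 1: "CD \<in> Eg n UNIV" unfolding CD_def by (rule Eg_mult)
  have 2: "map_mat (map_poly f) (map_mat (scale t) C) = map_mat (scale (f (s * t))) N"
  proof -
    have "map_mat (map_poly f) (map_mat (scale t) C) = map_mat (scale (f t)) (map_mat (map_poly f) C)"
      by (simp add: map_mat_map_mat map_poly_scale[OF f])
    also have "\<dots> = map_mat (scale (f (s * t))) N"
      by (simp add: C(2) map_mat_map_mat scale_scale hom_onD[OF f] mult.commute)
    finally show ?thesis .
  qed
  have 3: "map_mat (map_poly f) (map_mat (scale s) D) = map_mat (scale (f (s * t))) N'"
  proof -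
    have "map_mat (map_poly f) (map_mat (scale s) D) = map_mat (scale (f s)) (map_mat (map_poly f) D)"
      by (simp add: map_mat_map_mat map_poly_scale[OF f])
    also have "\<dots> = map_mat (scale (f (s * t))) N'"
      by (simp add: D(2) map_mat_map_mat scale_scale hom_onD[OF f])
    finally show ?thesis .
  qed
  have "map_mat (map_poly f) CD = map_mat (scale (f (s * t))) (N * N')"
    unfolding CD_def hom_mat_mult[OF hom_map_poly[OF f] Eg_carrier[OF Cc(1)] Eg_carrier[OF Cc(2)]]
      hom_mat_mult[OF hom_scale c] 2 3 ..
  moreover have "map_mat const_part CD = 1\<^sub>m n"
    unfolding CD_def hom_mat_mult[OF hom_const_part Eg_carrier[OF Cc(1)] Eg_carrier[OF Cc(2)]]
      map_mat_map_mat const_part_scale using C(3) D(3) by simp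
  moreover have "N * N' \<in> carrier_mat n n" using c by simp
  ultimately show ?thesis unfolding lifts_def using 1 S(2)[OF s] by blast
qed

text \<open>Scaling the variable makes the parameter, which is divisible by it, a multiple of any
  wanted denominator: of the one from \<open>conj_denominator\<close> for \<open>g\<close> and of
  the one of the coefficients of \<open>h\<close>.\<close>

lemma lifts_conj:
  assumes g: "g \<in> Eg n ((\<lambda>v. [:v:]) ` V)" "d \<in> carrier_mat n n" "g * d = 1\<^sub>m n"
    and ij: "i < n" "j < n" "i \<noteq> j" and h: "h \<in> polys V"
  shows "lifts (g * addrow_mat n (pCons 0 h) i j * d)"
proof -
  note UU = is_subring_UNIV[where 'a="'r poly"]
  have one: "1 \<in> (\<lambda>s. [:f s:]) ` S" by (rule cd.S(1))
  obtain d' r' where d': "d' \<in> carrier_mat n n" "g * d' = 1\<^sub>m n" "d' * g = 1\<^sub>m n" and r': "r' \<in> (\<lambda>s. [:f s:]) ` S"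
    "\<forall>i<n. \<forall>j<n. i \<noteq> j \<longrightarrow> (\<forall>z\<in>range (map_poly f). g * addrow_mat n (r' * z) i j * d' \<in> Eg n (cd.mR 1))"
    using cd.conj_denominator[OF g(1) one] by blast
  have gc: "g \<in> carrier_mat n n" using Eg_carrier[OF g(1)] .
  have dd: "d = d'" using right_inverse_unique[OF gc g(2) d'(1) g(3) d'(3)] .
  obtain N where N: "N \<in> Eg n ((\<lambda>v. [:v:]) ` V)" "g * N = 1\<^sub>m n" "N * g = 1\<^sub>m n"
    using Eg_inverse[OF cd.V g(1)] by metis
  have dN: "d = N" using right_inverse_unique[OF gc g(2) Eg_carrier[OF N(1)] g(3) N(3)] .
  have const: "map_mat F M = M" if M: "M \<in> Eg n ((\<lambda>v. [:v:]) ` V)" and F: "\<And>v. F [:v:] = [:v:]"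
    for M and F :: "'s poly \<Rightarrow> 's poly"
  proof (rule eq_matI)
    fix a b assume "a < dim_row M" "b < dim_col M"
    moreover from this have "M $$ (a,b) \<in> (\<lambda>v. [:v:]) ` V"
      using matsD(2)[OF Eg_mats[OF cd.V M]] Eg_carrier[OF M] by auto
    ultimately show "map_mat F M $$ (a,b) = M $$ (a,b)" using F by auto
  qed auto
  have sc: "scale t [:v:] = [:v:]" "const_part [:v:] = [:v:]" for t v :: 's
    by (auto simp: scale_def const_part_def)
  obtain s1 where s1: "s1 \<in> S" "r' = [:f s1:]" using r'(1) by blast
  obtain s2 where s2: "s2 \<in> S" "\<And>t. smult (f s2) (scale (f t) h) \<in> range (map_poly f)"
    using scaled_in_range[OF h] by blast
  \<comment> \<open>The substitution brings one factor \<open>s\<close> out of the parameter: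
    \<open>s1\<close> for the conjugation by \<open>g\<close> and \<open>s2\<close> for the
    coefficients of \<open>h\<close>.\<close>
  define s where "s = s1 * s2"
  define P where "P = g * addrow_mat n (pCons 0 h) i j * d"
  have dc: "d \<in> carrier_mat n n" by fact
  have Pc: "P \<in> carrier_mat n n" using gc dc by (auto simp: P_def intro!: mult_carrier_mat)
  have mapP: "map_mat F P = g * addrow_mat n (F (pCons 0 h)) i j * d"
    if F: "hom_on UNIV F" "\<And>v. F [:v:] = [:v:]" for F
  proof -
    have "map_mat F P = map_mat F g * map_mat F (addrow_mat n (pCons 0 h) i j) * map_mat F d"
      unfolding P_def using gc dc by (subst hom_mat_mult[OF F(1), of _ n], simp_all add: hom_mat_mult[OF F(1), of _ n] mult_carrier_mat[of _ n n _ n])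
    then show ?thesis using const[OF g(1) F(2)] const[OF N(1) F(2)] ij
      by (simp add: dN map_addrow_mat hom_onD[OF F(1)])
  qed
  obtain w where w: "smult (f s2) (scale (f s) h) = map_poly f w" using s2(2) by blast
  have z: "pCons 0 (smult (f s2) (scale (f s) h)) = map_poly f (pCons 0 w)"
    unfolding w by (rule poly_eqI) (simp add: coeff_map_poly_hom[OF f] coeff_pCons hom_onD[OF f] split: nat.split)
  have "scale (f s) (pCons 0 h) = r' * pCons 0 (smult (f s2) (scale (f s) h))"
    by (rule poly_eqI) (simp add: s_def s1(2) coeff_scale coeff_pCons hom_onD[OF f] mult_ac split: nat.split)
  then have "map_mat (scale (f s)) P = g * addrow_mat n (r' * map_poly f (pCons 0 w)) i j * d"
    unfolding mapP[OF hom_scale sc(1)] z by simp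
  also have "\<dots> \<in> Eg n (cd.mR 1)" using r'(2) ij dd by blast
  finally have "map_mat (scale (f s)) P \<in> Eg n (range (map_poly f))" by simp
  then obtain C where C: "C \<in> Eg n UNIV" "map_mat (map_poly f) C = map_mat (scale (f s)) P"
    using Eg_lift[OF hom_map_poly[OF f], of "range (map_poly f)"] by auto
  \<comment> \<open>The lift need not be 1 at x = 0, but its value there maps to 1. Multiplying by
    the inverse of that value normalizes it without changing its image.\<close>
  define C0 where "C0 = map_mat const_part C"
  have C0: "C0 \<in> Eg n UNIV" unfolding C0_def using Eg_hom[OF hom_const_part _ C(1)] by blast
  obtain D where D: "D \<in> Eg n UNIV" "C0 * D = 1\<^sub>m n" using Eg_inverse[OF UU C0] by metis
  have c: "C0 \<in> carrier_mat n n" "D \<in> carrier_mat n n" "C \<in> carrier_mat n n"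
    using C0 D C Eg_carrier by auto
  have fC0: "map_mat (map_poly f) C0 = 1\<^sub>m n"
  proof -
    have "map_mat (map_poly f) C0 = map_mat const_part (map_mat (map_poly f) C)"
      by (simp add: C0_def map_mat_map_mat map_poly_const_part[OF f])
    also have "\<dots> = map_mat const_part P" by (simp add: C(2) map_mat_map_mat const_part_scale)
    also have "\<dots> = g * addrow_mat n 0 i j * d"
      unfolding mapP[OF hom_const_part sc(2)] by (simp add: const_part_def)
    also have "\<dots> = 1\<^sub>m n" using ij gc g(3) by (simp add: addrow_zero)
    finally show ?thesis .
  qed
  have "map_mat (map_poly f) (C0 * D) = 1\<^sub>m n"
    unfolding D(2) by (rule hom_on_mat_one[OF hom_map_poly[OF f]])
  then have fD: "map_mat (map_poly f) D = 1\<^sub>m n"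
    unfolding hom_mat_mult[OF hom_map_poly[OF f] c(1,2)] fC0 using c(2) by simp
  have "map_mat const_part (C0 * D) = 1\<^sub>m n"
    unfolding D(2) by (rule hom_on_mat_one[OF hom_const_part])
  then have "C0 * map_mat const_part D = 1\<^sub>m n"
    unfolding hom_mat_mult[OF hom_const_part c(1,2)] by (simp only: C0_def map_mat_map_mat const_part_scale)
  then have "map_mat const_part (C * D) = 1\<^sub>m n"
    unfolding hom_mat_mult[OF hom_const_part c(3,2)] by (simp only: C0_def)
  moreover have "map_mat (map_poly f) (C * D) = map_mat (scale (f s)) P"
    unfolding hom_mat_mult[OF hom_map_poly[OF f] c(3,2)] fD C(2) using Pc by simp
  moreover have "C * D \<in> Eg n UNIV" using C D by (intro Eg_mult)
  moreover have "s \<in> S" unfolding s_def by (rule S(2)[OF s1(1) s2(1)])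
  ultimately show ?thesis using Pc unfolding lifts_def P_def by blast
qed

text \<open>A parameter \<open>h0 + x h1\<close> splits into two transvections. Moving all constant
  ones to the right conjugates the others by constant elementary matrices, which is the form treated
  in \<open>lifts_conj\<close>.\<close>

lemma lifts_Eg:
  assumes "M \<in> Eg n (polys V)"
  shows "\<exists>N. lifts N \<and> M = N * map_mat const_part M"
  using assms
proof (induction rule: Eg.induct)
  case one
  have "map_mat (map_poly f) (1\<^sub>m n) = map_mat (scale (f 1)) (1\<^sub>m n :: 's poly mat)"
    by (simp only: hom_on_mat_one[OF hom_map_poly[OF f]] hom_on_mat_one[OF hom_scale])
  then have "lifts (1\<^sub>m n)" unfolding lifts_def
    using S(1) Eg.one[of n UNIV] hom_on_mat_one[OF hom_const_part] by (intro conjI bexI[of _ 1] bexI[of _ "1\<^sub>m n"]) auto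
  then show ?case by (intro exI[of _ "1\<^sub>m n"]) (simp add: hom_on_mat_one[OF hom_const_part])
next
  case (step M i j h)
  obtain N where N: "lifts N" "M = N * map_mat const_part M" using step.IH by blast
  have Mc: "M \<in> carrier_mat n n" using Eg_carrier[OF step.hyps(1)] .
  obtain h0 h1 where h: "h = pCons h0 h1" by (cases h)
  have h1: "h1 \<in> polys V" using polysD[OF step.hyps(5), of "Suc i" for i] by (intro polysI) (simp add: h)
  have h0: "h0 \<in> V" using polysD[OF step.hyps(5), of 0] by (simp add: h)
  define g where "g = map_mat const_part M * addrow_mat n [:h0:] i j"
  have homV: "hom_on (polys V) const_part"
    using hom_const_part is_subring_polys[OF V] unfolding hom_on_def by blast
  have "const_part ` polys V \<subseteq> (\<lambda>v. [:v:]) ` V" using polysD unfolding const_part_def by fast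
  then have "map_mat const_part M \<in> Eg n ((\<lambda>v. [:v:]) ` V)" by (rule Eg_hom[OF homV _ step.hyps(1)])
  then have g: "g \<in> Eg n ((\<lambda>v. [:v:]) ` V)" unfolding g_def using step.hyps h0 by (intro Eg.step) auto
  have gc: "g \<in> carrier_mat n n" using Eg_carrier[OF g] .
  obtain d where d: "d \<in> Eg n ((\<lambda>v. [:v:]) ` V)" "g * d = 1\<^sub>m n" "d * g = 1\<^sub>m n"
    using Eg_inverse[OF cd.V g] by metis
  have dc: "d \<in> carrier_mat n n" using Eg_carrier[OF d(1)] .
  have cg: "map_mat const_part (M * addrow_mat n h i j) = g"
    unfolding hom_mat_mult[OF hom_const_part Mc addrow_mat_carrier] g_def
    using step.hyps by (simp add: map_addrow_mat hom_onD[OF hom_const_part]) (simp add: const_part_def h)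
  have Nc: "N \<in> carrier_mat n n" using N(1) by (simp add: lifts_def)
  have "addrow_mat n h i j = addrow_mat n [:h0:] i j * addrow_mat n (pCons 0 h1) i j"
    using step.hyps by (intro eq_matI) (auto simp: h mult_addrow_entry[of _ n] simp del: index_mult_mat(1))
  then have "M * addrow_mat n h i j = N * (g * addrow_mat n (pCons 0 h1) i j)"
    using Nc Mc by (subst N(2)) (simp add: g_def assoc_mult_mat[of _ n n _ n _ n] mult_carrier_mat[of _ n n _ n])
  also have "g * addrow_mat n (pCons 0 h1) i j = g * addrow_mat n (pCons 0 h1) i j * (d * g)"
    using gc d(3) by (simp add: mult_carrier_mat[of _ n n _ n])
  also have "N * \<dots> = N * (g * addrow_mat n (pCons 0 h1) i j * d) * g"
    using Nc gc dc by (simp add: assoc_mult_mat[of _ n n _ n _ n] mult_carrier_mat[of _ n n _ n])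
  finally have "M * addrow_mat n h i j = N * (g * addrow_mat n (pCons 0 h1) i j * d) * map_mat const_part (M * addrow_mat n h i j)"
    unfolding cg .
  moreover have "lifts (N * (g * addrow_mat n (pCons 0 h1) i j * d))"
    using step.hyps by (intro lifts_mult N(1) lifts_conj[OF g dc d(2) _ _ _ h1])
  ultimately show ?case by blast
qed

text \<open>The image of \<open>B\<close> lifts, after scaling, to an elementary \<open>C\<close>.
  The quotient of the scaled \<open>B\<close> by \<open>C\<close> has image 1, so it differs from 1
  by coefficients in the kernel; another scaling makes these nilpotent, and
  \<open>Eg_if_cong_one_units\<close> applies.\<close>

lemma scaled_Eg:
  assumes B: "B \<in> carrier_mat n n" "det B = 1" "map_mat const_part B = 1\<^sub>m n"
    and fB: "map_mat (map_poly f) B \<in> Eg n (polys V)"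
  shows "\<exists>s\<in>S. map_mat (scale s) B \<in> Eg n UNIV"
proof -
  note UU = is_subring_UNIV[where 'a="'r poly"]
  obtain N where N: "lifts N" "map_mat (map_poly f) B = N * map_mat const_part (map_mat (map_poly f) B)"
    using lifts_Eg[OF fB] by blast
  have "map_mat const_part (map_mat (map_poly f) B) = map_mat (map_poly f) (map_mat const_part B)"
    by (simp add: map_mat_map_mat map_poly_const_part[OF f])
  also have "\<dots> = 1\<^sub>m n" unfolding B(3) by (rule hom_on_mat_one[OF hom_map_poly[OF f]])
  finally have "map_mat (map_poly f) B = N * 1\<^sub>m n" using N(2) by simp
  then have "N = map_mat (map_poly f) B" using N(1) by (auto simp: lifts_def)
  then obtain s C where s: "s \<in> S" and C: "C \<in> Eg n UNIV"
    "map_mat (map_poly f) C = map_mat (scale (f s)) (map_mat (map_poly f) B)" "map_mat const_part C = 1\<^sub>m n"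
    using N(1) unfolding lifts_def by blast
  define Bs where "Bs = map_mat (scale s) B"
  have fC: "map_mat (map_poly f) C = map_mat (map_poly f) Bs"
    unfolding C(2) Bs_def by (simp add: map_mat_map_mat map_poly_scale[OF f])
  obtain C' where C': "C' \<in> Eg n UNIV" "C * C' = 1\<^sub>m n" "C' * C = 1\<^sub>m n" using Eg_inverse[OF UU C(1)] by metis
  define D where "D = C' * Bs"
  have c: "C \<in> carrier_mat n n" "C' \<in> carrier_mat n n" "Bs \<in> carrier_mat n n" "D \<in> carrier_mat n n"
    using Eg_carrier[OF C(1)] Eg_carrier[OF C'(1)] B(1) by (auto simp: Bs_def D_def)
  have dBs: "det Bs = 1" unfolding Bs_def
    using hom_on_det[OF hom_scale, of B n s] B by (simp add: hom_onD[OF hom_scale])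
  have dD: "det D = 1" unfolding D_def using det_mult[OF c(2,3)] Eg_det[OF C'(1)] dBs by simp
  have fD: "map_mat (map_poly f) D = 1\<^sub>m n"
  proof -
    have "map_mat (map_poly f) D = map_mat (map_poly f) (C' * C)"
      unfolding D_def hom_mat_mult[OF hom_map_poly[OF f] c(2,3)] hom_mat_mult[OF hom_map_poly[OF f] c(2,1)] fC ..
    then show ?thesis unfolding C'(3) by (simp only: hom_on_mat_one[OF hom_map_poly[OF f]])
  qed
  have D0: "map_mat const_part D = 1\<^sub>m n"
  proof -
    have "map_mat const_part Bs = 1\<^sub>m n" unfolding Bs_def map_mat_map_mat const_part_scale by (rule B(3))
    then have "map_mat const_part D = map_mat const_part (C' * C)"
      unfolding D_def hom_mat_mult[OF hom_const_part c(2,3)] hom_mat_mult[OF hom_const_part c(2,1)] C(3) by simp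
    then show ?thesis unfolding C'(3) by (simp only: hom_on_mat_one[OF hom_const_part])
  qed
  define e where "e = (\<lambda>(i, j). D $$ (i,j) - (1\<^sub>m n $$ (i,j)))"
  define K where "K = (SIGMA (i, j) : {..<n} \<times> {..<n}. {..degree (e (i, j))})"
  have fe: "map_poly f (e (i, j)) = 0" "coeff (e (i, j)) 0 = 0" if ij: "i < n" "j < n" for i j
  proof -
    have "map_mat (map_poly f) D $$ (i,j) = 1\<^sub>m n $$ (i,j)" unfolding fD ..
    moreover have "map_poly f (1\<^sub>m n $$ (i,j)) = 1\<^sub>m n $$ (i,j)" using ij by (simp add: hom_onD[OF hom_map_poly[OF f]])
    ultimately show "map_poly f (e (i, j)) = 0" using ij c(4) by (simp add: e_def hom_onD(7)[OF hom_map_poly[OF f]])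
    have "const_part (D $$ (i,j)) = 1\<^sub>m n $$ (i,j)" using D0 ij c(4) by (metis carrier_matD(1,2) index_map_mat(1))
    then have "coeff (const_part (D $$ (i,j))) 0 = coeff (1\<^sub>m n $$ (i,j)) 0" by simp
    then show "coeff (e (i, j)) 0 = 0" by (simp add: e_def coeff_const_part)
  qed
  have "\<exists>t\<in>S. \<forall>k\<in>K. \<exists>N. t * coeff (e (fst k)) (snd k) ^ N = 0"
  proof (rule finite_multiplier[OF S])
    show "finite K" unfolding K_def by auto
    fix k assume "k \<in> K"
    then obtain i j l where k: "k = ((i, j), l)" "i < n" "j < n" by (auto simp: K_def)
    have "f (coeff (e (i, j)) l) = 0" using fe(1)[OF k(2,3)] coeff_map_poly_hom[OF f, of "e (i, j)" l] by simp
    then show "\<exists>t\<in>S. \<exists>N. t * coeff (e (fst k)) (snd k) ^ N = 0" using kernel by (simp add: k)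
  next
    fix s t k assume "\<exists>N. s * coeff (e (fst k)) (snd k) ^ N = 0"
    then obtain N where "s * coeff (e (fst k)) (snd k) ^ N = 0" by blast
    then have "t * s * coeff (e (fst k)) (snd k) ^ N = 0" by (simp add: mult.assoc)
    then show "\<exists>N. t * s * coeff (e (fst k)) (snd k) ^ N = 0" by blast
  qed
  then obtain t where t: "t \<in> S" "\<And>i j l. i < n \<Longrightarrow> j < n \<Longrightarrow> l \<le> degree (e (i, j)) \<Longrightarrow> \<exists>N. t * coeff (e (i, j)) l ^ N = 0"
    unfolding K_def by fastforce
  have nil: "scale t (e (i, j)) \<in> nilradical" if ij: "i < n" "j < n" for i j
  proof -
    have "coeff (scale t (e (i, j))) l \<in> nilradical" for l
    proof (cases "l = 0 \<or> l > degree (e (i, j))")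
      case True
      then have "coeff (scale t (e (i, j))) l = 0" using fe(2)[OF ij] by (auto simp: coeff_scale coeff_eq_0)
      then show ?thesis using ideal_inD(2)[OF ideal_in_nilradical] by simp
    next
      case False
      let ?c = "coeff (e (i, j)) l"
      obtain N where N: "t * ?c ^ N = 0" using t(2)[OF ij, of l] False by (metis leI)
      \<comment> \<open>As \<open>e\<close> has no constant term, scaling supplies at least one
        factor \<open>t\<close> to every coefficient, and \<open>t * ?c\<close> is
        nilpotent.\<close>
      obtain k where k: "l = Suc k" using False by (cases l) auto
      have "(t * ?c) ^ Suc N = (t * ?c ^ N) * (t ^ N * ?c)" by (simp add: power_mult_distrib mult_ac)
      then have "(t * ?c) ^ Suc N = 0" using N by simp
      then have "t * ?c \<in> nilradical" unfolding nilradical_def by blast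
      then have "t ^ k * (t * ?c) \<in> nilradical" by (rule ideal_inD(4)[OF ideal_in_nilradical UNIV_I])
      then show ?thesis by (simp add: coeff_scale k mult_ac)
    qed
    then show ?thesis using polys_nilradical polysI by blast
  qed
  have "cong_mat n nilradical (map_mat (scale t) D) (1\<^sub>m n)"
    unfolding cong_mat_def
  proof (intro allI impI)
    fix i j assume ij: "i < n" "j < n"
    have "scale t (1\<^sub>m n $$ (i,j)) = 1\<^sub>m n $$ (i,j)" using ij by (simp add: hom_onD[OF hom_scale])
    then have "map_mat (scale t) D $$ (i,j) - 1\<^sub>m n $$ (i,j) = scale t (e (i, j))"
      using ij c(4) by (simp add: e_def hom_onD(7)[OF hom_scale])
    then show "map_mat (scale t) D $$ (i,j) - 1\<^sub>m n $$ (i,j) \<in> nilradical" using nil[OF ij] by simp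
  qed
  moreover have "det (map_mat (scale t) D) = 1"
    using hom_on_det[OF hom_scale, of D n t] c(4) dD by (simp add: hom_onD[OF hom_scale])
  ultimately have "map_mat (scale t) D \<in> Eg n UNIV"
    using n c(4) by (intro Eg_if_cong_one_units[OF ideal_in_nilradical nilpotent_unit]) auto
  moreover have "map_mat (scale t) C \<in> Eg n UNIV" using C(1) by (auto intro: Eg_hom[OF hom_scale])
  ultimately have "map_mat (scale t) C * map_mat (scale t) D \<in> Eg n UNIV" by (rule Eg_mult[rotated])
  moreover have "Bs = C * D"
    unfolding D_def using c C'(2) by (subst assoc_mult_mat[symmetric, of C n n C' n Bs n]) auto
  then have "map_mat (scale t) C * map_mat (scale t) D = map_mat (scale t) Bs"
    by (simp only: hom_mat_mult[OF hom_scale c(1,4)])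
  then have "map_mat (scale t) C * map_mat (scale t) D = map_mat (scale (t * s)) B"
    by (simp add: Bs_def map_mat_map_mat scale_scale)
  ultimately show ?thesis using S(2)[OF t(1) s] by metis
qed

end

section \<open>The substitution of x + s y\<close>

lemma hom_poly: "hom_on UNIV g \<Longrightarrow> g (poly p x) = poly (map_poly g p) (g x)"
  by (induction p) (auto simp: hom_onD map_poly_pCons)

lemma poly_in_subring: "is_subring D \<Longrightarrow> p \<in> polys D \<Longrightarrow> x \<in> D \<Longrightarrow> poly p x \<in> D"
  unfolding poly_altdef by (intro subring_sum) (auto simp: is_subringD subring_power polysD)

lemma hom_const: "hom_on UNIV (\<lambda>a. [:a:])"
  by (simp add: hom_on_def)

lemma hom_const2: "hom_on UNIV (\<lambda>a :: 'a::comm_ring_1. [:[:a:]:])"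
  by (simp add: hom_on_def one_pCons)

lemma hom_poly_eval: "hom_on UNIV (\<lambda>p. poly p x)"
  by (simp add: hom_on_def)

lemma hom_comp: "hom_on UNIV f \<Longrightarrow> hom_on UNIV g \<Longrightarrow> hom_on UNIV (\<lambda>x. f (g x))"
  by (simp add: hom_on_def)

lemma hom_shift: "hom_on UNIV (shift s)"
  unfolding shift_def by (rule hom_comp[OF hom_poly_eval hom_map_poly[OF hom_const2]])

lemma map_shift:
  assumes g: "hom_on UNIV g"
  shows "g (shift s p) = poly (map_poly (\<lambda>a. g [:[:a:]:]) p) (g [:[:0, 1:], [:s:]:])"
  unfolding shift_def hom_poly[OF g] by (subst map_poly_map_poly) (auto simp: hom_onD[OF g] comp_def)

lemma scale_shift: "scale [:t:] (shift s p) = shift (t * s) p"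
proof -
  have "scale [:t:] [:[:a:]:] = [:[:a:]:]" for a by (simp add: scale_def)
  moreover have "scale [:t:] [:[:0, 1:], [:s:]:] = [:[:0, 1:], [:t * s:]:]" by (simp add: scale_def pcompose_pCons mult.commute)
  ultimately show ?thesis unfolding map_shift[OF hom_scale] by (simp only: shift_def)
qed

lemma const_part_shift: "const_part (shift s p) = shift 0 p"
proof -
  have "const_part [:[:a:]:] = [:[:a:]:]" for a :: 'a by (simp add: const_part_def)
  moreover have "const_part [:[:0, 1:], [:s:]:] = [:[:0, 1:], [:0:]:]" by (simp add: const_part_def)
  ultimately show ?thesis unfolding map_shift[OF hom_const_part] by (simp only: shift_def)
qed

lemma map_poly_shift:
  assumes f: "hom_on UNIV f"
  shows "map_poly (map_poly f) (shift s p) = shift (f s) (map_poly f p)"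
proof -
  have "map_poly (map_poly f) [:[:a:]:] = [:[:f a:]:]" for a
    by (simp add: map_poly_pCons hom_onD[OF f])
  moreover have "map_poly (map_poly f) [:[:0, 1:], [:s:]:] = [:[:0, 1:], [:f s:]:]"
    by (simp add: map_poly_pCons hom_onD[OF f])
  ultimately have "map_poly (map_poly f) (shift s p) = poly (map_poly (\<lambda>a. [:[:f a:]:]) p) [:[:0, 1:], [:f s:]:]"
    unfolding map_shift[OF hom_map_poly[OF hom_map_poly[OF f]]] by simp
  also have "\<dots> = shift (f s) (map_poly f p)"
    unfolding shift_def by (subst map_poly_map_poly) (auto simp: hom_onD[OF f] comp_def)
  finally show ?thesis .
qed

lemma shift_polys:
  assumes D: "is_subring D" and "s \<in> D" "p \<in> polys D"
  shows "shift s p \<in> polys (polys D)"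
  unfolding shift_def
proof (rule poly_in_subring)
  note P = is_subring_polys[OF D]
  show "is_subring (polys (polys D))" using is_subring_polys[OF P] .
  show "map_poly (\<lambda>a. [:[:a:]:]) p \<in> polys (polys (polys D))"
    using assms(3) by (intro polysI) (auto simp: coeff_map_poly polys_const_iff is_subringD[OF D] is_subringD[OF P] polysD)
  show "[:[:0, 1:], [:s:]:] \<in> polys (polys D)"
    using assms(2) by (auto intro!: polysI simp: coeff_pCons is_subringD[OF D] is_subringD[OF P] split: nat.split)
qed

lemma torsion_nil_subset: "prime_in UNIV m \<Longrightarrow> torsion_nil m \<subseteq> m"
proof
  fix a assume m: "prime_in UNIV m" and "a \<in> torsion_nil m"
  then obtain s N where s: "s \<notin> m" "s * a ^ N = 0" by (auto simp: torsion_nil_def)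
  have "s * a ^ N \<in> m" unfolding s(2) using ideal_inD(2)[OF prime_inD(1)[OF m]] .
  then have "a ^ N \<in> m" using prime_inD(3)[OF m] s(1) by blast
  then show "a \<in> m" using prime_in_power[OF m is_subring_UNIV] by blast
qed

lemma prime_compl:
  "prime_in UNIV m \<Longrightarrow> 1 \<in> - m" "prime_in UNIV m \<Longrightarrow> s \<in> - m \<Longrightarrow> t \<in> - m \<Longrightarrow> s * t \<in> - m"
  using prime_inD(2,3)[of UNIV m] by auto

lemma SL_inverse:
  fixes A :: "'a::comm_ring_1 mat"
  assumes A: "A \<in> carrier_mat n n" "det A = 1"
  obtains A' where "A' \<in> carrier_mat n n" "det A' = 1" "A * A' = 1\<^sub>m n" "A' * A = 1\<^sub>m n"
proof -
  note adj = adj_mat[OF A(1), unfolded A(2)]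
  have "A * adj_mat A = 1\<^sub>m n" "adj_mat A * A = 1\<^sub>m n" using adj(2,3) by (auto intro!: eq_matI)
  moreover from this have "det (adj_mat A) = 1" using det_mult[OF adj(1) A(1)] A(2) by simp
  ultimately show thesis using that adj(1) by blast
qed

text \<open>Over the residue field of the chosen \<open>cJ\<close>, the theorem for valuation rings
  makes A(x)^-1 A(x + y) elementary. Clearing denominators by scaling y puts some element outside
  \<open>m\<close> into Quillen's ideal.\<close>

lemma no_quillen_failure:
  fixes J :: "'a::comm_ring_1 set"
  shows "\<not> quillen_failure J"
proof
  assume "quillen_failure J"
  then have cD: "cD = (UNIV :: 'a set)" and qf: "quillen_failure (cJ :: 'a set)"
    using chosen_quillen no_val_failure by blast+
  obtain n :: nat and A :: "'a poly mat" and m where n: "n \<ge> 3" and A: "A \<in> carrier_mat n n" "det A = 1"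
    and m: "prime_in UNIV m" and qm: "quillen n A \<subseteq> m"
    and val: "\<And>a b. \<exists>s r. s \<notin> m \<and> (s * a = r * b \<or> s * b = r * a)" and J: "cJ = torsion_nil m"
    using qf unfolding quillen_failure_def by blast
  have res: "hom_on UNIV (res :: 'a \<Rightarrow> _)" using hom_on_res[where 'a='a] unfolding cD .
  have res0: "res a = 0 \<longleftrightarrow> a \<in> torsion_nil m" for a :: 'a using res_eq_0_iff[of a] unfolding cD J by simp
  have unit: "res s \<noteq> 0" if "s \<notin> m" for s using res0 torsion_nil_subset[OF m] that by blast
  note mc = prime_compl[OF m]
  \<comment> \<open>The image of the localization at \<open>m\<close> in the residue field.\<close>
  define V where "V = {res a / res s | a s. s \<notin> m}"
  have VI: "res s \<noteq> 0 \<Longrightarrow> res s * x = res a \<Longrightarrow> s \<notin> m \<Longrightarrow> x \<in> V" for a s x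
    using nonzero_eq_divide_eq[of "res s" x "res a"] unfolding V_def by (auto simp: mult.commute)
  have resV: "res a \<in> V" for a using VI[of 1 "res a" a] unit[of 1] mc(1) by (simp add: hom_onD[OF res])
  have V: "is_subring V"
    unfolding is_subring_def
  proof (intro conjI ballI)
    show "0 \<in> V" "1 \<in> V" using resV[of 0] resV[of 1] by (simp_all add: hom_onD[OF res])
    fix x assume "x \<in> V"
    then obtain a s where x: "x = res a / res s" "s \<notin> m" by (auto simp: V_def)
    show "- x \<in> V" using unit[OF x(2)] by (intro VI[of s _ "- a"] x(2)) (simp_all add: x(1) hom_onD[OF res])
    fix y assume "y \<in> V"
    then obtain b t where y: "y = res b / res t" "t \<notin> m" by (auto simp: V_def)
    have st: "s * t \<notin> m" using mc(2) x(2) y(2) by simp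
    show "x + y \<in> V" using unit[OF x(2)] unit[OF y(2)] unit[OF st]
      by (intro VI[of "s * t" _ "a * t + b * s"] st) (simp_all add: x(1) y(1) hom_onD[OF res] distrib_left mult.commute)
    show "x * y \<in> V" using unit[OF x(2)] unit[OF y(2)] unit[OF st]
      by (intro VI[of "s * t" _ "a * b"] st) (simp_all add: x(1) y(1) hom_onD[OF res])
  qed
  interpret valuation_subring V
  proof
    fix x :: "'a resfrac"
    obtain a s where x: "x = res a / res s" "s \<notin> (cJ :: 'a set)" using resfrac_cases[of x] by metis
    have s0: "res s \<noteq> 0" using x(2) res0 unfolding J by blast
    obtain t r where t: "t \<notin> m" "t * a = r * s \<or> t * s = r * a" using val[of a s] by blast
    from t(2) show "x \<in> V \<or> inverse x \<in> V"
    proof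
      assume "t * a = r * s"
      then have "res t * res a = res r * res s" using hom_onD(4)[OF res] by (metis UNIV_I)
      then have "res t * x = res r" using s0 by (simp add: x(1))
      then show ?thesis using VI[OF unit[OF t(1)] _ t(1)] by blast
    next
      assume "t * s = r * a"
      then have e: "res t * res s = res r * res a" using hom_onD(4)[OF res] by (metis UNIV_I)
      then have "res a \<noteq> 0" using unit[OF t(1)] s0 by auto
      then have "res t * inverse x = res r" using e by (simp add: x(1) field_simps)
      then show ?thesis using VI[OF unit[OF t(1)] _ t(1)] by blast
    qed
  qed (rule V)
  have den: "\<exists>s\<in>- m. \<exists>a. res s * v = res a" if v: "v \<in> V" for v
  proof -
    obtain a s where "v = res a / res s" "s \<notin> m" using v by (auto simp: V_def)
    then have "res s * v = res a" "s \<in> - m" using unit by simp_all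
    then show ?thesis by blast
  qed
  interpret p: poly_denominators n res "- m" V
  proof
    show "\<exists>s\<in>- m. \<exists>N. s * a ^ N = 0" if "res a = 0" for a
      using that unfolding res0 torsion_nil_def by auto
  qed (use n res V mc den in auto)
  \<comment> \<open>A common multiplier makes all coefficients nilpotent, hence the polynomial too;
    so the kernel condition passes from \<open>res\<close> to polynomials.\<close>
  have kernel: "\<exists>s\<in>(\<lambda>s. [:s:]) ` (- m). \<exists>N. s * p ^ N = 0" if p: "map_poly res p = 0" for p :: "'a poly"
  proof -
    have "\<exists>s\<in>- m. \<forall>i\<in>{..degree p}. \<exists>N. s * coeff p i ^ N = 0"
    proof (rule finite_multiplier[OF mc])
      fix i
      have "res (coeff p i) = 0" using p coeff_map_poly_hom[OF res, of p i] by simp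
      then show "\<exists>s\<in>- m. \<exists>N. s * coeff p i ^ N = 0" by (rule p.kernel)
    next
      fix s t i assume "\<exists>N. s * coeff p i ^ N = 0"
      then obtain N where "s * coeff p i ^ N = 0" by blast
      then have "t * s * coeff p i ^ N = 0" by (simp add: mult.assoc)
      then show "\<exists>N. t * s * coeff p i ^ N = 0" by blast
    qed auto
    then obtain s where s: "s \<in> - m" "\<And>i. i \<le> degree p \<Longrightarrow> \<exists>N. s * coeff p i ^ N = 0" by auto
    have "coeff (smult s p) i \<in> nilradical" for i
    proof (cases "i \<le> degree p")
      case True
      let ?c = "coeff p i"
      obtain N where N: "s * ?c ^ N = 0" using s(2)[OF True] by blast
      have "(s * ?c) ^ Suc N = (s * ?c ^ N) * (s ^ N * ?c)" by (simp add: power_mult_distrib mult_ac)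
      then have "(s * ?c) ^ Suc N = 0" using N by simp
      then show ?thesis unfolding nilradical_def coeff_smult by blast
    qed (use ideal_inD(2)[OF ideal_in_nilradical] in \<open>simp add: coeff_eq_0\<close>)
    then have "smult s p \<in> nilradical" using polys_nilradical polysI by blast
    then obtain N where "smult s p ^ N = 0" by (auto simp: nilradical_def)
    then have "[:s ^ N:] * p ^ N = 0" by (simp add: smult_power)
    moreover have "s ^ N \<in> - m" using prime_in_power[OF m is_subring_UNIV, of s N] s(1) by auto
    ultimately show ?thesis by blast
  qed
  \<comment> \<open>Denominators are cleared over R[x] with y as the scaled variable, but only
    constants of R serve as denominators; hence the result is again an element outside
    \<open>m\<close>.\<close>
  interpret pp: poly_denominators n "map_poly res :: 'a poly \<Rightarrow> _" "(\<lambda>s. [:s:]) ` (- m)" "polys V"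
  proof
    show "hom_on UNIV (map_poly (res :: 'a \<Rightarrow> _))" by (rule hom_map_poly[OF res])
    show "is_subring (polys V)" by (rule is_subring_polys[OF V])
    show "1 \<in> (\<lambda>s. [:s:]) ` (- m)" using mc(1) by (metis imageI one_pCons)
    show "s * t \<in> (\<lambda>s. [:s:]) ` (- m)" if st: "s \<in> (\<lambda>s. [:s:]) ` (- m)" "t \<in> (\<lambda>s. [:s:]) ` (- m)" for s t
    proof -
      obtain a b where "s = [:a:]" "t = [:b:]" "a \<in> - m" "b \<in> - m" using st by blast
      moreover from this have "s * t = [:a * b:]" by (simp add: mult.commute)
      ultimately show ?thesis using mc(2) by blast
    qed
    fix v assume v: "v \<in> polys V"
    obtain s where s: "s \<in> - m" "smult (res s) (scale (res 1) v) \<in> range (map_poly res)"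
      using p.scaled_in_range[OF v] by blast
    have "scale 1 v = v" by (rule poly_eqI) (simp add: coeff_scale)
    moreover have "map_poly res [:s:] = [:res s:]" by (simp add: map_poly_pCons hom_onD[OF res])
    ultimately have "map_poly res [:s:] * v = smult (res s) (scale (res 1) v)" by (simp add: hom_onD[OF res])
    then show "\<exists>s\<in>(\<lambda>s. [:s:]) ` (- m). \<exists>a. map_poly res s * v = map_poly res a"
      using s by (intro bexI[of _ "[:s:]"]) auto
  qed (use n kernel in auto)
  obtain A' where A': "A' \<in> carrier_mat n n" "det A' = 1" "A * A' = 1\<^sub>m n" "A' * A = 1\<^sub>m n"
    using SL_inverse[OF A] by metis
  \<comment> \<open>This is A(x)^-1 A(x + y). It is 1 at y = 0, and scaling y by \<open>t\<close>
    turns it into A(x)^-1 A(x + t y).\<close>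
  define B where "B = map_mat (shift 0) A' * map_mat (shift 1) A"
  have c: "map_mat (shift s) A \<in> carrier_mat n n" "map_mat (shift s) A' \<in> carrier_mat n n" for s
    using A A' by auto
  have sd: "det (map_mat (shift s) A) = 1" "det (map_mat (shift s) A') = 1" for s
    using hom_on_det[OF hom_shift, of A n s] hom_on_det[OF hom_shift, of A' n s] A A' by (simp_all add: hom_onD[OF hom_shift])
  have inv: "map_mat (shift s) A * map_mat (shift s) A' = 1\<^sub>m n" "map_mat (shift s) A' * map_mat (shift s) A = 1\<^sub>m n" for s
    by (simp_all only: A'(3,4) hom_on_mat_one[OF hom_shift] flip: hom_mat_mult[OF hom_shift A(1) A'(1)] hom_mat_mult[OF hom_shift A'(1) A(1)])
  have scB: "map_mat (scale [:t:]) B = map_mat (shift 0) A' * map_mat (shift t) A" for t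
    unfolding B_def hom_mat_mult[OF hom_scale c(2,1)] map_mat_map_mat scale_shift by simp
  have "map_mat const_part B = map_mat (shift 0) A' * map_mat (shift 0) A"
    unfolding B_def hom_mat_mult[OF hom_const_part c(2,1)] map_mat_map_mat const_part_shift ..
  then have B0: "map_mat const_part B = 1\<^sub>m n" using inv(2) by simp
  have SLE: "map_mat (map_poly (map_poly res)) (map_mat (shift s) M) \<in> Eg n (polys (polys V))"
    if M: "M \<in> carrier_mat n n" "det M = 1" and s: "res s \<in> V" for M s
  proof -
    have "map_poly res p \<in> polys V" for p :: "'a poly"
      using resV by (intro polysI) (simp add: coeff_map_poly_hom[OF res])
    then have "map_mat (map_poly res) M \<in> mats n (polys V)" using M by (auto simp: mats_def)
    moreover have "det (map_mat (map_poly res) M) = 1"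
      using hom_on_det[OF hom_map_poly[OF res], of M n] M by (simp add: hom_onD[OF hom_map_poly[OF res]])
    ultimately have E: "map_mat (map_poly res) M \<in> Eg n (polys V)" by (intro SL_valuation_poly[OF n])
    have h: "hom_on (polys V) (shift (res s))"
      using hom_shift[of "res s"] is_subring_polys[OF V] unfolding hom_on_def by blast
    have "shift (res s) ` polys V \<subseteq> polys (polys V)" using shift_polys[OF V s] by blast
    from Eg_hom[OF h this E] show ?thesis by (simp add: map_mat_map_mat map_poly_shift[OF res])
  qed
  have "map_mat (map_poly (map_poly res)) B \<in> Eg n (polys (polys V))"
    unfolding B_def hom_mat_mult[OF hom_map_poly[OF hom_map_poly[OF res]] c(2,1)]
    using A A' is_subringD(1,2)[OF V] by (intro Eg_mult SLE) (auto simp: hom_onD[OF res])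
  moreover have "B \<in> carrier_mat n n" "det B = 1"
    unfolding B_def using c sd det_mult[OF c(2,1)] by auto
  ultimately obtain t where t: "t \<in> - m" "map_mat (scale [:t:]) B \<in> Eg n UNIV"
    using pp.scaled_Eg B0 by blast
  have "map_mat (shift 0) A * (map_mat (shift 0) A' * map_mat (shift t) A) = map_mat (shift t) A"
    using c inv(1) by (subst assoc_mult_mat[symmetric, of _ n n _ n _ n]) auto
  then have "t \<in> quillen n A"
    unfolding quillen_def mem_Collect_eq by (rule bexI[OF sym t(2)[unfolded scB]])
  then show False using qm t(1) by blast
qed

text \<open>Multiples arise by scaling y in the defining relation, sums by composing two
  shifts.\<close>

lemma quillen_ideal:
  fixes A :: "'a::comm_ring_1 poly mat"
  assumes A: "A \<in> carrier_mat n n"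
  shows "ideal_in UNIV (quillen n A)"
  unfolding ideal_in_def
proof (intro conjI ballI)
  have c: "map_mat (shift s) A \<in> carrier_mat n n" for s using A by simp
  have "map_mat (shift 0) A = map_mat (shift 0) A * 1\<^sub>m n" using A by simp
  then show "0 \<in> quillen n A" unfolding quillen_def using Eg.one by blast
  fix s r assume r: "r \<in> quillen n A"
  then obtain F where F: "F \<in> Eg n UNIV" "map_mat (shift r) A = map_mat (shift 0) A * F"
    by (auto simp: quillen_def)
  have "map_mat (shift (s * r)) A = map_mat (scale [:s:]) (map_mat (shift r) A)"
    by (simp add: map_mat_map_mat scale_shift)
  also have "\<dots> = map_mat (shift 0) A * map_mat (scale [:s:]) F"
    unfolding F(2) hom_mat_mult[OF hom_scale c Eg_carrier[OF F(1)]] map_mat_map_mat scale_shift by simp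
  finally show "s * r \<in> quillen n A"
    unfolding quillen_def using Eg_hom[OF hom_scale _ F(1), of _ UNIV] by blast
  assume s: "s \<in> quillen n A"
  then obtain E where E: "E \<in> Eg n UNIV" "map_mat (shift s) A = map_mat (shift 0) A * E"
    by (auto simp: quillen_def)
  \<comment> \<open>The substitution of x + s y for x that fixes y. It turns A(x + r y) = A(x) F
    into a relation between A(x + (s + r) y) and A(x + s y).\<close>
  define g where "g = (\<lambda>P. poly (map_poly (shift s) P) [:0, 1 :: 'a poly:])"
  have g: "hom_on UNIV g" unfolding g_def by (rule hom_comp[OF hom_poly_eval hom_map_poly[OF hom_shift]])
  have gs: "g (shift t p) = shift (s + t) p" for t p
  proof -
    have e: "shift s [:a:] = [:[:a:]:]" "shift s [:0, 1:] = [:[:0, 1:], [:s:]:]" for a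
      by (simp_all add: shift_def map_poly_pCons)
    have "g [:[:a:]:] = [:[:a:]:]" for a
      by (simp add: g_def map_poly_pCons hom_onD[OF hom_shift] e)
    moreover have "g [:[:0, 1:], [:t:]:] = [:[:0, 1:], [:s + t:]:]"
      by (simp add: g_def map_poly_pCons hom_onD[OF hom_shift] e)
    ultimately show ?thesis unfolding map_shift[OF g] by (simp add: shift_def)
  qed
  have "map_mat (shift (s + r)) A = map_mat g (map_mat (shift r) A)" by (simp add: map_mat_map_mat gs)
  also have "\<dots> = map_mat (shift s) A * map_mat g F"
    unfolding F(2) hom_mat_mult[OF g c Eg_carrier[OF F(1)]] map_mat_map_mat gs by simp
  also have "\<dots> = map_mat (shift 0) A * (E * map_mat g F)"
    unfolding E(2) using Eg_carrier[OF E(1)] Eg_carrier[OF F(1)] A by (intro assoc_mult_mat) auto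
  finally show "s + r \<in> quillen n A"
    unfolding quillen_def using Eg_mult[OF E(1) Eg_hom[OF g _ F(1), of UNIV]] by blast
qed simp

lemma quillen_one:
  fixes A :: "'a::comm_ring_1 poly mat"
  assumes A: "A \<in> carrier_mat n n" and 1: "1 \<in> quillen n A"
  shows "\<exists>E\<in>Eg n UNIV. A = map_mat const_part A * E"
proof -
  obtain E where E: "E \<in> Eg n UNIV" "map_mat (shift 1) A = map_mat (shift 0) A * E"
    using 1 by (auto simp: quillen_def)
  \<comment> \<open>Sets the inner variable x to 0; the outer variable y then takes the place of
    x.\<close>
  define h where "h = map_poly (\<lambda>p :: 'a poly. poly p 0)"
  have h: "hom_on UNIV h" unfolding h_def by (rule hom_map_poly[OF hom_poly_eval])
  have hs: "h (shift s p) = scale s p" for s p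
  proof -
    have "h [:[:a:]:] = [:a:]" for a by (simp add: h_def map_poly_pCons)
    moreover have "h [:[:0, 1:], [:s:]:] = [:0, s:]" by (simp add: h_def map_poly_pCons)
    moreover have "poly (map_poly (\<lambda>a. [:a:]) p) [:0, s:] = pcompose p [:0, s:]"
      by (induction p) (auto simp: pcompose_pCons map_poly_pCons)
    ultimately show ?thesis unfolding map_shift[OF h] scale_def by simp
  qed
  have "scale 0 p = const_part p" "scale 1 p = p" for p :: "'a poly"
    by (auto intro!: poly_eqI simp: coeff_scale coeff_const_part power_0_left)
  then have hh: "map_mat h (map_mat (shift 0) A) = map_mat const_part A" "map_mat h (map_mat (shift 1) A) = A"
    by (auto intro!: eq_matI simp: hs)
  have "map_mat h (map_mat (shift 0) A * E) = map_mat const_part A * map_mat h E"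
    using A by (subst hom_mat_mult[OF h _ Eg_carrier[OF E(1)]]) (auto simp: hh)
  then have "A = map_mat const_part A * map_mat h E" using hh(2) unfolding E(2) by simp
  then show ?thesis using Eg_hom[OF h _ E(1), of UNIV] by blast
qed

text \<open>The arguments of \<open>radical_add\<close> and \<open>radical_prime\<close>, with
  divisibility holding only after multiplication by some \<open>t\<close> outside \<open>m\<close>;
  powers of \<open>t\<close> are collected in the annihilating factor.\<close>

lemma torsion_nil_prime:
  assumes m: "prime_in UNIV m"
    and val: "\<And>a b. \<exists>s r. s \<notin> m \<and> (s * a = r * b \<or> s * b = r * a)"
  shows "prime_in UNIV (torsion_nil m)"
  unfolding prime_in_def ideal_in_def
proof (intro conjI ballI impI)
  note mc = prime_compl[OF m]
  have I: "a \<in> torsion_nil m" if "s \<notin> m" "s * a ^ N = 0" for a s N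
    using that unfolding torsion_nil_def by blast
  show "0 \<in> torsion_nil m" using I[of 1 0 1] mc(1) by simp
  show "1 \<notin> torsion_nil m" using torsion_nil_subset[OF m] mc(1) by blast
  fix a b
  have add: "a + b \<in> torsion_nil m" if t: "t \<notin> m" "t * a = r * b" and b: "b \<in> torsion_nil m" for a b t r
  proof -
    obtain u M where u: "u \<notin> m" "u * b ^ M = 0" using b by (auto simp: torsion_nil_def)
    have "t ^ M \<notin> m" using prime_in_power[OF m is_subring_UNIV, of t M] t(1) by auto
    then have "u * t ^ M \<notin> m" using mc(2)[of u "t ^ M"] u(1) by simp
    moreover have "u * t ^ M * (a + b) ^ M = (r + t) ^ M * (u * b ^ M)"
    proof -
      have "t * (a + b) = (r + t) * b" using t(2) by (simp add: algebra_simps)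
      then have "t ^ M * (a + b) ^ M = (r + t) ^ M * b ^ M" by (simp flip: power_mult_distrib)
      then show ?thesis by (simp add: mult_ac)
    qed
    ultimately show ?thesis using I[of "u * t ^ M" "a + b" M] u(2) by simp
  qed
  obtain t r where t: "t \<notin> m" "t * a = r * b \<or> t * b = r * a" using val by blast
  show "a + b \<in> torsion_nil m" if "a \<in> torsion_nil m" "b \<in> torsion_nil m"
    using t(2) add[OF t(1), of a r b] add[OF t(1), of b r a] that by (auto simp: add.commute)
  show "a * b \<in> torsion_nil m" if b: "b \<in> torsion_nil m"
  proof -
    obtain u M where u: "u \<notin> m" "u * b ^ M = 0" using b by (auto simp: torsion_nil_def)
    have "u * (a * b) ^ M = a ^ M * (u * b ^ M)" by (simp add: power_mult_distrib mult_ac)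
    then show ?thesis using I[of u "a * b" M] u by simp
  qed
  show "a \<in> torsion_nil m \<or> b \<in> torsion_nil m" if ab: "a * b \<in> torsion_nil m"
  proof -
    have mul: "a \<in> torsion_nil m" if t: "t \<notin> m" "t * a = r * b" and ab: "a * b \<in> torsion_nil m" for a b t r
    proof -
      obtain u M where u: "u \<notin> m" "u * (a * b) ^ M = 0" using ab by (auto simp: torsion_nil_def)
      have "t ^ M \<notin> m" using prime_in_power[OF m is_subring_UNIV, of t M] t(1) by auto
      then have ut: "u * t ^ M \<notin> m" using mc(2)[of u "t ^ M"] u(1) by simp
      have "t * (a * a) = r * (a * b)" using t(2) by (metis mult.assoc mult.commute)
      then have "t ^ M * (a * a) ^ M = r ^ M * (a * b) ^ M" by (simp flip: power_mult_distrib)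
      then have "u * t ^ M * (a * a) ^ M = r ^ M * (u * (a * b) ^ M)" by (simp add: mult_ac)
      moreover have "(a * a) ^ M = a ^ (2 * M)" by (simp add: power_mult power2_eq_square)
      ultimately show ?thesis using I[OF ut, of a "2 * M"] u(2) by simp
    qed
    show ?thesis using t(2) mul[OF t(1), of a r b] mul[OF t(1), of b r a] ab by (auto simp: mult.commute)
  qed
qed simp

section \<open>From carrier-based arithmetical rings to types\<close>

lemma ring_of_type_algebra_simps [simp]:
  "carrier ring_of_type_algebra = (UNIV :: 'a::comm_ring_1 set)"
  "x \<otimes>\<^bsub>ring_of_type_algebra\<^esub> y = x * (y :: 'a)" "x \<oplus>\<^bsub>ring_of_type_algebra\<^esub> y = x + (y :: 'a)"
  "\<one>\<^bsub>ring_of_type_algebra\<^esub> = (1 :: 'a)" "\<zero>\<^bsub>ring_of_type_algebra\<^esub> = (0 :: 'a)"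
  by (simp_all add: ring_of_type_algebra_def)

lemma ideal_ring_of_type_algebra:
  fixes I :: "'a::comm_ring_1 set"
  shows "ideal I ring_of_type_algebra \<longleftrightarrow> ideal_in UNIV I"
proof
  interpret cring "ring_of_type_algebra :: 'a ring" by (rule cring_from_type_algebra)
  show "ideal_in UNIV I" if "ideal I ring_of_type_algebra"
  proof -
    interpret I: ideal I ring_of_type_algebra by fact
    show ?thesis unfolding ideal_in_def
      using I.zero_closed I.a_closed I.I_l_closed by auto
  qed
  assume I: "ideal_in UNIV I"
  have inv: "\<ominus>\<^bsub>ring_of_type_algebra\<^esub> x = - x" for x :: 'a
    by (rule minus_equality) auto
  show "ideal I ring_of_type_algebra"
    using ideal_inD[OF I] ideal_in_uminus[OF is_subring_UNIV I] inv
    by (intro idealI[OF ring_axioms] subgroup.intro) (auto simp: a_inv_def)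
qed

text \<open>One of the fractions \<open>a / 1\<close> and \<open>b / 1\<close> divides the other in
  the localization. Unfolding equality of fractions and multiplying by the denominators gives a
  relation in the ring itself.\<close>

lemma arithmetical_ring_relation:
  fixes a b :: "'a::comm_ring_1"
  assumes ar: "arithmetical_ring (ring_of_type_algebra :: 'a ring)" and m: "max_ideal m"
  shows "\<exists>s r. s \<notin> m \<and> (s * a = r * b \<or> s * b = r * a)"
proof -
  let ?R = "ring_of_type_algebra :: 'a ring"
  interpret cring ?R by (rule cring_from_type_algebra)
  have mi: "ideal_in UNIV m" "1 \<notin> m" using m by (auto simp: max_ideal_def)
  have max: "maximalideal m ?R"
  proof (rule maximalidealI)
    show "ideal m ?R" using mi by (simp add: ideal_ring_of_type_algebra)
    show "carrier ?R \<noteq> m" using mi by auto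
    fix J assume J: "ideal J ?R" "m \<subseteq> J"
    show "J = m \<or> J = carrier ?R"
    proof (cases "1 \<in> J")
      case True
      then have "x \<in> J" for x using ideal_inD(4)[of UNIV J x 1] J(1) by (simp add: ideal_ring_of_type_algebra)
      then show ?thesis by auto
    next
      case False
      then show ?thesis using m J unfolding max_ideal_def ideal_ring_of_type_algebra by blast
    qed
  qed
  define S where "S = carrier ?R - m"
  have S: "s \<in> S \<longleftrightarrow> s \<notin> m" for s by (simp add: S_def)
  interpret L: cring_localization ?R S
    unfolding S_def
    by (rule cring_localization.intro[OF is_cring cring_localization_axioms.intro[OF submonoid_compl_maximalideal[OF max]]])
  let ?L = "localization ?R S"
  have "valuation_ring ?L" using ar max unfolding arithmetical_ring_def S_def by blast
  then have val: "\<forall>x\<in>carrier ?L. \<forall>y\<in>carrier ?L. x divides\<^bsub>?L\<^esub> y \<or> y divides\<^bsub>?L\<^esub> x"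
    using cring.valuation_ring_iff[OF L.cring_localization] by blast
  have one: "1 \<in> S" using mi(2) by (simp add: S)
  have div: "\<exists>s r. s \<notin> m \<and> s * b = r * a" if ab: "fraction ?R S a 1 divides\<^bsub>?L\<^esub> fraction ?R S b 1" for a b
  proof -
    obtain P where P: "P \<in> carrier ?L" "fraction ?R S b 1 = fraction ?R S a 1 \<otimes>\<^bsub>?L\<^esub> P"
      using ab unfolding factor_def by blast
    obtain c s where c: "s \<in> S" "P = fraction ?R S c s" using L.localization_carrierE[OF P(1)] by metis
    have "fraction ?R S b 1 = fraction ?R S (a * c) s"
      using P(2) c one L.localization_mult[of a c 1 s] by simp
    then obtain u where u: "u \<in> S" "u * (b * s) = u * (a * c)"
      using L.fraction_eq_iff[of b "a * c" 1 s] c(1) one by auto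
    have "u * s \<in> S" using L.S_mult[OF u(1) c(1)] by simp
    moreover have "u * s * b = u * c * a" using u(2) by (simp add: mult_ac)
    ultimately show ?thesis unfolding S by blast
  qed
  have "fraction ?R S a 1 \<in> carrier ?L" "fraction ?R S b 1 \<in> carrier ?L" using one by auto
  then show ?thesis using val div by blast
qed

lemma SL_poly_decomposition:
  fixes A :: "'a::comm_ring_1 poly mat"
  assumes ar: "arithmetical_ring (ring_of_type_algebra :: 'a ring)" and n: "n \<ge> 3"
    and A: "A \<in> carrier_mat n n" "det A = 1"
  shows "\<exists>E\<in>Eg n UNIV. A = map_mat const_part A * E"
proof (cases "1 \<in> quillen n A")
  case False
  then obtain m where m: "max_ideal m" "quillen n A \<subseteq> m"
    using ex_max_ideal[OF quillen_ideal[OF A(1)]] by blast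
  note val = arithmetical_ring_relation[OF ar m(1)]
  have "quillen_failure (torsion_nil m)"
    unfolding quillen_failure_def
    using torsion_nil_prime[OF max_ideal_prime[OF m(1)] val] max_ideal_prime[OF m(1)] n A m(2) val by blast
  then show ?thesis using no_quillen_failure by blast
qed (rule quillen_one[OF A(1)])

lemma Eg_subset_elementary_group: "Eg n UNIV \<subseteq> elementary_group n"
proof
  fix M :: "'a::comm_ring_1 mat" assume "M \<in> Eg n UNIV"
  then show "M \<in> elementary_group n"
  proof (induction rule: Eg.induct)
    case one
    show ?case using generate.one[of "SL n" "elementary_mats n"] by (simp add: elementary_group_def SL_def)
  next
    case (step M i j a)
    have "addrow_mat n a i j = 1\<^sub>m n + a \<cdot>\<^sub>m unit_mat n i j"
      using step.hyps(4) by (intro eq_matI) (auto simp: unit_mat_def)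
    then have "addrow_mat n a i j \<in> elementary_mats n"
      unfolding elementary_mats_def using step.hyps(2-4) by blast
    then have "addrow_mat n a i j \<in> generate (SL n) (elementary_mats n)" by (rule generate.incl)
    then have "M \<otimes>\<^bsub>SL n\<^esub> addrow_mat n a i j \<in> generate (SL n) (elementary_mats n)"
      using step.IH unfolding elementary_group_def by (rule generate.eng[rotated])
    then show ?case by (simp add: elementary_group_def SL_def)
  qed
qed

theorem theorem4p4:
  fixes n :: nat
  assumes "arithmetical_ring (ring_of_type_algebra :: 'a::comm_ring_1 ring)"
    and "n \<ge> 3"
  shows "carrier (SL n :: 'a poly mat monoid) =
    map_mat (\<lambda>a. [:a:]) ` carrier (SL n :: 'a mat monoid) <#>\<^bsub>SL n\<^esub> elementary_group n"
proof (intro equalityI subsetI)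
  fix A :: "'a poly mat" assume "A \<in> carrier (SL n)"
  then have A: "A \<in> carrier_mat n n" "det A = 1" by (auto simp: SL_def)
  obtain E where E: "E \<in> Eg n UNIV" "A = map_mat const_part A * E"
    using SL_poly_decomposition[OF assms A] by blast
  \<comment> \<open>Evaluation at 0 recovers the constant matrix over the base ring and preserves
    the determinant.\<close>
  define C where "C = map_mat (\<lambda>p. poly p 0) A"
  have "map_mat const_part A = map_mat (\<lambda>a. [:a:]) C"
    by (auto intro!: eq_matI simp: C_def const_part_def poly_0_coeff_0)
  moreover have "C \<in> carrier (SL n)"
    using A hom_on_det[OF hom_poly_eval, of A n 0] by (auto simp: SL_def C_def)
  moreover have "E \<in> elementary_group n" using E(1) Eg_subset_elementary_group by blast
  ultimately show "A \<in> map_mat (\<lambda>a. [:a:]) ` carrier (SL n) <#>\<^bsub>SL n\<^esub> elementary_group n"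
    using E(2) unfolding set_mult_def by (auto simp: SL_def)
next
  fix A :: "'a poly mat" assume "A \<in> map_mat (\<lambda>a. [:a:]) ` carrier (SL n) <#>\<^bsub>SL n\<^esub> elementary_group n"
  then obtain C E where CE: "C \<in> carrier (SL n)" "E \<in> elementary_group n"
    "A = map_mat (\<lambda>a. [:a:]) C \<otimes>\<^bsub>SL n\<^esub> E" by (auto simp: set_mult_def)
  have C: "C \<in> carrier_mat n n" "det C = 1" using CE(1) by (auto simp: SL_def)
  have "map_mat (\<lambda>a. [:a:]) C \<in> carrier (SL n)"
    using C hom_on_det[OF hom_const, of C n] by (auto simp: SL_def)
  moreover have "E \<in> carrier (SL n)" using CE(2) subgroup.subset[OF subgroup_elementary_group] by blast
  ultimately show "A \<in> carrier (SL n)"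
    unfolding CE(3) by (intro monoid.m_closed[OF group.is_monoid[OF group_SL]])
qed

end
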